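(* Let $\{|e_0\rangle,|e_1\rangle,|e_2\rangle,|e_3\rangle\}$ be an orthonormal basis of $\mathbb{C}^4$ and $\{|f_0\rangle,|f_1\rangle,|f_2\rangle\}$ an orthonormal basis of $\mathbb{C}^3$, and let $|\phi_\pm\rangle=(|f_1\rangle\pm|f_2\rangle)/\sqrt2$. Define the quantum channel $\Phi:\mathcal{L}(\mathbb{C}^4)\to\mathcal{L}(\mathbb{C}^3)$ by $\Phi(X)=\sum_{i=1}^3E_iXE_i^*$, where $$E_1=|f_0\rangle\langle e_0|+|f_1\rangle\langle e_1|,\qquad E_2=|\phi_+\rangle\langle e_2|,\qquad E_3=|\phi_-\rangle\langle e_3|.$$ Then, up to $*$-isomorphism, $$\max(\mathscr{T}(\Phi))=\{\mathbb{M}_2(\mathbb{C}),\ \mathbb{C}^3\},$$ and $\Phi$ has no dominating transmittable algebra.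
   Context: All Hilbert spaces are finite-dimensional and complex; all $C^*$-algebras are finite-dimensional and nonzero. $\mathcal{L}(\mathcal{H})$ is the algebra of linear operators on $\mathcal{H}$. A quantum channel is a linear, completely positive, trace-preserving map $\Phi:\mathcal{L}(\mathcal{H})\to\mathcal{L}(\mathcal{K})$; its adjoint $\Phi^*$ is defined by $\mathrm{Tr}(Y\Phi(X))=\mathrm{Tr}(\Phi^*(Y)X)$. Embedding: for $C^*$-algebras, $\mathscr{A}\leq\mathscr{B}$ means there is an injective (not necessarily unital) $*$-homomorphism $\mathscr{A}\to\mathscr{B}$. Correctability: a $*$-subalgebra $\mathscr{A}\subseteq\mathcal{L}(\mathcal{H})$ with unit projection $P$ (possibly $P\neq 1_{\mathcal{H}}$) is correctable for $\Phi:\mathcal{L}(\mathcal{H})\to\mathcal{L}(\mathcal{K})$ if, with $C=P\mathcal{H}$, $V:C\to\mathcal{H}$ the inclusion and $\Phi|_C(Y)=\Phi(VYV^* )$, there is a channel $\mathcal{D}:\mathcal{L}(\mathcal{K})\to\mathcal{L}(C)$ with $(\mathcal{D}\circ\Phi|_C)^*(X)=X$ for all $X\in V^*\mathscr{A}V$. Transmittability: $\mathscr{A}$ is transmittable via $\Phi$ if there is an injective $*$-homomorphism $\pi:\mathscr{A}\to\mathcal{L}(\mathcal{H})$ whose image is correctable for $\Phi$. $\mathscr{T}(\Phi)$ is the set of $C^*$-algebras transmittable via $\Phi$, identified up to $*$-isomorphism. $\max(\mathscr{T}(\Phi))$ is the set of maximal elements: those $\mathscr{A}\in\mathscr{T}(\Phi)$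 such that $\mathscr{B}\in\mathscr{T}(\Phi)$, $\mathscr{A}\leq\mathscr{B}$ imply $\mathscr{A}\cong\mathscr{B}$. A dominating transmittable algebra is an $\mathscr{A}\in\mathscr{T}(\Phi)$ such that $\mathscr{B}\leq\mathscr{A}$ for every $\mathscr{B}\in\mathscr{T}(\Phi)$. *)

theory Defs
  imports "Jordan_Normal_Form.Schur_Decomposition"
begin

section \<open>Finite-dimensional C*-algebras\<close>

record 'a cstar = "(complex, 'a) module" +
  star :: "'a \<Rightarrow> 'a"
  cnorm :: "'a \<Rightarrow> real"

text \<open>Nonzero finite-dimensional C*-algebras. These always have a unit, stored in the
  field \<open>one\<close>; completeness of the norm is automatic in finite dimension.\<close>

definition fd_cstar_algebra :: "('a, 'm) cstar_scheme \<Rightarrow> bool" where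
  "fd_cstar_algebra A \<longleftrightarrow>
     vectorspace class_ring A \<and> vectorspace.fin_dim class_ring A \<and>
     ring A \<and> carrier A \<noteq> {\<zero>\<^bsub>A\<^esub>} \<and>
     (\<forall>c. \<forall>x\<in>carrier A. \<forall>y\<in>carrier A.
        (c \<odot>\<^bsub>A\<^esub> x) \<otimes>\<^bsub>A\<^esub> y = c \<odot>\<^bsub>A\<^esub> (x \<otimes>\<^bsub>A\<^esub> y) \<and>
        x \<otimes>\<^bsub>A\<^esub> (c \<odot>\<^bsub>A\<^esub> y) = c \<odot>\<^bsub>A\<^esub> (x \<otimes>\<^bsub>A\<^esub> y)) \<and>
     (\<forall>x\<in>carrier A. star A x \<in> carrier A \<and> star A (star A x) = x) \<and>
     (\<forall>x\<in>carrier A. \<forall>y\<in>carrier A.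
        star A (x \<oplus>\<^bsub>A\<^esub> y) = star A x \<oplus>\<^bsub>A\<^esub> star A y \<and>
        star A (x \<otimes>\<^bsub>A\<^esub> y) = star A y \<otimes>\<^bsub>A\<^esub> star A x) \<and>
     (\<forall>c. \<forall>x\<in>carrier A. star A (c \<odot>\<^bsub>A\<^esub> x) = cnj c \<odot>\<^bsub>A\<^esub> star A x) \<and>
     (\<forall>x\<in>carrier A. 0 \<le> cnorm A x \<and> (cnorm A x = 0 \<longleftrightarrow> x = \<zero>\<^bsub>A\<^esub>)) \<and>
     (\<forall>c. \<forall>x\<in>carrier A. cnorm A (c \<odot>\<^bsub>A\<^esub> x) = cmod c * cnorm A x) \<and>
     (\<forall>x\<in>carrier A. \<forall>y\<in>carrier A.
        cnorm A (x \<oplus>\<^bsub>A\<^esub> y) \<le> cnorm A x + cnorm A y \<and>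
        cnorm A (x \<otimes>\<^bsub>A\<^esub> y) \<le> cnorm A x * cnorm A y) \<and>
     (\<forall>x\<in>carrier A. cnorm A (star A x \<otimes>\<^bsub>A\<^esub> x) = (cnorm A x)\<^sup>2)"

text \<open>Homomorphisms are not required to preserve the unit.\<close>

definition star_homs :: "('a, 'm) cstar_scheme \<Rightarrow> ('b, 'n) cstar_scheme \<Rightarrow> ('a \<Rightarrow> 'b) set" where
  "star_homs A B = {\<pi> \<in> carrier A \<rightarrow> carrier B.
     (\<forall>x\<in>carrier A. \<forall>y\<in>carrier A.
        \<pi> (x \<oplus>\<^bsub>A\<^esub> y) = \<pi> x \<oplus>\<^bsub>B\<^esub> \<pi> y \<and> \<pi> (x \<otimes>\<^bsub>A\<^esub> y) = \<pi> x \<otimes>\<^bsub>B\<^esub> \<pi> y) \<and>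
     (\<forall>c. \<forall>x\<in>carrier A. \<pi> (c \<odot>\<^bsub>A\<^esub> x) = c \<odot>\<^bsub>B\<^esub> \<pi> x) \<and>
     (\<forall>x\<in>carrier A. \<pi> (star A x) = star B (\<pi> x))}"

definition cstar_embeds :: "('a, 'm) cstar_scheme \<Rightarrow> ('b, 'n) cstar_scheme \<Rightarrow> bool"
    (infix \<open>\<lesssim>\<^sub>C\<close> 50) where
  "A \<lesssim>\<^sub>C B \<longleftrightarrow> (\<exists>\<pi>\<in>star_homs A B. inj_on \<pi> (carrier A))"

definition cstar_iso :: "('a, 'm) cstar_scheme \<Rightarrow> ('b, 'n) cstar_scheme \<Rightarrow> bool"
    (infix \<open>\<cong>\<^sub>C\<close> 50) where
  "A \<cong>\<^sub>C B \<longleftrightarrow> (\<exists>\<pi>\<in>star_homs A B. bij_betw \<pi> (carrier A) (carrier B))"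

text \<open>Every finite-dimensional C*-algebra is *-isomorphic to one whose elements are complex
  matrices, so algebras over the element type \<open>complex mat\<close> represent all isomorphism classes.\<close>

definition iso_class :: "('a, 'm) cstar_scheme \<Rightarrow> complex mat cstar set" where
  "iso_class A = {B. fd_cstar_algebra B \<and> B \<cong>\<^sub>C A}"

definition op_norm :: "complex mat \<Rightarrow> real" where
  "op_norm X = (SUP v\<in>{v \<in> carrier_vec (dim_col X). v \<bullet>c v = 1}.
     sqrt (Re ((X *\<^sub>v v) \<bullet>c (X *\<^sub>v v))))"

text \<open>The algebra of \<open>n \<times> n\<close> matrices, i.e. of linear operators on \<open>\<complex>\<close> to the power \<open>n\<close>.\<close>

definition mat_algebra :: "nat \<Rightarrow> complex mat cstar" where
  "mat_algebra n = \<lparr>carrier = carrier_mat n n, monoid.mult = (*), one = 1\<^sub>m n,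
     zero = 0\<^sub>m n n, add = (+), module.smult = (\<cdot>\<^sub>m), star = mat_adjoint, cnorm = op_norm\<rparr>"

text \<open>The commutative algebra of complex \<open>n\<close>-tuples with entrywise operations.\<close>

definition tuple_algebra :: "nat \<Rightarrow> complex vec cstar" where
  "tuple_algebra n = \<lparr>carrier = carrier_vec n, monoid.mult = (\<lambda>v w. vec n (\<lambda>i. v $ i * w $ i)),
     one = vec n (\<lambda>i. 1), zero = 0\<^sub>v n, add = (+), module.smult = (\<cdot>\<^sub>v), star = conjugate,
     cnorm = (\<lambda>v. Max ((\<lambda>i. cmod (v $ i)) ` {..<n}))\<rparr>"


section \<open>Quantum channels\<close>

text \<open>A linear map from operators on an \<open>n\<close>-dimensional space to operators on an
  \<open>m\<close>-dimensional space is a function on matrices of which only the values on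
  \<open>carrier_mat n n\<close> matter.\<close>

definition mat_trace :: "complex mat \<Rightarrow> complex" where
  "mat_trace X = (\<Sum>i<dim_row X. X $$ (i, i))"

definition psd_mat :: "nat \<Rightarrow> complex mat \<Rightarrow> bool" where
  "psd_mat n X \<longleftrightarrow> X \<in> carrier_mat n n \<and> (\<forall>v\<in>carrier_vec n. 0 \<le> (X *\<^sub>v v) \<bullet>c v)"

definition linear_superop :: "nat \<Rightarrow> nat \<Rightarrow> (complex mat \<Rightarrow> complex mat) \<Rightarrow> bool" where
  "linear_superop n m \<Phi> \<longleftrightarrow>
     \<Phi> \<in> carrier_mat n n \<rightarrow> carrier_mat m m \<and>
     (\<forall>X\<in>carrier_mat n n. \<forall>Y\<in>carrier_mat n n. \<Phi> (X + Y) = \<Phi> X + \<Phi> Y) \<and>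
     (\<forall>c. \<forall>X\<in>carrier_mat n n. \<Phi> (c \<cdot>\<^sub>m X) = c \<cdot>\<^sub>m \<Phi> X)"

text \<open>The tensor product of the identity on \<open>k \<times> k\<close> matrices with \<open>\<Phi>\<close>: a \<open>kn \<times> kn\<close> matrix is
  read as a \<open>k \<times> k\<close> array of \<open>n \<times> n\<close> blocks, and \<open>\<Phi>\<close> is applied to each block.\<close>

definition ampliation ::
    "nat \<Rightarrow> nat \<Rightarrow> nat \<Rightarrow> (complex mat \<Rightarrow> complex mat) \<Rightarrow> complex mat \<Rightarrow> complex mat" where
  "ampliation k n m \<Phi> X = mat (k * m) (k * m) (\<lambda>(p, q).
     \<Phi> (mat n n (\<lambda>(i, j). X $$ ((p div m) * n + i, (q div m) * n + j))) $$ (p mod m, q mod m))"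

definition completely_positive :: "nat \<Rightarrow> nat \<Rightarrow> (complex mat \<Rightarrow> complex mat) \<Rightarrow> bool" where
  "completely_positive n m \<Phi> \<longleftrightarrow>
     (\<forall>k X. psd_mat (k * n) X \<longrightarrow> psd_mat (k * m) (ampliation k n m \<Phi> X))"

definition quantum_channel :: "nat \<Rightarrow> nat \<Rightarrow> (complex mat \<Rightarrow> complex mat) \<Rightarrow> bool" where
  "quantum_channel n m \<Phi> \<longleftrightarrow>
     linear_superop n m \<Phi> \<and> completely_positive n m \<Phi> \<and>
     (\<forall>X\<in>carrier_mat n n. mat_trace (\<Phi> X) = mat_trace X)"

text \<open>For a linear map \<open>\<Phi>\<close> the matrix described here exists and is unique.\<close>

definition superop_adjoint :: "nat \<Rightarrow> (complex mat \<Rightarrow> complex mat) \<Rightarrow> complex mat \<Rightarrow> complex mat" where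
  "superop_adjoint n \<Phi> Y = (THE Z. Z \<in> carrier_mat n n \<and>
     (\<forall>X\<in>carrier_mat n n. mat_trace (Y * \<Phi> X) = mat_trace (Z * X)))"


section \<open>Correctable and transmittable algebras\<close>

definition star_subalgebra :: "nat \<Rightarrow> complex mat set \<Rightarrow> bool" where
  "star_subalgebra n S \<longleftrightarrow>
     S \<subseteq> carrier_mat n n \<and> 0\<^sub>m n n \<in> S \<and>
     (\<forall>X\<in>S. \<forall>Y\<in>S. X + Y \<in> S \<and> X * Y \<in> S) \<and>
     (\<forall>c. \<forall>X\<in>S. c \<cdot>\<^sub>m X \<in> S) \<and> (\<forall>X\<in>S. mat_adjoint X \<in> S)"

definition unit_projection :: "complex mat set \<Rightarrow> complex mat \<Rightarrow> bool" where
  "unit_projection S P \<longleftrightarrow>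
     P \<in> S \<and> P * P = P \<and> mat_adjoint P = P \<and> (\<forall>X\<in>S. P * X = X \<and> X * P = X)"

text \<open>The range of \<open>P\<close> is identified with the \<open>r\<close>-dimensional coordinate space through an
  orthonormal basis of it, the columns of \<open>V\<close>; thus \<open>V\<close> is the inclusion of that range.
  The condition does not depend on the chosen basis.\<close>

definition correctable ::
    "nat \<Rightarrow> nat \<Rightarrow> (complex mat \<Rightarrow> complex mat) \<Rightarrow> complex mat set \<Rightarrow> bool" where
  "correctable n m \<Phi> S \<longleftrightarrow> star_subalgebra n S \<and>
     (\<exists>P r V. unit_projection S P \<and>
        V \<in> carrier_mat n r \<and> mat_adjoint V * V = 1\<^sub>m r \<and> V * mat_adjoint V = P \<and>
        (\<exists>D. quantum_channel m r D \<and>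
           (\<forall>X\<in>{mat_adjoint V * A * V | A. A \<in> S}.
              superop_adjoint r (D \<circ> (\<lambda>Y. \<Phi> (V * Y * mat_adjoint V))) X = X)))"

definition transmittable ::
    "nat \<Rightarrow> nat \<Rightarrow> (complex mat \<Rightarrow> complex mat) \<Rightarrow> ('a, 'm) cstar_scheme \<Rightarrow> bool" where
  "transmittable n m \<Phi> A \<longleftrightarrow>
     (\<exists>\<pi>\<in>star_homs A (mat_algebra n). inj_on \<pi> (carrier A) \<and> correctable n m \<Phi> (\<pi> ` carrier A))"

definition transmittable_algebras ::
    "nat \<Rightarrow> nat \<Rightarrow> (complex mat \<Rightarrow> complex mat) \<Rightarrow> complex mat cstar set" where
  "transmittable_algebras n m \<Phi> = {A. fd_cstar_algebra A \<and> transmittable n m \<Phi> A}"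

definition maximal_algebras :: "'a cstar set \<Rightarrow> 'a cstar set" where
  "maximal_algebras T = {A \<in> T. \<forall>B\<in>T. A \<lesssim>\<^sub>C B \<longrightarrow> A \<cong>\<^sub>C B}"

definition dominating_transmittable ::
    "nat \<Rightarrow> nat \<Rightarrow> (complex mat \<Rightarrow> complex mat) \<Rightarrow> complex mat cstar \<Rightarrow> bool" where
  "dominating_transmittable n m \<Phi> A \<longleftrightarrow>
     A \<in> transmittable_algebras n m \<Phi> \<and> (\<forall>B\<in>transmittable_algebras n m \<Phi>. B \<lesssim>\<^sub>C A)"


section \<open>Bases and rank-one operators\<close>

text \<open>Spanning is automatic for \<open>n\<close> orthonormal vectors in dimension \<open>n\<close>.\<close>

definition orthonormal_basis :: "nat \<Rightarrow> (nat \<Rightarrow> complex vec) \<Rightarrow> bool" where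
  "orthonormal_basis n e \<longleftrightarrow>
     (\<forall>i<n. e i \<in> carrier_vec n) \<and>
     (\<forall>i<n. \<forall>j<n. e i \<bullet>c e j = (if i = j then 1 else 0))"

definition ket_bra :: "complex vec \<Rightarrow> complex vec \<Rightarrow> complex mat" where
  "ket_bra v w = mat (dim_vec v) (dim_vec w) (\<lambda>(i, j). v $ i * cnj (w $ j))"

end

theory Submission
  imports Defs "Jordan_Normal_Form.VS_Connect" "HOL-Analysis.L2_Norm"
begin

text \<open>
  If \<open>D\<close> corrects \<open>S\<close>, then \<open>D\<^sup>*\<close> attains equality in the Kadison--Schwarz inequality on the
  vectors \<open>K P v\<close>; perturbing around this equality shows that \<open>S\<close> commutes with all
  \<open>P K\<^sup>* L P\<close>, where \<open>K, L\<close> are Kraus operators of \<open>\<Phi>\<close> and \<open>P\<close> is the unit of \<open>S\<close>. No Kraus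
  form of \<open>D\<close> is needed. For the given channel and \<open>p\<^sub>k = P e\<^sub>k\<close> these are
  \<open>|p\<^sub>0\<rangle>\<langle>p\<^sub>0| + |p\<^sub>1\<rangle>\<langle>p\<^sub>1|\<close>, \<open>|p\<^sub>2\<rangle>\<langle>p\<^sub>2|\<close>, \<open>|p\<^sub>3\<rangle>\<langle>p\<^sub>3|\<close>, \<open>|p\<^sub>1\<rangle>\<langle>p\<^sub>2|\<close> and \<open>|p\<^sub>1\<rangle>\<langle>p\<^sub>3|\<close> up to scalars.
  If \<open>p\<^sub>1 \<noteq> 0\<close> and \<open>p\<^sub>2 = p\<^sub>3 = 0\<close>, then \<open>S\<close> lives on the span of \<open>e\<^sub>0, e\<^sub>1\<close> and embeds into the
  \<open>2 \<times> 2\<close> matrices. Otherwise every \<open>p\<^sub>k\<close> is a joint eigenvector, the eigenvalue at \<open>p\<^sub>1\<close> (if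
  nonzero) being the one at \<open>p\<^sub>2\<close> or \<open>p\<^sub>3\<close>, and the eigenvalues at \<open>p\<^sub>0, p\<^sub>2, p\<^sub>3\<close> embed \<open>S\<close> into
  the complex triples. Both algebras are transmittable, through the codes spanned by \<open>e\<^sub>0, e\<^sub>1\<close> and
  by \<open>e\<^sub>0, e\<^sub>2, e\<^sub>3\<close>, and neither embeds into the other.
\<close>

section \<open>Adjoints, inner products and traces\<close>

text \<open>The hypothesis provides an arbitrary \<open>D\<close>, of which only linearity, trace
  preservation and positivity of its ampliations are known. Equality in Kadison--Schwarz comes from
  summing over the Kraus operators: in the dual picture \<open>D\<close> after the restricted
  channel fixes \<open>X\<close>, its adjoint, \<open>X* X\<close> and the unit, so the defects at
  the pairs \<open>(K v, K X v)\<close> add up to zero while each is nonnegative. The vanishing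
  first variation rewrites a trace with both \<open>X\<close> and \<open>D\<close> as one without
  \<open>X\<close>, and trace preservation then removes \<open>D\<close>; only inner products of
  vectors \<open>K P v\<close> survive.

  A second obstacle is that \<open>P\<close> has no prescribed position relative to the basis
  \<open>e\<close>: the vectors \<open>P e_k\<close> need not be orthogonal and may vanish. Hence
  the use of joint eigenvalues at these vectors instead of a choice of code basis. What keeps the
  two codes apart is that \<open>f 1\<close> overlaps both \<open>\<phi>p\<close> and
  \<open>\<phi>m\<close>, so the output of \<open>e 1\<close> cannot be separated from those of
  \<open>e 2\<close> and \<open>e 3\<close>.\<close>

lemma mat_adjoint_dim [simp]:
  "dim_row (mat_adjoint A) = dim_col A" "dim_col (mat_adjoint A) = dim_row A"
  by (auto simp: mat_adjoint_def)

lemma mat_adjoint_index [simp]: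
  fixes A :: "complex mat"
  assumes "i < dim_col A" "j < dim_row A"
  shows "mat_adjoint A $$ (i, j) = cnj (A $$ (j, i))"
  using assms by (simp add: mat_adjoint_def mat_of_rows_index)

lemma mat_adjoint_carrier [simp]:
  "A \<in> carrier_mat n m \<Longrightarrow> mat_adjoint A \<in> carrier_mat m n"
  by (intro carrier_matI) auto

lemma mat_adjoint_adjoint [simp]: "mat_adjoint (mat_adjoint A) = (A :: complex mat)"
  by (rule eq_matI) auto

lemma mat_adjoint_add:
  fixes A :: "complex mat"
  assumes "A \<in> carrier_mat n m" "B \<in> carrier_mat n m"
  shows "mat_adjoint (A + B) = mat_adjoint A + mat_adjoint B"
  using assms by (intro eq_matI) auto

lemma mat_adjoint_smult: "mat_adjoint (c \<cdot>\<^sub>m A) = cnj c \<cdot>\<^sub>m mat_adjoint (A :: complex mat)"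
  by (intro eq_matI) auto

lemma mat_adjoint_mult:
  fixes A :: "complex mat"
  assumes "A \<in> carrier_mat n m" "B \<in> carrier_mat m l"
  shows "mat_adjoint (A * B) = mat_adjoint B * mat_adjoint A"
  using assms by (intro eq_matI) (auto simp: scalar_prod_def intro!: sum.cong)

lemma mat_adjoint_one [simp]: "mat_adjoint (1\<^sub>m n) = (1\<^sub>m n :: complex mat)"
  by (rule eq_matI) auto

lemma mat_adjoint_zero [simp]: "mat_adjoint (0\<^sub>m n m) = (0\<^sub>m m n :: complex mat)"
  by (rule eq_matI) auto

lemma cscalar_sum:
  fixes v w :: "complex vec"
  assumes "w \<in> carrier_vec n"
  shows "v \<bullet>c w = (\<Sum>i<n. v $ i * cnj (w $ i))"
  using assms by (auto simp: scalar_prod_def lessThan_atLeast0)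

lemma cscalar_swap:
  fixes v w :: "complex vec"
  assumes "v \<in> carrier_vec n" "w \<in> carrier_vec n"
  shows "w \<bullet>c v = cnj (v \<bullet>c w)"
  using assms by (simp add: cscalar_sum mult.commute)

lemma cscalar_add_left:
  fixes u v w :: "complex vec"
  assumes "u \<in> carrier_vec n" "v \<in> carrier_vec n" "w \<in> carrier_vec n"
  shows "(u + v) \<bullet>c w = u \<bullet>c w + v \<bullet>c w"
  using assms by (simp add: cscalar_sum sum.distrib algebra_simps)

lemma cscalar_add_right:
  fixes u v w :: "complex vec"
  assumes "u \<in> carrier_vec n" "v \<in> carrier_vec n" "w \<in> carrier_vec n"
  shows "w \<bullet>c (u + v) = w \<bullet>c u + w \<bullet>c v"
  using assms by (simp add: cscalar_sum[of _ n] sum.distrib algebra_simps)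

lemma cscalar_smult_left:
  fixes v w :: "complex vec"
  assumes "v \<in> carrier_vec n" "w \<in> carrier_vec n"
  shows "(c \<cdot>\<^sub>v v) \<bullet>c w = c * (v \<bullet>c w)"
  using assms by (simp add: cscalar_sum[of _ n] sum_distrib_left algebra_simps)

lemma cscalar_smult_right:
  fixes v w :: "complex vec"
  assumes "v \<in> carrier_vec n" "w \<in> carrier_vec n"
  shows "v \<bullet>c (c \<cdot>\<^sub>v w) = cnj c * (v \<bullet>c w)"
  using assms by (simp add: cscalar_sum[of _ n] sum_distrib_left algebra_simps)

lemma cscalar_unit_vec:
  fixes v :: "complex vec"
  assumes "v \<in> carrier_vec n" "i < n"
  shows "v \<bullet>c unit_vec n i = v $ i" "unit_vec n i \<bullet>c v = cnj (v $ i)"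
proof -
  have "v \<bullet>c unit_vec n i = (\<Sum>j<n. v $ j * cnj (if j = i then 1 else 0))"
    using assms by (simp add: cscalar_sum[of _ n])
  also have "\<dots> = (\<Sum>j<n. if j = i then v $ j else 0)" by (intro sum.cong) auto
  finally show a: "v \<bullet>c unit_vec n i = v $ i" using assms by simp
  show "unit_vec n i \<bullet>c v = cnj (v $ i)"
    using cscalar_swap[of v n "unit_vec n i"] assms a by simp
qed

lemma cscalar_eqI:
  fixes v w :: "complex vec"
  assumes "v \<in> carrier_vec n" "w \<in> carrier_vec n"
    and "\<And>u. u \<in> carrier_vec n \<Longrightarrow> u \<bullet>c v = u \<bullet>c w"
  shows "v = w"
proof (rule eq_vecI)
  fix i assume "i < dim_vec w"
  then show "v $ i = w $ i"
    using assms(3)[of "unit_vec n i"] assms(1,2) by (simp add: cscalar_unit_vec)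
qed (use assms in auto)

lemma cscalar_adjoint:
  fixes A :: "complex mat"
  assumes "A \<in> carrier_mat n m" "v \<in> carrier_vec m" "w \<in> carrier_vec n"
  shows "(A *\<^sub>v v) \<bullet>c w = v \<bullet>c (mat_adjoint A *\<^sub>v w)"
proof -
  have Aw: "mat_adjoint A *\<^sub>v w \<in> carrier_vec m"
    using assms by (intro mult_mat_vec_carrier mat_adjoint_carrier)
  have "(A *\<^sub>v v) \<bullet>c w = (\<Sum>i<n. \<Sum>j<m. A $$ (i, j) * v $ j * cnj (w $ i))"
    using assms by (simp add: cscalar_sum[of _ n] scalar_prod_def sum_distrib_right lessThan_atLeast0)
  also have "\<dots> = (\<Sum>j<m. \<Sum>i<n. A $$ (i, j) * v $ j * cnj (w $ i))"
    by (rule sum.swap)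
  also have "\<dots> = v \<bullet>c (mat_adjoint A *\<^sub>v w)"
    using assms by (subst cscalar_sum[OF Aw])
      (auto simp: scalar_prod_def sum_distrib_left lessThan_atLeast0 algebra_simps intro!: sum.cong)
  finally show ?thesis .
qed

lemma cscalar_adjoint':
  fixes A :: "complex mat"
  assumes "A \<in> carrier_mat n m" "v \<in> carrier_vec n" "w \<in> carrier_vec m"
  shows "(mat_adjoint A *\<^sub>v v) \<bullet>c w = v \<bullet>c (A *\<^sub>v w)"
  using cscalar_adjoint[of "mat_adjoint A" m n v w] assms by simp

lemma mat_vec_eqI:
  fixes A B :: "complex mat"
  assumes "A \<in> carrier_mat n m" "B \<in> carrier_mat n m"
    and "\<And>v. v \<in> carrier_vec m \<Longrightarrow> A *\<^sub>v v = B *\<^sub>v v"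
  shows "A = B"
proof (rule eq_matI)
  fix i j assume ij: "i < dim_row B" "j < dim_col B"
  have "(A *\<^sub>v unit_vec m j) $ i = (B *\<^sub>v unit_vec m j) $ i" using assms(3) by simp
  then show "A $$ (i, j) = B $$ (i, j)" using assms(1,2) ij
    by (simp add: mult_mat_vec_def)
qed (use assms in auto)

lemma ket_bra_dim [simp]: "dim_row (ket_bra v w) = dim_vec v" "dim_col (ket_bra v w) = dim_vec w"
  by (auto simp: ket_bra_def)

lemma ket_bra_index [simp]:
  "i < dim_vec v \<Longrightarrow> j < dim_vec w \<Longrightarrow> ket_bra v w $$ (i, j) = v $ i * cnj (w $ j)"
  by (simp add: ket_bra_def)

lemma ket_bra_carrier [simp]:
  "v \<in> carrier_vec n \<Longrightarrow> w \<in> carrier_vec m \<Longrightarrow> ket_bra v w \<in> carrier_mat n m"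
  by (intro carrier_matI) auto

lemma ket_bra_mult_vec:
  assumes "v \<in> carrier_vec n" "w \<in> carrier_vec m" "x \<in> carrier_vec m"
  shows "ket_bra v w *\<^sub>v x = (x \<bullet>c w) \<cdot>\<^sub>v v"
  using assms by (intro eq_vecI)
    (auto simp: cscalar_sum[of _ m] scalar_prod_def sum_distrib_left sum_distrib_right
      lessThan_atLeast0 algebra_simps intro!: sum.cong)

lemma mult_ket_bra:
  assumes "A \<in> carrier_mat l n" "v \<in> carrier_vec n" "w \<in> carrier_vec m"
  shows "A * ket_bra v w = ket_bra (A *\<^sub>v v) w"
  using assms by (intro eq_matI) (auto simp: scalar_prod_def sum_distrib_left algebra_simps)

lemma mat_adjoint_ket_bra: "mat_adjoint (ket_bra v w) = ket_bra w v"
  by (intro eq_matI) auto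

lemma ket_bra_mult_adjoint:
  assumes "A \<in> carrier_mat l m" "v \<in> carrier_vec n" "w \<in> carrier_vec m"
  shows "ket_bra v w * mat_adjoint A = ket_bra v (A *\<^sub>v w)"
  using assms by (intro eq_matI) (auto simp: scalar_prod_def sum_distrib_left algebra_simps intro!: sum.cong)

lemma conj_ket_bra:
  assumes "A \<in> carrier_mat l n" "v \<in> carrier_vec n" "w \<in> carrier_vec n"
  shows "A * ket_bra v w * mat_adjoint A = ket_bra (A *\<^sub>v v) (A *\<^sub>v w)"
  using assms by (simp add: mult_ket_bra[of A l n] ket_bra_mult_adjoint[of A l n _ l])

lemma ket_bra_add_left:
  "u \<in> carrier_vec n \<Longrightarrow> v \<in> carrier_vec n \<Longrightarrow> ket_bra (u + v) w = ket_bra u w + ket_bra v w"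
  by (intro eq_matI) (auto simp: algebra_simps)

lemma ket_bra_add_right:
  "u \<in> carrier_vec n \<Longrightarrow> v \<in> carrier_vec n \<Longrightarrow> ket_bra w (u + v) = ket_bra w u + ket_bra w v"
  by (intro eq_matI) (auto simp: algebra_simps)

lemma ket_bra_smult_left: "ket_bra (c \<cdot>\<^sub>v v) w = c \<cdot>\<^sub>m ket_bra v w"
  by (intro eq_matI) auto

lemma ket_bra_smult_right: "ket_bra v (c \<cdot>\<^sub>v w) = cnj c \<cdot>\<^sub>m ket_bra v w"
  by (intro eq_matI) auto

lemma mat_trace_add:
  "A \<in> carrier_mat n n \<Longrightarrow> B \<in> carrier_mat n n \<Longrightarrow> mat_trace (A + B) = mat_trace A + mat_trace B"
  by (simp add: mat_trace_def sum.distrib)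

lemma mat_trace_smult: "A \<in> carrier_mat n n \<Longrightarrow> mat_trace (c \<cdot>\<^sub>m A) = c * mat_trace A"
  by (simp add: mat_trace_def sum_distrib_left)

lemma mat_trace_mult:
  "A \<in> carrier_mat n m \<Longrightarrow> B \<in> carrier_mat m n \<Longrightarrow>
    mat_trace (A * B) = (\<Sum>i<n. \<Sum>j<m. A $$ (i, j) * B $$ (j, i))"
  by (auto simp: mat_trace_def scalar_prod_def lessThan_atLeast0 intro!: sum.cong)

lemma mat_trace_comm:
  assumes "A \<in> carrier_mat n m" "B \<in> carrier_mat m n"
  shows "mat_trace (A * B) = mat_trace (B * A)"
proof -
  have "mat_trace (A * B) = (\<Sum>i<n. \<Sum>j<m. A $$ (i, j) * B $$ (j, i))"
    using assms by (rule mat_trace_mult)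
  also have "\<dots> = (\<Sum>j<m. \<Sum>i<n. A $$ (i, j) * B $$ (j, i))" by (rule sum.swap)
  also have "\<dots> = mat_trace (B * A)"
    using assms by (simp add: mat_trace_mult[of _ m n] mult.commute)
  finally show ?thesis .
qed

lemma mat_trace_ket_bra:
  assumes "v \<in> carrier_vec n" "w \<in> carrier_vec n"
  shows "mat_trace (ket_bra v w) = v \<bullet>c w"
  using assms by (simp add: mat_trace_def cscalar_sum[of _ n])

lemma mat_trace_mult_ket_bra:
  assumes "A \<in> carrier_mat n n" "v \<in> carrier_vec n" "w \<in> carrier_vec n"
  shows "mat_trace (A * ket_bra v w) = (A *\<^sub>v v) \<bullet>c w"
  using assms by (simp add: mult_ket_bra[of _ n n] mat_trace_ket_bra[of _ n])

text \<open>Testing against \<open>ket_bra v u\<close> turns the trace into an inner product, so the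
  trace pairing separates matrices. This is the uniqueness behind the \<open>THE\<close> in
  \<open>superop_adjoint\<close>.\<close>

lemma mat_trace_nondegenerate:
  assumes "Y \<in> carrier_mat n n" "Z \<in> carrier_mat n n"
    and "\<And>X. X \<in> carrier_mat n n \<Longrightarrow> mat_trace (Y * X) = mat_trace (Z * X)"
  shows "Y = Z"
proof (rule mat_vec_eqI[OF assms(1,2)])
  fix v :: "complex vec" assume v: "v \<in> carrier_vec n"
  show "Y *\<^sub>v v = Z *\<^sub>v v"
  proof (rule cscalar_eqI[of _ n])
    fix u :: "complex vec" assume u: "u \<in> carrier_vec n"
    have "(Y *\<^sub>v v) \<bullet>c u = (Z *\<^sub>v v) \<bullet>c u"
      using assms(3)[of "ket_bra v u"] u v assms(1,2)
      by (simp add: mat_trace_mult_ket_bra[of _ n])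
    then show "u \<bullet>c (Y *\<^sub>v v) = u \<bullet>c (Z *\<^sub>v v)"
      using u v assms(1,2) by (metis cscalar_swap mult_mat_vec_carrier)
  qed (use assms v in auto)
qed


section \<open>Channels and their adjoints\<close>

lemma linear_superopD:
  assumes "linear_superop n m \<Phi>"
  shows "X \<in> carrier_mat n n \<Longrightarrow> \<Phi> X \<in> carrier_mat m m"
    "X \<in> carrier_mat n n \<Longrightarrow> Y \<in> carrier_mat n n \<Longrightarrow> \<Phi> (X + Y) = \<Phi> X + \<Phi> Y"
    "X \<in> carrier_mat n n \<Longrightarrow> \<Phi> (c \<cdot>\<^sub>m X) = c \<cdot>\<^sub>m \<Phi> X"
  using assms by (auto simp: linear_superop_def)

text \<open>Riesz representation for the trace pairing, which is the existence behind that
  \<open>THE\<close>. The representing matrix holds the values of \<open>g\<close> on the matrix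
  units, with the indices transposed.\<close>

lemma linear_functional_mat_sum:
  fixes g :: "complex mat \<Rightarrow> complex"
  assumes add: "\<And>X Y. X \<in> carrier_mat n n \<Longrightarrow> Y \<in> carrier_mat n n \<Longrightarrow> g (X + Y) = g X + g Y"
    and smult: "\<And>c X. X \<in> carrier_mat n n \<Longrightarrow> g (c \<cdot>\<^sub>m X) = c * g X"
  shows "\<exists>Z\<in>carrier_mat n n. \<forall>X\<in>carrier_mat n n. g X = mat_trace (Z * X)"
proof -
  define E where "E = (\<lambda>(i, j). mat n n (\<lambda>q. if q = (i, j) then 1 else 0 :: complex))"
  have E: "E p \<in> carrier_mat n n" for p by (cases p) (simp add: E_def)
  have g0: "g (0\<^sub>m n n) = 0"
    using smult[of "0\<^sub>m n n" 0] by simp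
  \<comment> \<open>\<open>part F X\<close> keeps the entries of \<open>X\<close> with index in
    \<open>F\<close>, so induction on \<open>F\<close> adds one matrix unit at a time.\<close>
  define part where "part = (\<lambda>F X. mat n n (\<lambda>q. if q \<in> F then X $$ q else 0) :: complex mat)"
  have part: "g (part F X) = (\<Sum>p\<in>F. X $$ p * g (E p))"
    if X: "X \<in> carrier_mat n n" and F: "finite F" "F \<subseteq> {..<n} \<times> {..<n}" for F X
    using F
  proof (induction F)
    case empty
    have "part {} X = 0\<^sub>m n n" by (rule eq_matI) (auto simp: part_def)
    then show ?case using g0 by simp
  next
    case (insert p F)
    have "part (insert p F) X = X $$ p \<cdot>\<^sub>m E p + part F X"
      using insert by (intro eq_matI) (auto simp: part_def E_def)
    moreover have "part F X \<in> carrier_mat n n" by (simp add: part_def)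
    ultimately have "g (part (insert p F) X) = X $$ p * g (E p) + g (part F X)"
      using add smult E by simp
    then show ?case using insert by simp
  qed
  define Z where "Z = mat n n (\<lambda>(j, i). g (E (i, j)))"
  have "g X = mat_trace (Z * X)" if X: "X \<in> carrier_mat n n" for X
  proof -
    have "part ({..<n} \<times> {..<n}) X = X"
      using X by (intro eq_matI) (auto simp: part_def)
    then have "g X = (\<Sum>p\<in>{..<n} \<times> {..<n}. X $$ p * g (E p))"
      using part[OF X, of "{..<n} \<times> {..<n}"] by simp
    also have "\<dots> = (\<Sum>i<n. \<Sum>j<n. X $$ (i, j) * g (E (i, j)))"
      by (simp add: sum.cartesian_product)
    also have "\<dots> = mat_trace (X * Z)"
      using X by (subst mat_trace_mult[of _ n n]) (auto simp: Z_def)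
    also have "\<dots> = mat_trace (Z * X)"
      using X by (intro mat_trace_comm[of _ n n]) (auto simp: Z_def)
    finally show ?thesis .
  qed
  then show ?thesis by (intro bexI[of _ Z]) (auto simp: Z_def)
qed

lemma superop_adjoint_eqI:
  assumes "Z \<in> carrier_mat n n"
    and "\<And>X. X \<in> carrier_mat n n \<Longrightarrow> mat_trace (Y * \<Phi> X) = mat_trace (Z * X)"
  shows "superop_adjoint n \<Phi> Y = Z"
  unfolding superop_adjoint_def using assms mat_trace_nondegenerate[of _ n Z]
  by (intro the_equality) auto

lemma superop_adjoint_trace:
  assumes "linear_superop n m \<Phi>" "Y \<in> carrier_mat m m" "X \<in> carrier_mat n n"
  shows "mat_trace (Y * \<Phi> X) = mat_trace (superop_adjoint n \<Phi> Y * X)"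
proof -
  note lin = linear_superopD[OF assms(1)]
  have "\<exists>Z\<in>carrier_mat n n. \<forall>X\<in>carrier_mat n n. mat_trace (Y * \<Phi> X) = mat_trace (Z * X)"
  proof (rule linear_functional_mat_sum)
    fix X X' :: "complex mat" assume X: "X \<in> carrier_mat n n" "X' \<in> carrier_mat n n"
    have "Y * \<Phi> (X + X') = Y * \<Phi> X + Y * \<Phi> X'"
      using X lin(1)[OF X(1)] lin(1)[OF X(2)] assms(2) by (simp add: lin(2) mult_add_distrib_mat[of _ m m])
    then show "mat_trace (Y * \<Phi> (X + X')) = mat_trace (Y * \<Phi> X) + mat_trace (Y * \<Phi> X')"
      using lin(1)[OF X(1)] lin(1)[OF X(2)] assms(2) by (simp add: mat_trace_add[of _ m])
  next
    fix c and X :: "complex mat" assume X: "X \<in> carrier_mat n n"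
    have "Y * \<Phi> (c \<cdot>\<^sub>m X) = c \<cdot>\<^sub>m (Y * \<Phi> X)"
      using X lin(1)[OF X] assms(2) by (simp add: lin(3) mult_smult_distrib[of _ m m])
    then show "mat_trace (Y * \<Phi> (c \<cdot>\<^sub>m X)) = c * mat_trace (Y * \<Phi> X)"
      using lin(1)[OF X] assms(2) by (simp add: mat_trace_smult[of _ m])
  qed
  then obtain Z where Z: "Z \<in> carrier_mat n n"
    "\<And>X. X \<in> carrier_mat n n \<Longrightarrow> mat_trace (Y * \<Phi> X) = mat_trace (Z * X)" by blast
  then show ?thesis using superop_adjoint_eqI[of Z n Y \<Phi>] assms(3) by simp
qed


section \<open>Kraus maps: linearity and traces\<close>

definition kraus_map :: "nat \<Rightarrow> complex mat list \<Rightarrow> complex mat \<Rightarrow> complex mat" where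
  "kraus_map m Ks X = foldr (\<lambda>K Y. K * X * mat_adjoint K + Y) Ks (0\<^sub>m m m)"

text \<open>When this sum is the identity, the Kraus map preserves traces.\<close>

definition kraus_gram :: "nat \<Rightarrow> complex mat list \<Rightarrow> complex mat" where
  "kraus_gram n Ks = foldr (\<lambda>K Y. mat_adjoint K * K + Y) Ks (0\<^sub>m n n)"

lemma kraus_map_simps [simp]:
  "kraus_map m [] X = 0\<^sub>m m m"
  "kraus_map m (K # Ks) X = K * X * mat_adjoint K + kraus_map m Ks X"
  by (simp_all add: kraus_map_def)

lemma kraus_gram_simps [simp]:
  "kraus_gram n [] = 0\<^sub>m n n"
  "kraus_gram n (K # Ks) = mat_adjoint K * K + kraus_gram n Ks"
  by (simp_all add: kraus_gram_def)

lemma conj_carrier [simp]: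
  "K \<in> carrier_mat m n \<Longrightarrow> X \<in> carrier_mat n n \<Longrightarrow> K * X * mat_adjoint K \<in> carrier_mat m m"
  by (intro mult_carrier_mat[of _ m n] mult_carrier_mat[of _ n n]) auto

lemma kraus_map_carrier:
  "set Ks \<subseteq> carrier_mat m n \<Longrightarrow> X \<in> carrier_mat n n \<Longrightarrow> kraus_map m Ks X \<in> carrier_mat m m"
  by (induction Ks) auto

lemma kraus_gram_carrier:
  "set Ks \<subseteq> carrier_mat m n \<Longrightarrow> kraus_gram n Ks \<in> carrier_mat n n"
  by (induction Ks) (auto intro: mult_carrier_mat[of _ n m])

lemma conj_add:
  assumes "K \<in> carrier_mat m n" "X \<in> carrier_mat n n" "Y \<in> carrier_mat n n"
  shows "K * (X + Y) * mat_adjoint K = K * X * mat_adjoint K + K * Y * mat_adjoint K"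
  using assms
  by (simp add: mult_add_distrib_mat[of _ m n] add_mult_distrib_mat[of _ m n _ _ m] mult_carrier_mat[of _ m n])

lemma conj_smult:
  assumes "K \<in> carrier_mat m n" "X \<in> carrier_mat n n"
  shows "K * (c \<cdot>\<^sub>m X) * mat_adjoint K = c \<cdot>\<^sub>m (K * X * mat_adjoint K)"
  using assms
  by (simp add: mult_smult_distrib[of _ m n] mult_smult_assoc_mat[of _ m n _ m] mult_carrier_mat[of _ m n])

lemma add_mat_four:
  fixes A :: "complex mat"
  assumes "A \<in> carrier_mat n m" "B \<in> carrier_mat n m" "C \<in> carrier_mat n m" "D \<in> carrier_mat n m"
  shows "A + B + (C + D) = A + C + (B + D)"
  using assms by (intro eq_matI) auto

lemma linear_superop_kraus_map:
  assumes Ks: "set Ks \<subseteq> carrier_mat m n"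
  shows "linear_superop n m (kraus_map m Ks)"
  unfolding linear_superop_def
proof (intro conjI ballI allI)
  show "kraus_map m Ks \<in> carrier_mat n n \<rightarrow> carrier_mat m m"
    using kraus_map_carrier[OF Ks] by auto
  fix X :: "complex mat" assume X: "X \<in> carrier_mat n n"
  show "kraus_map m Ks (c \<cdot>\<^sub>m X) = c \<cdot>\<^sub>m kraus_map m Ks X" for c
    using Ks
  proof (induction Ks)
    case (Cons K Ks)
    then have "K * X * mat_adjoint K \<in> carrier_mat m m" "kraus_map m Ks X \<in> carrier_mat m m"
      using X kraus_map_carrier[of Ks m n X] by auto
    then show ?case
      using X Cons conj_smult[of K m n X] by (simp add: add_smult_distrib_left_mat[of _ m m])
  qed auto
  fix Y :: "complex mat" assume Y: "Y \<in> carrier_mat n n"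
  show "kraus_map m Ks (X + Y) = kraus_map m Ks X + kraus_map m Ks Y"
    using Ks
  proof (induction Ks)
    case (Cons K Ks)
    then have "K * X * mat_adjoint K \<in> carrier_mat m m" "K * Y * mat_adjoint K \<in> carrier_mat m m"
      using X Y by auto
    then show ?case
      using X Y Cons kraus_map_carrier[of Ks m n X] kraus_map_carrier[of Ks m n Y]
      by (simp add: conj_add[of K m n] add_mat_four[of _ m m] del: assoc_add_mat)
  qed auto
qed

lemma mat_trace_kraus_map:
  assumes Ks: "set Ks \<subseteq> carrier_mat m n" and X: "X \<in> carrier_mat n n"
  shows "mat_trace (kraus_map m Ks X) = mat_trace (kraus_gram n Ks * X)"
  using Ks
proof (induction Ks)
  case Nil
  then show ?case using X by (simp add: mat_trace_def)
next
  case (Cons K Ks)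
  then have K: "K \<in> carrier_mat m n" and K': "mat_adjoint K \<in> carrier_mat n m" by auto
  have "mat_trace (K * X * mat_adjoint K) = mat_trace (mat_adjoint K * (K * X))"
    using K K' X by (intro mat_trace_comm[of _ m n]) auto
  also have "mat_adjoint K * (K * X) = mat_adjoint K * K * X"
    using K K' X by (intro assoc_mult_mat[symmetric]) auto
  finally have *: "mat_trace (K * X * mat_adjoint K) = mat_trace (mat_adjoint K * K * X)" .
  have KK: "mat_adjoint K * K \<in> carrier_mat n n" using K K' by auto
  have G: "kraus_gram n Ks \<in> carrier_mat n n" using Cons kraus_gram_carrier[of Ks m n] by simp
  have "kraus_map m Ks X \<in> carrier_mat m m" using Cons X kraus_map_carrier[of Ks m n X] by simp
  then have "mat_trace (kraus_map m (K # Ks) X) = mat_trace (mat_adjoint K * K * X) + mat_trace (kraus_gram n Ks * X)"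
    using Cons K X * by (simp add: mat_trace_add[of _ m])
  also have "\<dots> = mat_trace (mat_adjoint K * K * X + kraus_gram n Ks * X)"
    using KK G X by (intro mat_trace_add[symmetric, of _ n]) auto
  also have "mat_adjoint K * K * X + kraus_gram n Ks * X = kraus_gram n (K # Ks) * X"
    using KK G X by (simp add: add_mult_distrib_mat[of _ n n])
  finally show ?case .
qed

section \<open>Block matrices and complete positivity\<close>

lemma sum_block: "(\<Sum>p<k * n. h p) = (\<Sum>c<k. \<Sum>i<n. h (c * n + i))"
  for h :: "nat \<Rightarrow> 'a :: comm_monoid_add"
proof -
  have "sum h {c * n..<c * n + n} = (\<Sum>i<n. h (c * n + i))" for c
    using sum.shift_bounds_nat_ivl[of h 0 "c * n" n] by (simp add: lessThan_atLeast0 add.commute)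
  then show ?thesis using sum.nat_group[of h n k] by simp
qed

lemma block_index_less:
  "c < k \<Longrightarrow> i < n \<Longrightarrow> c * n + i < k * (n :: nat)"
  by (metis add_less_cancel_left less_le_trans mult.commute mult_Suc_right mult_le_mono1 Suc_leI add.commute)

text \<open>The Kronecker product of the identity with \<open>K\<close>, in the block order of
  \<open>ampliation\<close>.\<close>

definition id_tensor :: "nat \<Rightarrow> complex mat \<Rightarrow> complex mat" where
  "id_tensor k K = mat (k * dim_row K) (k * dim_col K) (\<lambda>(p, q).
     if p div dim_row K = q div dim_col K then K $$ (p mod dim_row K, q mod dim_col K) else 0)"

text \<open>Row \<open>p\<close> vanishes outside the column block \<open>p div m\<close>, so the
  long sum collapses to that block.\<close>

lemma id_tensor_sum:
  assumes K: "K \<in> carrier_mat m n" and p: "p < k * m"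
  shows "(\<Sum>s<k * n. id_tensor k K $$ (p, s) * g s) = (\<Sum>i<n. K $$ (p mod m, i) * g (p div m * n + i))"
proof -
  have pk: "p div m < k" using p by (simp add: less_mult_imp_div_less)
  have "(\<Sum>s<k * n. id_tensor k K $$ (p, s) * g s) =
      (\<Sum>c<k. \<Sum>i<n. id_tensor k K $$ (p, c * n + i) * g (c * n + i))"
    by (rule sum_block)
  also have "\<dots> = (\<Sum>c<k. if c = p div m then \<Sum>i<n. K $$ (p mod m, i) * g (p div m * n + i) else 0)"
    using K p by (intro sum.cong) (auto simp: id_tensor_def block_index_less intro!: sum.cong sum.neutral)
  also have "\<dots> = (\<Sum>i<n. K $$ (p mod m, i) * g (p div m * n + i))"
    using pk by simp
  finally show ?thesis .
qed

text \<open>Amplifying a conjugation is conjugating by the amplified operator, and conjugation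
  visibly preserves positivity. This reduces complete positivity of Kraus maps to
  \<open>psd_mat_conj\<close>.\<close>

lemma ampliation_conj:
  assumes K: "K \<in> carrier_mat m n" and X: "X \<in> carrier_mat (k * n) (k * n)"
  shows "ampliation k n m (\<lambda>Y. K * Y * mat_adjoint K) X =
    id_tensor k K * X * mat_adjoint (id_tensor k K)"
proof (rule eq_matI)
  let ?T = "id_tensor k K"
  have T: "?T \<in> carrier_mat (k * m) (k * n)" using K by (simp add: id_tensor_def)
  \<comment> \<open>The inner sum stays under \<open>cnj\<close> so that both sums have the shape
    that \<open>id_tensor_sum\<close> rewrites.\<close>
  have entry: "(B * Z * mat_adjoint B) $$ (p, q) =
      (\<Sum>s<c. B $$ (p, s) * cnj (\<Sum>t<c. B $$ (q, t) * cnj (Z $$ (s, t))))"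
    if "B \<in> carrier_mat r c" "Z \<in> carrier_mat c c" "p < r" "q < r" for B Z :: "complex mat" and r c p q
  proof -
    have "B * Z * mat_adjoint B = B * (Z * mat_adjoint B)"
      using that by (intro assoc_mult_mat) auto
    then show ?thesis using that
      by (auto simp: scalar_prod_def lessThan_atLeast0 algebra_simps intro!: sum.cong)
  qed
  fix p q assume "p < dim_row (?T * X * mat_adjoint ?T)" "q < dim_col (?T * X * mat_adjoint ?T)"
  then have p: "p < k * m" and q: "q < k * m" using T by auto
  then have m: "0 < m" by (cases m) auto
  have pk: "p div m < k" "q div m < k" using p q by (auto simp: less_mult_imp_div_less)
  define blk where "blk = mat n n (\<lambda>(i, j). X $$ (p div m * n + i, q div m * n + j))"
  have "ampliation k n m (\<lambda>Y. K * Y * mat_adjoint K) X $$ (p, q) =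
      (K * blk * mat_adjoint K) $$ (p mod m, q mod m)"
    using p q by (simp add: ampliation_def blk_def)
  also have "\<dots> = (\<Sum>i<n. K $$ (p mod m, i) * cnj (\<Sum>j<n. K $$ (q mod m, j) * cnj (blk $$ (i, j))))"
    using K m by (intro entry[of _ m]) (auto simp: blk_def)
  also have "\<dots> = (\<Sum>i<n. K $$ (p mod m, i) *
      cnj (\<Sum>j<n. K $$ (q mod m, j) * cnj (X $$ (p div m * n + i, q div m * n + j))))"
    by (simp add: blk_def)
  also have "\<dots> = (\<Sum>i<n. K $$ (p mod m, i) *
      cnj (\<Sum>t<k * n. ?T $$ (q, t) * cnj (X $$ (p div m * n + i, t))))"
    by (simp only: id_tensor_sum[OF K q])
  also have "\<dots> = (\<Sum>s<k * n. ?T $$ (p, s) * cnj (\<Sum>t<k * n. ?T $$ (q, t) * cnj (X $$ (s, t))))"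
    by (rule id_tensor_sum[OF K p, symmetric])
  also have "\<dots> = (?T * X * mat_adjoint ?T) $$ (p, q)"
    using T X p q by (intro entry[symmetric])
  finally show "ampliation k n m (\<lambda>Y. K * Y * mat_adjoint K) X $$ (p, q) = (?T * X * mat_adjoint ?T) $$ (p, q)" .
qed (use K in \<open>auto simp: ampliation_def id_tensor_def\<close>)

lemma psd_mat_conj:
  assumes "psd_mat n X" "B \<in> carrier_mat m n"
  shows "psd_mat m (B * X * mat_adjoint B)"
  unfolding psd_mat_def
proof (intro conjI ballI)
  have X: "X \<in> carrier_mat n n" using assms by (simp add: psd_mat_def)
  then show "B * X * mat_adjoint B \<in> carrier_mat m m" using assms by simp
  fix v :: "complex vec" assume v: "v \<in> carrier_vec m"
  define w where "w = mat_adjoint B *\<^sub>v v"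
  have B': "mat_adjoint B \<in> carrier_mat n m" using assms by simp
  then have w: "w \<in> carrier_vec n" using v by (simp add: w_def)
  have "(B * X * mat_adjoint B) *\<^sub>v v = (B * X) *\<^sub>v w"
    unfolding w_def using assms(2) X B' v by (intro assoc_mult_mat_vec) auto
  also have "\<dots> = B *\<^sub>v (X *\<^sub>v w)"
    using assms(2) X w by (intro assoc_mult_mat_vec) auto
  finally have "(B * X * mat_adjoint B) *\<^sub>v v = B *\<^sub>v (X *\<^sub>v w)" .
  moreover have "X *\<^sub>v w \<in> carrier_vec n" using X w by simp
  ultimately have "((B * X * mat_adjoint B) *\<^sub>v v) \<bullet>c v = (X *\<^sub>v w) \<bullet>c w"
    using assms(2) X v w by (simp add: w_def cscalar_adjoint[of B m n])
  then show "0 \<le> ((B * X * mat_adjoint B) *\<^sub>v v) \<bullet>c v"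
    using assms(1) w by (simp add: psd_mat_def)
qed

lemma completely_positive_conj:
  assumes "K \<in> carrier_mat m n"
  shows "completely_positive n m (\<lambda>Y. K * Y * mat_adjoint K)"
  unfolding completely_positive_def
proof (intro allI impI)
  fix k X assume X: "psd_mat (k * n) X"
  then have "X \<in> carrier_mat (k * n) (k * n)" by (simp add: psd_mat_def)
  moreover have "id_tensor k K \<in> carrier_mat (k * m) (k * n)"
    using assms by (simp add: id_tensor_def)
  ultimately show "psd_mat (k * m) (ampliation k n m (\<lambda>Y. K * Y * mat_adjoint K) X)"
    using ampliation_conj[OF assms] psd_mat_conj[OF X] by simp
qed

text \<open>The blocks fed to the map always lie in \<open>carrier_mat n n\<close>, so a Kraus form
  known only there still settles complete positivity.\<close>

lemma ampliation_cong:
  assumes "\<And>X. X \<in> carrier_mat n n \<Longrightarrow> \<Phi> X = \<Psi> X"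
  shows "ampliation k n m \<Phi> X = ampliation k n m \<Psi> X"
  unfolding ampliation_def by (intro cong_mat) (auto simp: assms)

lemma completely_positive_zero: "completely_positive n m (\<lambda>Y. 0\<^sub>m m m)"
proof -
  have "ampliation k n m (\<lambda>Y. 0\<^sub>m m m) X = 0\<^sub>m (k * m) (k * m)" for k X
    by (rule eq_matI) (cases "m = 0", auto simp: ampliation_def)
  moreover have "0\<^sub>m l l *\<^sub>v v = 0\<^sub>v l" if "v \<in> carrier_vec l" for l and v :: "complex vec"
    using that by (intro eq_vecI) auto
  ultimately show ?thesis by (simp add: completely_positive_def psd_mat_def cscalar_sum)
qed

lemma completely_positive_add:
  assumes "completely_positive n m \<Phi>" "completely_positive n m \<Psi>"
    and "\<Phi> \<in> carrier_mat n n \<rightarrow> carrier_mat m m" "\<Psi> \<in> carrier_mat n n \<rightarrow> carrier_mat m m"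
  shows "completely_positive n m (\<lambda>Y. \<Phi> Y + \<Psi> Y)"
  unfolding completely_positive_def
proof (intro allI impI)
  fix k X assume X: "psd_mat (k * n) X"
  let ?A = "ampliation k n m \<Phi> X" and ?B = "ampliation k n m \<Psi> X"
  have A: "psd_mat (k * m) ?A" and B: "psd_mat (k * m) ?B"
    using assms(1,2) X by (auto simp: completely_positive_def)
  have eq: "ampliation k n m (\<lambda>Y. \<Phi> Y + \<Psi> Y) X = ?A + ?B"
  proof (rule eq_matI)
    fix p q assume "p < dim_row (?A + ?B)" "q < dim_col (?A + ?B)"
    then have pq: "p < k * m" "q < k * m" by (auto simp: ampliation_def)
    then have m: "0 < m" by (cases m) auto
    let ?b = "mat n n (\<lambda>(i, j). X $$ (p div m * n + i, q div m * n + j))"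
    have "\<Phi> ?b \<in> carrier_mat m m" "\<Psi> ?b \<in> carrier_mat m m" using assms(3,4) by auto
    then show "ampliation k n m (\<lambda>Y. \<Phi> Y + \<Psi> Y) X $$ (p, q) = (?A + ?B) $$ (p, q)"
      using pq m by (simp add: ampliation_def)
  qed (auto simp: ampliation_def)
  show "psd_mat (k * m) (ampliation k n m (\<lambda>Y. \<Phi> Y + \<Psi> Y) X)"
    unfolding psd_mat_def eq
  proof (intro conjI ballI)
    show "?A + ?B \<in> carrier_mat (k * m) (k * m)" using A B by (simp add: psd_mat_def)
    fix v :: "complex vec" assume v: "v \<in> carrier_vec (k * m)"
    have "?A *\<^sub>v v \<in> carrier_vec (k * m)" "?B *\<^sub>v v \<in> carrier_vec (k * m)"
      using A B v by (auto simp: psd_mat_def intro: mult_mat_vec_carrier)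
    then have "((?A + ?B) *\<^sub>v v) \<bullet>c v = (?A *\<^sub>v v) \<bullet>c v + (?B *\<^sub>v v) \<bullet>c v"
      using A B v by (simp add: psd_mat_def add_mult_distrib_mat_vec[of _ "k * m" "k * m"] cscalar_add_left[of _ "k * m"])
    then show "0 \<le> ((?A + ?B) *\<^sub>v v) \<bullet>c v"
      using A B v by (simp add: psd_mat_def)
  qed
qed

lemma completely_positive_kraus_map:
  "set Ks \<subseteq> carrier_mat m n \<Longrightarrow> completely_positive n m (kraus_map m Ks)"
proof (induction Ks)
  case Nil
  then show ?case using completely_positive_zero[of n m] by (simp add: kraus_map_def)
next
  case (Cons K Ks)
  have "completely_positive n m (\<lambda>X. K * X * mat_adjoint K + kraus_map m Ks X)"
    using Cons kraus_map_carrier[of Ks m n]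
    by (intro completely_positive_add completely_positive_conj) auto
  then show ?case by (simp add: kraus_map_def)
qed

theorem quantum_channel_kraus_map:
  assumes Ks: "set Ks \<subseteq> carrier_mat m n" and gram: "kraus_gram n Ks = 1\<^sub>m n"
    and \<Phi>: "\<And>X. X \<in> carrier_mat n n \<Longrightarrow> \<Phi> X = kraus_map m Ks X"
  shows "quantum_channel n m \<Phi>"
proof -
  have "linear_superop n m \<Phi>"
    using linear_superop_kraus_map[OF Ks] by (simp add: linear_superop_def \<Phi> Pi_iff)
  moreover have "completely_positive n m \<Phi>"
    using completely_positive_kraus_map[OF Ks] ampliation_cong[of n \<Phi> "kraus_map m Ks"] \<Phi>
    by (simp add: completely_positive_def)
  moreover have "mat_trace (\<Phi> X) = mat_trace X" if "X \<in> carrier_mat n n" for X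
    using that mat_trace_kraus_map[OF Ks that] by (simp add: \<Phi> gram)
  ultimately show ?thesis by (simp add: quantum_channel_def)
qed

text \<open>Complete positivity tested on the rank-one block matrix of the stacked vectors
  \<open>a s\<close>, evaluated at the stacked vectors \<open>w s\<close>. This scalar inequality is
  the only form in which positivity of a recovery map enters.\<close>

lemma completely_positive_form:
  fixes k :: nat
  assumes "completely_positive n m \<Phi>" "\<Phi> \<in> carrier_mat n n \<rightarrow> carrier_mat m m"
    and a: "\<And>s. s < k \<Longrightarrow> a s \<in> carrier_vec n" and w: "\<And>s. s < k \<Longrightarrow> w s \<in> carrier_vec m"
  shows "0 \<le> (\<Sum>s<k. \<Sum>t<k. (\<Phi> (ket_bra (a s) (a t)) *\<^sub>v w t) \<bullet>c w s)"
proof -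
  define A where "A = vec (k * n) (\<lambda>p. a (p div n) $ (p mod n))"
  define W where "W = vec (k * m) (\<lambda>p. w (p div m) $ (p mod m))"
  define Y where "Y = ampliation k n m \<Phi> (ket_bra A A)"
  have A: "A \<in> carrier_vec (k * n)" and W: "W \<in> carrier_vec (k * m)" by (simp_all add: A_def W_def)
  have "psd_mat (k * n) (ket_bra A A)"
    unfolding psd_mat_def
  proof (intro conjI ballI)
    fix v :: "complex vec" assume v: "v \<in> carrier_vec (k * n)"
    have "(ket_bra A A *\<^sub>v v) \<bullet>c v = (v \<bullet>c A) * (A \<bullet>c v)"
      using v A by (simp add: ket_bra_mult_vec[of _ "k * n" _ "k * n"] cscalar_smult_left[of _ "k * n"])
    also have "\<dots> = (v \<bullet>c A) * cnj (v \<bullet>c A)" using cscalar_swap[OF v A] by simp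
    finally show "0 \<le> (ket_bra A A *\<^sub>v v) \<bullet>c v"
      using conjugate_square_positive[of "v \<bullet>c A"] by simp
  qed (use A in auto)
  then have "psd_mat (k * m) Y" using assms(1) by (simp add: completely_positive_def Y_def)
  then have "0 \<le> (Y *\<^sub>v W) \<bullet>c W" and Yc: "Y \<in> carrier_mat (k * m) (k * m)"
    using W by (auto simp: psd_mat_def)
  note this(1)
  also have "(Y *\<^sub>v W) \<bullet>c W = (\<Sum>p<k * m. (\<Sum>q<k * m. Y $$ (p, q) * W $ q) * cnj (W $ p))"
    using Yc W by (auto simp: cscalar_sum[of _ "k * m"] scalar_prod_def lessThan_atLeast0 intro!: sum.cong)
  also have "\<dots> = (\<Sum>s<k. \<Sum>i<m. (\<Sum>t<k. \<Sum>j<m. Y $$ (s * m + i, t * m + j) * W $ (t * m + j)) * cnj (W $ (s * m + i)))"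
    by (simp only: sum_block)
  also have "\<dots> = (\<Sum>s<k. \<Sum>i<m. (\<Sum>t<k. \<Sum>j<m. \<Phi> (ket_bra (a s) (a t)) $$ (i, j) * w t $ j) * cnj (w s $ i))"
  proof -
    have "Y $$ (s * m + i, t * m + j) = \<Phi> (ket_bra (a s) (a t)) $$ (i, j)"
      if st: "s < k" "t < k" and ij: "i < m" "j < m" for s t i j
    proof -
      have "mat n n (\<lambda>(i, j). ket_bra A A $$ (s * n + i, t * n + j)) = ket_bra (a s) (a t)"
        using st a[OF st(1)] a[OF st(2)] A by (intro eq_matI) (auto simp: block_index_less A_def)
      then show ?thesis
        using st ij by (simp add: Y_def ampliation_def block_index_less)
    qed
    moreover have "W $ (s * m + i) = w s $ i" if "s < k" "i < m" for s i
      using that by (simp add: W_def block_index_less)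
    ultimately show ?thesis by (intro sum.cong arg_cong2[where f = "(*)"]) auto
  qed
  also have "\<dots> = (\<Sum>s<k. \<Sum>t<k. \<Sum>i<m. (\<Sum>j<m. \<Phi> (ket_bra (a s) (a t)) $$ (i, j) * w t $ j) * cnj (w s $ i))"
    by (simp only: sum_distrib_right sum.swap[of _ "{..<m}" "{..<k}"])
  also have "\<dots> = (\<Sum>s<k. \<Sum>t<k. (\<Phi> (ket_bra (a s) (a t)) *\<^sub>v w t) \<bullet>c w s)"
  proof (intro sum.cong refl)
    fix s t assume st: "s \<in> {..<k}" "t \<in> {..<k}"
    then have "ket_bra (a s) (a t) \<in> carrier_mat n n" using a by simp
    then have "\<Phi> (ket_bra (a s) (a t)) \<in> carrier_mat m m" using assms(2) by auto
    then show "(\<Sum>i<m. (\<Sum>j<m. \<Phi> (ket_bra (a s) (a t)) $$ (i, j) * w t $ j) * cnj (w s $ i)) =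
        (\<Phi> (ket_bra (a s) (a t)) *\<^sub>v w t) \<bullet>c w s"
      using st w[of s] w[of t] by (auto simp: cscalar_sum[of _ m] scalar_prod_def lessThan_atLeast0 intro!: sum.cong)
  qed
  finally show ?thesis .
qed


section \<open>What a correctable algebra must commute with\<close>

lemma mat_trace_unit_vecs:
  assumes "A \<in> carrier_mat n n"
  shows "mat_trace A = (\<Sum>i<n. (A *\<^sub>v unit_vec n i) \<bullet>c unit_vec n i)"
proof -
  have "(A *\<^sub>v unit_vec n i) \<bullet>c unit_vec n i = A $$ (i, i)" if "i < n" for i
    using assms that by (subst cscalar_unit_vec[of _ n]) (auto simp: mult_mat_vec_def)
  then show ?thesis using assms by (simp add: mat_trace_def)
qed

text \<open>A nonnegative quadratic vanishing at 0 has no linear term. The order on complex numbers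
  also makes the values real, which removes the imaginary part of \<open>s\<close>.\<close>

lemma quadratic_nonneg_linear_zero:
  fixes s d :: complex
  assumes "\<And>\<epsilon>. 0 \<le> complex_of_real \<epsilon> * s + complex_of_real \<epsilon> * complex_of_real \<epsilon> * d"
  shows "s = 0"
proof -
  have im: "\<epsilon> * Im s + \<epsilon> * \<epsilon> * Im d = 0" and re: "0 \<le> \<epsilon> * Re s + \<epsilon> * \<epsilon> * Re d" for \<epsilon>
    using assms[of \<epsilon>] by (auto simp: less_eq_complex_def)
  have "Im s = 0" using im[of 1] im[of "-1"] by simp
  moreover have "Re s = 0"
  proof (rule ccontr)
    assume s: "Re s \<noteq> 0"
    define c where "c = \<bar>Re d\<bar> + 1"
    have c: "c > 0" "Re d < c" by (auto simp: c_def)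
    \<comment> \<open>Minimising \<open>\<epsilon> * Re s + \<epsilon> * \<epsilon> * c\<close> up
      to a factor 2; since \<open>c\<close> exceeds \<open>Re d\<close>, the value is
      negative.\<close>
    define \<epsilon> where "\<epsilon> = - Re s / c"
    have "\<epsilon> * Re s + \<epsilon> * \<epsilon> * Re d = (Re s)\<^sup>2 / c * (Re d / c - 1)"
      using c by (simp add: \<epsilon>_def field_simps power2_eq_square)
    also have "\<dots> < 0" using c s by (intro mult_pos_neg) auto
    finally show False using re[of \<epsilon>] by simp
  qed
  ultimately show ?thesis by (simp add: complex_eq_iff)
qed

text \<open>Real \<open>t\<close> gives \<open>p + q = 0\<close>, purely imaginary \<open>t\<close>
  gives \<open>p - q = 0\<close>.\<close>

lemma sesquilinear_nonneg_linear_zero: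
  fixes p q d :: complex
  assumes "\<And>t. 0 \<le> t * p + cnj t * q + t * cnj t * d"
  shows "p = 0" "q = 0"
proof -
  have "p + q = 0"
    using assms[of "complex_of_real _"]
    by (intro quadratic_nonneg_linear_zero[of _ d]) (simp add: algebra_simps)
  moreover have "\<i> * (p - q) = 0"
    using assms[of "complex_of_real _ * \<i>"]
    by (intro quadratic_nonneg_linear_zero[of _ d]) (simp add: algebra_simps)
  ultimately show "p = 0" "q = 0" by auto
qed

definition schwarz_defect ::
    "(complex mat \<Rightarrow> complex mat) \<Rightarrow> complex mat \<Rightarrow> complex vec \<Rightarrow> complex vec \<Rightarrow> complex" where
  "schwarz_defect D X a b =
     mat_trace (mat_adjoint X * X * D (ket_bra a a)) - mat_trace (mat_adjoint X * D (ket_bra b a))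
     - mat_trace (X * D (ket_bra a b)) + mat_trace (D (ket_bra b b))"

text \<open>Writing \<open>D\<^sup>*\<close> for the adjoint, the defect is
  \<open>\<langle>a, D\<^sup>*(X\<^sup>*X) a\<rangle> - 2 Re \<langle>b, D\<^sup>*(X) a\<rangle> + \<langle>b, D\<^sup>*(1) b\<rangle>\<close>, so its nonnegativity is the
  Kadison--Schwarz inequality for \<open>D\<^sup>*\<close>.\<close>

lemma schwarz_defect_nonneg:
  assumes lin: "linear_superop m r D" and cp: "completely_positive m r D"
    and X: "X \<in> carrier_mat r r" and a: "a \<in> carrier_vec m" and b: "b \<in> carrier_vec m"
  shows "0 \<le> schwarz_defect D X a b"
proof -
  have D: "D (ket_bra v w) \<in> carrier_mat r r" if "v \<in> carrier_vec m" "w \<in> carrier_vec m" for v w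
    using linear_superopD(1)[OF lin] that by simp
  have X': "mat_adjoint X \<in> carrier_mat r r" using X by simp
  let ?u = "unit_vec r :: nat \<Rightarrow> complex vec"
  let ?x = "\<lambda>k. mat_adjoint X *\<^sub>v ?u k"
  have x: "?x k \<in> carrier_vec r" for k using X' by (intro mult_mat_vec_carrier) auto
  \<comment> \<open>The contribution of the basis vector \<open>?u k\<close> to the defect; summing
    over \<open>k\<close> turns these inner products into traces.\<close>
  define q where "q = (\<lambda>k. (D (ket_bra a a) *\<^sub>v ?x k) \<bullet>c ?x k - (D (ket_bra b a) *\<^sub>v ?x k) \<bullet>c ?u k
      - (D (ket_bra a b) *\<^sub>v ?u k) \<bullet>c ?x k + (D (ket_bra b b) *\<^sub>v ?u k) \<bullet>c ?u k)"
  have q: "0 \<le> q k" for k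
  proof -
    \<comment> \<open>Two blocks suffice: \<open>a\<close> is paired with the adjoint of
      \<open>X\<close> applied to \<open>?u k\<close>, and \<open>b\<close> with
      \<open>- ?u k\<close>, whose sign creates the negative cross terms.\<close>
    define w where "w = (\<lambda>s :: nat. if s = 0 then ?x k else (-1) \<cdot>\<^sub>v ?u k)"
    define v where "v = (\<lambda>s :: nat. if s = 0 then a else b)"
    have "0 \<le> (\<Sum>s<2. \<Sum>t<2. (D (ket_bra (v s) (v t)) *\<^sub>v w t) \<bullet>c w s)"
      using linear_superopD(1)[OF lin] a b x
      by (intro completely_positive_form[OF cp]) (auto simp: v_def w_def)
    also have "\<dots> = q k"
    proof -
      have m: "D (ket_bra y z) *\<^sub>v ((-1) \<cdot>\<^sub>v ?u k) = (-1) \<cdot>\<^sub>v (D (ket_bra y z) *\<^sub>v ?u k)"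
        if "y \<in> carrier_vec m" "z \<in> carrier_vec m" for y z
        using D[OF that] by (intro mult_mat_vec) auto
      have c: "D (ket_bra y z) *\<^sub>v u \<in> carrier_vec r"
        if "y \<in> carrier_vec m" "z \<in> carrier_vec m" "u \<in> carrier_vec r" for y z u
        using D[OF that(1,2)] that(3) by (intro mult_mat_vec_carrier)
      show ?thesis using a b x
        by (simp add: q_def v_def w_def numeral_2_eq_2 m c
          cscalar_smult_left[of _ r] cscalar_smult_right[of _ r])
    qed
    finally show ?thesis .
  qed
  have "(\<Sum>k<r. q k) = mat_trace (X * (D (ket_bra a a) * mat_adjoint X)) - mat_trace (D (ket_bra b a) * mat_adjoint X)
      - mat_trace (X * D (ket_bra a b)) + mat_trace (D (ket_bra b b))"
  proof -
    have 1: "((X * (D (ket_bra a a) * mat_adjoint X)) *\<^sub>v ?u k) \<bullet>c ?u k = (D (ket_bra a a) *\<^sub>v ?x k) \<bullet>c ?x k" for k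
    proof -
      have "(X * (D (ket_bra a a) * mat_adjoint X)) *\<^sub>v ?u k = X *\<^sub>v ((D (ket_bra a a) * mat_adjoint X) *\<^sub>v ?u k)"
        using X X' D[OF a a] by (intro assoc_mult_mat_vec) auto
      also have "(D (ket_bra a a) * mat_adjoint X) *\<^sub>v ?u k = D (ket_bra a a) *\<^sub>v ?x k"
        using X X' D[OF a a] by (intro assoc_mult_mat_vec) auto
      finally show ?thesis using X D[OF a a] x by (subst cscalar_adjoint[of X r r, symmetric]) auto
    qed
    have 2: "((D (ket_bra b a) * mat_adjoint X) *\<^sub>v ?u k) \<bullet>c ?u k = (D (ket_bra b a) *\<^sub>v ?x k) \<bullet>c ?u k" for k
      using X' D[OF b a] by (subst assoc_mult_mat_vec) auto
    have 3: "((X * D (ket_bra a b)) *\<^sub>v ?u k) \<bullet>c ?u k = (D (ket_bra a b) *\<^sub>v ?u k) \<bullet>c ?x k" for k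
      using X D[OF a b] by (subst assoc_mult_mat_vec, auto) (subst cscalar_adjoint[of X r r], auto)
    have c: "X * (D (ket_bra a a) * mat_adjoint X) \<in> carrier_mat r r" "D (ket_bra b a) * mat_adjoint X \<in> carrier_mat r r"
      "X * D (ket_bra a b) \<in> carrier_mat r r"
      using X X' D a b by (auto intro!: mult_carrier_mat)
    show ?thesis
      by (simp add: q_def sum.distrib sum_subtractf mat_trace_unit_vecs[OF c(1)] mat_trace_unit_vecs[OF c(2)]
          mat_trace_unit_vecs[OF c(3)] mat_trace_unit_vecs[OF D[OF b b]] 1 2 3)
  qed
  also have "mat_trace (X * (D (ket_bra a a) * mat_adjoint X)) = mat_trace (D (ket_bra a a) * mat_adjoint X * X)"
    using X X' D[OF a a] by (intro mat_trace_comm[of _ r r]) auto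
  also have "D (ket_bra a a) * mat_adjoint X * X = D (ket_bra a a) * (mat_adjoint X * X)"
    using X X' D[OF a a] by (intro assoc_mult_mat)
  also have "mat_trace \<dots> = mat_trace (mat_adjoint X * X * D (ket_bra a a))"
    using X X' D[OF a a] by (intro mat_trace_comm[of _ r r]) auto
  also have "mat_trace (D (ket_bra b a) * mat_adjoint X) = mat_trace (mat_adjoint X * D (ket_bra b a))"
    using X' D[OF b a] by (intro mat_trace_comm[of _ r r])
  finally have "(\<Sum>k<r. q k) = schwarz_defect D X a b" by (simp add: schwarz_defect_def)
  then show ?thesis using q sum_nonneg[of "{..<r}" q] by simp
qed

lemma trace_superop_additive:
  assumes "linear_superop m r D" "Y \<in> carrier_mat r r" "Z \<in> carrier_mat m m" "W \<in> carrier_mat m m"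
  shows "mat_trace (Y * D (Z + W)) = mat_trace (Y * D Z) + mat_trace (Y * D W)"
    "mat_trace (D (Z + W)) = mat_trace (D Z) + mat_trace (D W)"
proof -
  note lin = linear_superopD[OF assms(1)]
  have D: "D Z \<in> carrier_mat r r" "D W \<in> carrier_mat r r" using lin(1) assms by auto
  then show "mat_trace (Y * D (Z + W)) = mat_trace (Y * D Z) + mat_trace (Y * D W)"
    using assms by (simp add: lin(2) mult_add_distrib_mat[of _ r r] mat_trace_add[of _ r] mult_carrier_mat[of _ r r])
  show "mat_trace (D (Z + W)) = mat_trace (D Z) + mat_trace (D W)"
    using assms D by (simp add: lin(2) mat_trace_add[of _ r])
qed

lemma trace_superop_smult:
  assumes "linear_superop m r D" "Y \<in> carrier_mat r r" "Z \<in> carrier_mat m m"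
  shows "mat_trace (Y * D (c \<cdot>\<^sub>m Z)) = c * mat_trace (Y * D Z)"
    "mat_trace (D (c \<cdot>\<^sub>m Z)) = c * mat_trace (D Z)"
proof -
  note lin = linear_superopD[OF assms(1)]
  have D: "D Z \<in> carrier_mat r r" using lin(1) assms by auto
  show "mat_trace (Y * D (c \<cdot>\<^sub>m Z)) = c * mat_trace (Y * D Z)"
    using assms D by (simp add: lin(3) mult_smult_distrib[of _ r r] mat_trace_smult[of _ r] mult_carrier_mat[of _ r r])
  show "mat_trace (D (c \<cdot>\<^sub>m Z)) = c * mat_trace (D Z)"
    using assms D by (simp add: lin(3) mat_trace_smult[of _ r])
qed

text \<open>The defect is at its minimum 0, so its first variation under replacing \<open>b\<close>
  by \<open>b + t c\<close> vanishes; the coefficients of \<open>t\<close> and \<open>cnj t\<close>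
  are the two conclusions.\<close>

lemma schwarz_defect_zeroD:
  assumes lin: "linear_superop m r D" and cp: "completely_positive m r D"
    and X: "X \<in> carrier_mat r r" and a: "a \<in> carrier_vec m" and b: "b \<in> carrier_vec m"
    and zero: "schwarz_defect D X a b = 0" and c: "c \<in> carrier_vec m"
  shows "mat_trace (mat_adjoint X * D (ket_bra c a)) = mat_trace (D (ket_bra c b))"
    and "mat_trace (X * D (ket_bra a c)) = mat_trace (D (ket_bra b c))"
proof -
  let ?p = "mat_trace (D (ket_bra c b)) - mat_trace (mat_adjoint X * D (ket_bra c a))"
  let ?q = "mat_trace (D (ket_bra b c)) - mat_trace (X * D (ket_bra a c))"
  have "0 \<le> t * ?p + cnj t * ?q + t * cnj t * mat_trace (D (ket_bra c c))" for t
  proof -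
    have kb: "ket_bra (b + t \<cdot>\<^sub>v c) a = ket_bra b a + t \<cdot>\<^sub>m ket_bra c a"
      "ket_bra a (b + t \<cdot>\<^sub>v c) = ket_bra a b + cnj t \<cdot>\<^sub>m ket_bra a c"
      "ket_bra (b + t \<cdot>\<^sub>v c) (b + t \<cdot>\<^sub>v c) = (ket_bra b b + t \<cdot>\<^sub>m ket_bra c b) + cnj t \<cdot>\<^sub>m (ket_bra b c + t \<cdot>\<^sub>m ket_bra c c)"
      using b c by (simp_all add: ket_bra_add_left[of _ m] ket_bra_add_right[of _ m] ket_bra_smult_left ket_bra_smult_right)
    have X': "mat_adjoint X \<in> carrier_mat r r" using X by simp
    note add = trace_superop_additive[OF lin X] trace_superop_smult[OF lin X]
    note add' = trace_superop_additive[OF lin X'] trace_superop_smult[OF lin X']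
    have k: "ket_bra v w \<in> carrier_mat m m" if "v \<in> {a, b, c}" "w \<in> {a, b, c}" for v w
      using that a b c by auto
    have 1: "mat_trace (mat_adjoint X * D (ket_bra (b + t \<cdot>\<^sub>v c) a)) =
        mat_trace (mat_adjoint X * D (ket_bra b a)) + t * mat_trace (mat_adjoint X * D (ket_bra c a))"
      unfolding kb using k by (simp add: add')
    have 2: "mat_trace (X * D (ket_bra a (b + t \<cdot>\<^sub>v c))) =
        mat_trace (X * D (ket_bra a b)) + cnj t * mat_trace (X * D (ket_bra a c))"
      unfolding kb using k by (simp add: add)
    have 3: "mat_trace (D (ket_bra (b + t \<cdot>\<^sub>v c) (b + t \<cdot>\<^sub>v c))) =
        mat_trace (D (ket_bra b b)) + t * mat_trace (D (ket_bra c b))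
        + cnj t * (mat_trace (D (ket_bra b c)) + t * mat_trace (D (ket_bra c c)))"
      unfolding kb using k by (simp add: add del: assoc_add_mat)
    have "0 \<le> schwarz_defect D X a (b + t \<cdot>\<^sub>v c)"
      using b c by (intro schwarz_defect_nonneg[OF lin cp X a]) auto
    also have "\<dots> = schwarz_defect D X a b + t * ?p + cnj t * ?q + t * cnj t * mat_trace (D (ket_bra c c))"
      unfolding schwarz_defect_def 1 2 3 by (simp add: algebra_simps)
    finally show ?thesis by (simp add: zero)
  qed
  from sesquilinear_nonneg_linear_zero[OF this]
  show "mat_trace (mat_adjoint X * D (ket_bra c a)) = mat_trace (D (ket_bra c b))"
    "mat_trace (X * D (ket_bra a c)) = mat_trace (D (ket_bra b c))" by auto
qed

lemma mat_trace_superop_kraus: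
  assumes lin: "linear_superop m r D" and Y: "Y \<in> carrier_mat r r" and X: "X \<in> carrier_mat n n"
  shows "set Fs \<subseteq> carrier_mat m n \<Longrightarrow>
    mat_trace (Y * D (kraus_map m Fs X)) = (\<Sum>F\<leftarrow>Fs. mat_trace (Y * D (F * X * mat_adjoint F)))"
proof (induction Fs)
  case Nil
  have "mat_trace (Y * D (0 \<cdot>\<^sub>m 0\<^sub>m m m)) = 0 * mat_trace (Y * D (0\<^sub>m m m))"
    by (rule trace_superop_smult(1)[OF lin Y, of "0\<^sub>m m m"]) simp
  then show ?case by simp
next
  case (Cons F Fs)
  then have "F * X * mat_adjoint F \<in> carrier_mat m m" using X by auto
  then show ?case
    using Cons X kraus_map_carrier[of Fs m n X] by (simp add: trace_superop_additive(1)[OF lin Y])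
qed

text \<open>One trace, of the adjoint of \<open>X\<close> times
  \<open>D (ket_bra (G u) (F v))\<close>, is evaluated twice: by equality for \<open>X\<close> at
  \<open>F v\<close>, and by equality for the adjoint of \<open>X\<close> at \<open>G u\<close>. In
  operator terms, the adjoint of \<open>X\<close> commutes with \<open>F* G\<close>.\<close>

lemma fixed_algebra_intertwines:
  assumes lin: "linear_superop m r D" and cp: "completely_positive m r D"
    and tp: "\<And>Z. Z \<in> carrier_mat m m \<Longrightarrow> mat_trace (D Z) = mat_trace Z"
    and Fs: "set Fs \<subseteq> carrier_mat m r"
    and R: "R \<subseteq> carrier_mat r r" "1\<^sub>m r \<in> R"
      "\<And>X. X \<in> R \<Longrightarrow> mat_adjoint X \<in> R" "\<And>X Y. X \<in> R \<Longrightarrow> Y \<in> R \<Longrightarrow> X * Y \<in> R"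
    and fix_R: "\<And>X Z. X \<in> R \<Longrightarrow> Z \<in> carrier_mat r r \<Longrightarrow>
      mat_trace (X * D (kraus_map m Fs Z)) = mat_trace (X * Z)"
    and X: "X \<in> R" and F: "F \<in> set Fs" and G: "G \<in> set Fs"
    and u: "u \<in> carrier_vec r" and v: "v \<in> carrier_vec r"
  shows "(G *\<^sub>v u) \<bullet>c (F *\<^sub>v (X *\<^sub>v v)) = (G *\<^sub>v (mat_adjoint X *\<^sub>v u)) \<bullet>c (F *\<^sub>v v)"
proof -
  have zero: "schwarz_defect D X (F *\<^sub>v v) (F *\<^sub>v (X *\<^sub>v v)) = 0"
    if X: "X \<in> R" and F: "F \<in> set Fs" and v: "v \<in> carrier_vec r" for X F v
  proof -
    have Xc: "X \<in> carrier_mat r r" using X R by auto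
    have X'c: "mat_adjoint X \<in> carrier_mat r r" using Xc by simp
    have Xv: "X *\<^sub>v v \<in> carrier_vec r" using Xc v by simp
    define q where "q = (\<lambda>F. schwarz_defect D X (F *\<^sub>v v) (F *\<^sub>v (X *\<^sub>v v)))"
    have q0: "0 \<le> q F" if "F \<in> set Fs" for F
      unfolding q_def using that Fs v Xv Xc by (intro schwarz_defect_nonneg[OF lin cp Xc] mult_mat_vec_carrier) auto
    \<comment> \<open>The fixed-point property on a rank-one operator: summation over all Kraus
      operators undoes the channel and \<open>D\<close> together.\<close>
    have sum: "(\<Sum>F\<leftarrow>Fs. mat_trace (Y * D (ket_bra (F *\<^sub>v x) (F *\<^sub>v y)))) = mat_trace (Y * ket_bra x y)"
      if "Y \<in> R" "x \<in> carrier_vec r" "y \<in> carrier_vec r" for Y x y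
    proof -
      have "mat_trace (Y * ket_bra x y) = mat_trace (Y * D (kraus_map m Fs (ket_bra x y)))"
        using fix_R that by simp
      also have "\<dots> = (\<Sum>F\<leftarrow>Fs. mat_trace (Y * D (F * ket_bra x y * mat_adjoint F)))"
        using that R by (intro mat_trace_superop_kraus[OF lin _ _ Fs]) auto
      also have "\<dots> = (\<Sum>F\<leftarrow>Fs. mat_trace (Y * D (ket_bra (F *\<^sub>v x) (F *\<^sub>v y))))"
        using Fs that by (intro arg_cong[where f = sum_list] map_cong refl) (auto simp: conj_ket_bra[of _ m r])
      finally show ?thesis by simp
    qed
    \<comment> \<open>Writing the unit of \<open>R\<close> in front brings the last term of the
      defect into the shape covered by \<open>sum\<close>.\<close>
    have one: "1\<^sub>m r * D (ket_bra (F *\<^sub>v x) (F *\<^sub>v y)) = D (ket_bra (F *\<^sub>v x) (F *\<^sub>v y))"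
      if "F \<in> set Fs" "x \<in> carrier_vec r" "y \<in> carrier_vec r" for F x y
    proof -
      have "F *\<^sub>v x \<in> carrier_vec m" "F *\<^sub>v y \<in> carrier_vec m" using that Fs by auto
      then show ?thesis using linear_superopD(1)[OF lin] by (intro left_mult_one_mat[of _ r r]) auto
    qed
    have "(\<Sum>F\<leftarrow>Fs. q F) =
        (\<Sum>F\<leftarrow>Fs. mat_trace (mat_adjoint X * X * D (ket_bra (F *\<^sub>v v) (F *\<^sub>v v))))
      - (\<Sum>F\<leftarrow>Fs. mat_trace (mat_adjoint X * D (ket_bra (F *\<^sub>v (X *\<^sub>v v)) (F *\<^sub>v v))))
      - (\<Sum>F\<leftarrow>Fs. mat_trace (X * D (ket_bra (F *\<^sub>v v) (F *\<^sub>v (X *\<^sub>v v)))))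
      + (\<Sum>F\<leftarrow>Fs. mat_trace (D (ket_bra (F *\<^sub>v (X *\<^sub>v v)) (F *\<^sub>v (X *\<^sub>v v)))))"
      by (simp add: q_def schwarz_defect_def sum_list_addf sum_list_subtractf)
    also have "(\<Sum>F\<leftarrow>Fs. mat_trace (D (ket_bra (F *\<^sub>v (X *\<^sub>v v)) (F *\<^sub>v (X *\<^sub>v v))))) =
        (\<Sum>F\<leftarrow>Fs. mat_trace (1\<^sub>m r * D (ket_bra (F *\<^sub>v (X *\<^sub>v v)) (F *\<^sub>v (X *\<^sub>v v)))))"
      using Xv one by (intro arg_cong[where f = sum_list] map_cong refl) simp
    also have "(\<Sum>F\<leftarrow>Fs. mat_trace (mat_adjoint X * X * D (ket_bra (F *\<^sub>v v) (F *\<^sub>v v))))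
      - (\<Sum>F\<leftarrow>Fs. mat_trace (mat_adjoint X * D (ket_bra (F *\<^sub>v (X *\<^sub>v v)) (F *\<^sub>v v))))
      - (\<Sum>F\<leftarrow>Fs. mat_trace (X * D (ket_bra (F *\<^sub>v v) (F *\<^sub>v (X *\<^sub>v v)))))
      + \<dots> = mat_trace (mat_adjoint X * X * ket_bra v v) - mat_trace (mat_adjoint X * ket_bra (X *\<^sub>v v) v)
      - mat_trace (X * ket_bra v (X *\<^sub>v v)) + mat_trace (1\<^sub>m r * ket_bra (X *\<^sub>v v) (X *\<^sub>v v))"
      using X v Xv R by (simp add: sum)
    also have "\<dots> = 0"
    proof -
      have XX: "mat_adjoint X * X \<in> carrier_mat r r" using Xc X'c by auto
      let ?n = "(X *\<^sub>v v) \<bullet>c (X *\<^sub>v v)"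
      have "(mat_adjoint X * X) *\<^sub>v v = mat_adjoint X *\<^sub>v (X *\<^sub>v v)"
        using Xc X'c v by (intro assoc_mult_mat_vec)
      then have "mat_trace (mat_adjoint X * X * ket_bra v v) = (mat_adjoint X *\<^sub>v (X *\<^sub>v v)) \<bullet>c v"
        using mat_trace_mult_ket_bra[OF XX v v] by simp
      moreover have "mat_trace (mat_adjoint X * ket_bra (X *\<^sub>v v) v) = (mat_adjoint X *\<^sub>v (X *\<^sub>v v)) \<bullet>c v"
        by (rule mat_trace_mult_ket_bra[OF X'c Xv v])
      moreover have "(mat_adjoint X *\<^sub>v (X *\<^sub>v v)) \<bullet>c v = ?n" by (rule cscalar_adjoint'[OF Xc Xv v])
      moreover have "mat_trace (X * ket_bra v (X *\<^sub>v v)) = ?n" by (rule mat_trace_mult_ket_bra[OF Xc v Xv])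
      moreover have "mat_trace (1\<^sub>m r * ket_bra (X *\<^sub>v v) (X *\<^sub>v v)) = ?n"
        using mat_trace_mult_ket_bra[OF one_carrier_mat Xv Xv] one_mult_mat_vec[OF Xv] by simp
      ultimately show ?thesis by simp
    qed
    finally have "(\<Sum>F\<leftarrow>Fs. q F) = 0" .
    \<comment> \<open>Nonnegative terms with sum zero: equality holds for each Kraus operator
      separately.\<close>
    then have "q F = 0" using q0 F sum_list_nonneg_eq_0_iff[of "map q Fs"] by auto
    then show ?thesis by (simp add: q_def)
  qed
  have Fc: "F \<in> carrier_mat m r" and Gc: "G \<in> carrier_mat m r" using F G Fs by auto
  have Xc: "X \<in> carrier_mat r r" and X': "mat_adjoint X \<in> R" using X R by auto
  then have X'c: "mat_adjoint X \<in> carrier_mat r r" by simp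
  have Xv: "X *\<^sub>v v \<in> carrier_vec r" and X'u: "mat_adjoint X *\<^sub>v u \<in> carrier_vec r"
    using mult_mat_vec_carrier[OF Xc v] mult_mat_vec_carrier[OF X'c u] by auto
  have c: "F *\<^sub>v v \<in> carrier_vec m" "G *\<^sub>v u \<in> carrier_vec m" "F *\<^sub>v (X *\<^sub>v v) \<in> carrier_vec m"
    "G *\<^sub>v (mat_adjoint X *\<^sub>v u) \<in> carrier_vec m"
    using Fc Gc u v Xv X'u by (auto intro: mult_mat_vec_carrier)
  have "mat_trace (mat_adjoint X * D (ket_bra (G *\<^sub>v u) (F *\<^sub>v v))) =
      mat_trace (D (ket_bra (G *\<^sub>v u) (F *\<^sub>v (X *\<^sub>v v))))"
    by (rule schwarz_defect_zeroD(1)[OF lin cp Xc c(1,3) zero[OF X F v] c(2)])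
  moreover have "mat_trace (mat_adjoint X * D (ket_bra (G *\<^sub>v u) (F *\<^sub>v v))) =
      mat_trace (D (ket_bra (G *\<^sub>v (mat_adjoint X *\<^sub>v u)) (F *\<^sub>v v)))"
    by (rule schwarz_defect_zeroD(2)[OF lin cp X'c c(2,4) zero[OF X' G u] c(1)])
  ultimately show ?thesis using c by (simp add: tp mat_trace_ket_bra[of _ m])
qed

text \<open>Restricting a channel to a code, or composing it with an encoding, multiplies its Kraus
  operators by \<open>V\<close> on the right.\<close>

lemma kraus_map_comp:
  assumes "set Ks \<subseteq> carrier_mat m n" "V \<in> carrier_mat n r" "Y \<in> carrier_mat r r"
  shows "kraus_map m Ks (V * Y * mat_adjoint V) = kraus_map m (map (\<lambda>K. K * V) Ks) Y"
  using assms(1)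
proof (induction Ks)
  case (Cons K Ks)
  then have K: "K \<in> carrier_mat m n" "mat_adjoint K \<in> carrier_mat n m" by auto
  have V': "mat_adjoint V \<in> carrier_mat r n" using assms by simp
  have KV: "K * V \<in> carrier_mat m r" "K * V * Y \<in> carrier_mat m r" "V * Y \<in> carrier_mat n r"
    using K assms(2,3) by auto
  have "K * (V * Y * mat_adjoint V) * mat_adjoint K = K * (V * Y) * mat_adjoint V * mat_adjoint K"
    using K V' KV by (simp add: assoc_mult_mat[of K m n "V * Y" r "mat_adjoint V" n])
  also have "K * (V * Y) = K * V * Y"
    using K assms(2,3) by (intro assoc_mult_mat[symmetric])
  also have "K * V * Y * mat_adjoint V * mat_adjoint K = K * V * Y * (mat_adjoint V * mat_adjoint K)"
    using K V' KV by (intro assoc_mult_mat)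
  also have "mat_adjoint V * mat_adjoint K = mat_adjoint (K * V)"
    using K assms(2) by (intro mat_adjoint_mult[symmetric])
  finally have "K * (V * Y * mat_adjoint V) * mat_adjoint K = K * V * Y * mat_adjoint (K * V)" .
  then show ?case using Cons by simp
qed simp

text \<open>The relation for the compressed algebra, with Kraus operators \<open>K V\<close>, is
  evaluated at the images of \<open>x\<close> and \<open>y\<close> under the adjoint of
  \<open>V\<close>. There \<open>V\<close> meets its adjoint and becomes \<open>P\<close>, so the
  chosen basis of the code disappears from the result.\<close>

theorem correctable_intertwines:
  assumes corr: "correctable n m \<Phi> S"
    and Ks: "set Ks \<subseteq> carrier_mat m n"
    and \<Phi>: "\<And>X. X \<in> carrier_mat n n \<Longrightarrow> \<Phi> X = kraus_map m Ks X"
  obtains P where "unit_projection S P"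
    and "\<And>A K L x y. A \<in> S \<Longrightarrow> K \<in> set Ks \<Longrightarrow> L \<in> set Ks \<Longrightarrow> x \<in> carrier_vec n \<Longrightarrow> y \<in> carrier_vec n \<Longrightarrow>
      (L *\<^sub>v (P *\<^sub>v x)) \<bullet>c (K *\<^sub>v (A *\<^sub>v y)) = (L *\<^sub>v (mat_adjoint A *\<^sub>v x)) \<bullet>c (K *\<^sub>v (P *\<^sub>v y))"
proof -
  from corr obtain P r V D where S: "star_subalgebra n S" and P: "unit_projection S P"
    and V: "V \<in> carrier_mat n r" and VV: "mat_adjoint V * V = 1\<^sub>m r" "V * mat_adjoint V = P"
    and D: "quantum_channel m r D"
    and fixed: "\<And>A. A \<in> S \<Longrightarrow> superop_adjoint r (D \<circ> (\<lambda>Y. \<Phi> (V * Y * mat_adjoint V)))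
      (mat_adjoint V * A * V) = mat_adjoint V * A * V"
    unfolding correctable_def by blast
  have lin: "linear_superop m r D" and cp: "completely_positive m r D"
    and tp: "\<And>Z. Z \<in> carrier_mat m m \<Longrightarrow> mat_trace (D Z) = mat_trace Z"
    using D by (auto simp: quantum_channel_def)
  have V': "mat_adjoint V \<in> carrier_mat r n" using V by simp
  have Sc: "A \<in> carrier_mat n n" if "A \<in> S" for A using S that by (auto simp: star_subalgebra_def)
  have PS: "P \<in> S" "\<And>A. A \<in> S \<Longrightarrow> P * A = A" "\<And>A. A \<in> S \<Longrightarrow> A * P = A"
    using P by (auto simp: unit_projection_def)
  define Fs where "Fs = map (\<lambda>K. K * V) Ks"
  have Fs: "set Fs \<subseteq> carrier_mat m r" using Ks V by (auto simp: Fs_def)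
  define R where "R = (\<lambda>A. mat_adjoint V * A * V) ` S"
  have Rc: "R \<subseteq> carrier_mat r r" using Sc V V' by (auto simp: R_def)
  \<comment> \<open>Compression is multiplicative on \<open>S\<close> because \<open>V\<close> times
    its adjoint is \<open>P\<close>, the unit of \<open>S\<close>.\<close>
  have conj_mult: "(mat_adjoint V * A * V) * (mat_adjoint V * B * V) = mat_adjoint V * (A * B) * V"
    if AB: "A \<in> S" "B \<in> S" for A B
  proof -
    have c: "A \<in> carrier_mat n n" "B \<in> carrier_mat n n" "P \<in> carrier_mat n n" using AB PS Sc by auto
    have AV: "mat_adjoint V * A \<in> carrier_mat r n" "mat_adjoint V * B \<in> carrier_mat r n" "B * V \<in> carrier_mat n r"
      using c V V' by auto
    have "(mat_adjoint V * A * V) * (mat_adjoint V * B * V) = mat_adjoint V * A * (V * (mat_adjoint V * B * V))"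
      using AV V V' c by (intro assoc_mult_mat[of _ r n _ r _ r] mult_carrier_mat[of _ r n _ r]) auto
    also have "V * (mat_adjoint V * B * V) = P * (B * V)"
      unfolding VV(2)[symmetric] assoc_mult_mat[OF V' c(2) V] using V V' AV by (intro assoc_mult_mat[symmetric])
    also have "\<dots> = P * B * V" using c V by (intro assoc_mult_mat[symmetric])
    also have "\<dots> = B * V" using PS AB by simp
    also have "mat_adjoint V * A * (B * V) = mat_adjoint V * A * B * V"
      using c AV V by (intro assoc_mult_mat[symmetric])
    also have "mat_adjoint V * A * B = mat_adjoint V * (A * B)" using c V' by (intro assoc_mult_mat)
    finally show ?thesis .
  qed
  have conj_adj: "mat_adjoint (mat_adjoint V * A * V) = mat_adjoint V * mat_adjoint A * V" if A: "A \<in> S" for A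
  proof -
    have c: "A \<in> carrier_mat n n" "mat_adjoint A \<in> carrier_mat n n" using A Sc by auto
    have "mat_adjoint (mat_adjoint V * A * V) = mat_adjoint V * mat_adjoint (mat_adjoint V * A)"
      using c V V' by (intro mat_adjoint_mult[of _ r n]) auto
    also have "mat_adjoint (mat_adjoint V * A) = mat_adjoint A * V"
      using c V V' by (subst mat_adjoint_mult[of _ r n]) auto
    also have "mat_adjoint V * (mat_adjoint A * V) = mat_adjoint V * mat_adjoint A * V"
      using c V V' by (intro assoc_mult_mat[symmetric])
    finally show ?thesis .
  qed
  \<comment> \<open>The compressed unit is the identity, so the compressed algebra is unital as
    \<open>fixed_algebra_intertwines\<close> requires.\<close>
  have "mat_adjoint V * P * V = mat_adjoint V * V * (mat_adjoint V * V)"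
  proof -
    have "mat_adjoint V * P = mat_adjoint V * V * mat_adjoint V"
      unfolding VV(2)[symmetric] using V V' by (intro assoc_mult_mat[symmetric])
    moreover have "mat_adjoint V * V * mat_adjoint V * V = mat_adjoint V * V * (mat_adjoint V * V)"
      using V V' mult_carrier_mat[OF V' V] by (intro assoc_mult_mat[of _ r r _ n _ r])
    ultimately show ?thesis by simp
  qed
  then have one: "1\<^sub>m r \<in> R" using PS by (auto simp: R_def VV(1) intro!: image_eqI[of _ _ P])
  have fix_R: "mat_trace (X * D (kraus_map m Fs Z)) = mat_trace (X * Z)"
    if X: "X \<in> R" and Z: "Z \<in> carrier_mat r r" for X Z
  proof -
    let ?\<Psi> = "D \<circ> (\<lambda>Y. \<Phi> (V * Y * mat_adjoint V))"
    have \<Psi>: "?\<Psi> Y = D (kraus_map m Fs Y)" if "Y \<in> carrier_mat r r" for Y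
      using that V Ks \<Phi>[of "V * Y * mat_adjoint V"] kraus_map_comp[OF Ks V that]
      by (simp add: Fs_def)
    note l1 = linear_superopD[OF linear_superop_kraus_map[OF Fs]]
    have lin\<Psi>: "linear_superop r r ?\<Psi>"
      unfolding linear_superop_def
      by (auto simp: \<Psi> l1 linear_superopD[OF lin] simp del: o_apply)
    have "mat_trace (X * ?\<Psi> Z) = mat_trace (superop_adjoint r ?\<Psi> X * Z)"
      using X Z Rc by (intro superop_adjoint_trace[OF lin\<Psi>]) auto
    moreover have "superop_adjoint r ?\<Psi> X = X" using X fixed by (auto simp: R_def)
    ultimately show ?thesis using \<Psi>[OF Z] by simp
  qed
  have "(L *\<^sub>v (P *\<^sub>v x)) \<bullet>c (K *\<^sub>v (A *\<^sub>v y)) = (L *\<^sub>v (mat_adjoint A *\<^sub>v x)) \<bullet>c (K *\<^sub>v (P *\<^sub>v y))"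
    if A: "A \<in> S" and K: "K \<in> set Ks" and L: "L \<in> set Ks" and x: "x \<in> carrier_vec n" and y: "y \<in> carrier_vec n"
    for A K L x y
  proof -
    have F: "(J * V) *\<^sub>v (mat_adjoint V *\<^sub>v z) = J *\<^sub>v (P *\<^sub>v z)" if "J \<in> set Ks" "z \<in> carrier_vec n" for J z
    proof -
      have J: "J \<in> carrier_mat m n" using that Ks by auto
      have "(J * V) *\<^sub>v (mat_adjoint V *\<^sub>v z) = J *\<^sub>v (V *\<^sub>v (mat_adjoint V *\<^sub>v z))"
        using J V mult_mat_vec_carrier[OF V' that(2)] by (rule assoc_mult_mat_vec)
      also have "V *\<^sub>v (mat_adjoint V *\<^sub>v z) = P *\<^sub>v z"
        unfolding VV(2)[symmetric] using V V' that by (intro assoc_mult_mat_vec[symmetric])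
      finally show ?thesis .
    qed
    have FX: "(J * V) *\<^sub>v ((mat_adjoint V * B * V) *\<^sub>v (mat_adjoint V *\<^sub>v z)) = J *\<^sub>v (B *\<^sub>v z)"
      if J: "J \<in> set Ks" and B: "B \<in> S" and z: "z \<in> carrier_vec n" for J B z
    proof -
      have Bc: "B \<in> carrier_mat n n" "P \<in> carrier_mat n n" using B PS Sc by auto
      have V'z: "mat_adjoint V *\<^sub>v z \<in> carrier_vec r" using V' z by (intro mult_mat_vec_carrier)
      have "(mat_adjoint V * B * V) *\<^sub>v (mat_adjoint V *\<^sub>v z) = (mat_adjoint V * B) *\<^sub>v (V *\<^sub>v (mat_adjoint V *\<^sub>v z))"
        using V V' Bc V'z by (intro assoc_mult_mat_vec) auto
      also have "V *\<^sub>v (mat_adjoint V *\<^sub>v z) = P *\<^sub>v z"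
        unfolding VV(2)[symmetric] using V V' z by (intro assoc_mult_mat_vec[symmetric])
      also have "(mat_adjoint V * B) *\<^sub>v (P *\<^sub>v z) = mat_adjoint V *\<^sub>v (B *\<^sub>v (P *\<^sub>v z))"
        using V' Bc z by (intro assoc_mult_mat_vec) auto
      also have "B *\<^sub>v (P *\<^sub>v z) = (B * P) *\<^sub>v z"
        using Bc z by (intro assoc_mult_mat_vec[symmetric])
      also have "B * P = B" using B PS by simp
      finally have *: "(mat_adjoint V * B * V) *\<^sub>v (mat_adjoint V *\<^sub>v z) = mat_adjoint V *\<^sub>v (B *\<^sub>v z)" .
      have "P *\<^sub>v (B *\<^sub>v z) = (P * B) *\<^sub>v z" using Bc z by (intro assoc_mult_mat_vec[symmetric])
      then have "P *\<^sub>v (B *\<^sub>v z) = B *\<^sub>v z" using PS B by simp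
      then show ?thesis unfolding * using F[OF J, of "B *\<^sub>v z"] Bc z by simp
    qed
    have "((L * V) *\<^sub>v (mat_adjoint V *\<^sub>v x)) \<bullet>c ((K * V) *\<^sub>v ((mat_adjoint V * A * V) *\<^sub>v (mat_adjoint V *\<^sub>v y))) =
        ((L * V) *\<^sub>v (mat_adjoint (mat_adjoint V * A * V) *\<^sub>v (mat_adjoint V *\<^sub>v x))) \<bullet>c ((K * V) *\<^sub>v (mat_adjoint V *\<^sub>v y))"
    proof (rule fixed_algebra_intertwines[OF lin cp tp Fs Rc one _ _ fix_R])
      show "mat_adjoint X \<in> R" if "X \<in> R" for X
        using that S conj_adj by (auto simp: R_def star_subalgebra_def)
      show "X * Y \<in> R" if "X \<in> R" "Y \<in> R" for X Y
        using that S conj_mult by (auto simp: R_def star_subalgebra_def)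
    qed (use A K L V' x y in \<open>auto simp: R_def Fs_def intro: mult_mat_vec_carrier\<close>)
    moreover have "mat_adjoint A \<in> S" using A S by (auto simp: star_subalgebra_def)
    ultimately show ?thesis using F FX A K L x y by (simp add: conj_adj)
  qed
  then show ?thesis using that P by blast
qed


section \<open>The operator norm is a C*-norm\<close>

definition vnorm :: "complex vec \<Rightarrow> real" where
  "vnorm v = sqrt (Re (v \<bullet>c v))"

lemma Re_cscalar_self: "v \<in> carrier_vec n \<Longrightarrow> Re (v \<bullet>c v) = (\<Sum>i<n. (cmod (v $ i))\<^sup>2)"
  by (simp add: cscalar_sum complex_norm_square[symmetric] cmod_power2[symmetric] power2_eq_square
      flip: of_real_mult of_real_power)

text \<open>The identification with \<open>L2_set\<close> supplies the triangle and Cauchy--Schwarz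
  inequalities.\<close>

lemma vnorm_L2_set: "v \<in> carrier_vec n \<Longrightarrow> vnorm v = L2_set (\<lambda>i. cmod (v $ i)) {..<n}"
  by (simp add: vnorm_def Re_cscalar_self L2_set_def)

lemma vnorm_nonneg [simp]: "0 \<le> vnorm v"
  by (metis L2_set_nonneg carrier_vec_dim_vec vnorm_L2_set)

lemma vnorm_eq_0_iff: "v \<in> carrier_vec n \<Longrightarrow> vnorm v = 0 \<longleftrightarrow> v = 0\<^sub>v n"
  by (auto simp: vnorm_L2_set L2_set_eq_0_iff)

lemma vnorm_smult: "vnorm (c \<cdot>\<^sub>v v) = cmod c * vnorm v"
proof -
  have "v \<in> carrier_vec (dim_vec v)" "c \<cdot>\<^sub>v v \<in> carrier_vec (dim_vec v)" by auto
  then show ?thesis by (auto simp: vnorm_L2_set[of _ "dim_vec v"] norm_mult L2_set_right_distrib intro!: L2_set_cong)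
qed

lemma vnorm_triangle:
  assumes "v \<in> carrier_vec n" "w \<in> carrier_vec n"
  shows "vnorm (v + w) \<le> vnorm v + vnorm w"
proof -
  have "vnorm (v + w) = L2_set (\<lambda>i. cmod (v $ i + w $ i)) {..<n}"
    using assms by (subst vnorm_L2_set[of _ n]) (auto intro!: L2_set_cong)
  also have "\<dots> \<le> L2_set (\<lambda>i. cmod (v $ i) + cmod (w $ i)) {..<n}"
    by (intro L2_set_mono norm_triangle_ineq) auto
  also have "\<dots> \<le> vnorm v + vnorm w"
    using L2_set_triangle_ineq by (simp add: vnorm_L2_set[OF assms(1)] vnorm_L2_set[OF assms(2)])
  finally show ?thesis .
qed

lemma vnorm_cauchy_schwarz:
  assumes "v \<in> carrier_vec n" "w \<in> carrier_vec n"
  shows "cmod (v \<bullet>c w) \<le> vnorm v * vnorm w"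
proof -
  have "cmod (v \<bullet>c w) \<le> (\<Sum>i<n. \<bar>cmod (v $ i)\<bar> * \<bar>cmod (w $ i)\<bar>)"
    using assms by (auto simp: cscalar_sum[of _ n] norm_mult intro!: sum_norm_le)
  also have "\<dots> \<le> vnorm v * vnorm w"
    unfolding vnorm_L2_set[OF assms(1)] vnorm_L2_set[OF assms(2)] by (rule L2_set_mult_ineq)
  finally show ?thesis .
qed

lemma vnorm_unit: "v \<bullet>c v = 1 \<Longrightarrow> vnorm v = 1"
  by (simp add: vnorm_def)

lemma op_norm_vnorm:
  "X \<in> carrier_mat n m \<Longrightarrow> op_norm X = (SUP v\<in>{v \<in> carrier_vec m. v \<bullet>c v = 1}. vnorm (X *\<^sub>v v))"
  by (auto simp: op_norm_def vnorm_def)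

text \<open>\<open>op_norm\<close> is a supremum of reals, usable only once the set is bounded.
  Coordinates of a unit vector have modulus at most 1, so the sum of the moduli of all entries is a
  bound.\<close>

lemma bdd_above_op_norm:
  assumes X: "X \<in> carrier_mat n m"
  shows "bdd_above ((\<lambda>v. vnorm (X *\<^sub>v v)) ` {v \<in> carrier_vec m. v \<bullet>c v = 1})"
proof (rule bdd_aboveI2)
  fix v :: "complex vec" assume "v \<in> {v \<in> carrier_vec m. v \<bullet>c v = 1}"
  then have v: "v \<in> carrier_vec m" "vnorm v = 1" by (auto simp: vnorm_unit)
  have le1: "cmod (v $ j) \<le> 1" if "j < m" for j
    using member_le_L2_set[of "{..<m}" j "\<lambda>i. cmod (v $ i)"] v that by (simp add: vnorm_L2_set[of _ m])
  have Xv: "X *\<^sub>v v \<in> carrier_vec n" using X v by simp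
  have "vnorm (X *\<^sub>v v) \<le> (\<Sum>i<n. cmod ((X *\<^sub>v v) $ i))"
    by (simp add: vnorm_L2_set[OF Xv] L2_set_le_sum)
  also have "\<dots> \<le> (\<Sum>i<n. \<Sum>j<m. cmod (X $$ (i, j)))"
  proof (intro sum_mono)
    fix i assume i: "i \<in> {..<n}"
    have "cmod ((X *\<^sub>v v) $ i) = cmod (\<Sum>j<m. X $$ (i, j) * v $ j)"
      using X v i by (simp add: scalar_prod_def lessThan_atLeast0)
    also have "\<dots> \<le> (\<Sum>j<m. cmod (X $$ (i, j)))"
      using le1 by (intro sum_norm_le) (auto simp: norm_mult intro!: mult_left_le)
    finally show "cmod ((X *\<^sub>v v) $ i) \<le> (\<Sum>j<m. cmod (X $$ (i, j)))" .
  qed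
  finally show "vnorm (X *\<^sub>v v) \<le> (\<Sum>i<n. \<Sum>j<m. cmod (X $$ (i, j)))" .
qed

lemma op_norm_unit_bound:
  assumes "X \<in> carrier_mat n m" "v \<in> carrier_vec m" "v \<bullet>c v = 1"
  shows "vnorm (X *\<^sub>v v) \<le> op_norm X"
  unfolding op_norm_vnorm[OF assms(1)] using assms
  by (intro cSUP_upper bdd_above_op_norm) auto

text \<open>\<open>0 < m\<close> yields a unit vector, so the supremum does not range over the empty
  set.\<close>

lemma op_norm_leI:
  assumes "X \<in> carrier_mat n m" "0 < m"
    and "\<And>v. v \<in> carrier_vec m \<Longrightarrow> v \<bullet>c v = 1 \<Longrightarrow> vnorm (X *\<^sub>v v) \<le> c"
  shows "op_norm X \<le> c"
proof -
  have "unit_vec m 0 \<in> {v \<in> carrier_vec m. v \<bullet>c v = (1 :: complex)}"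
    using assms(2) by (auto simp: cscalar_unit_vec[of _ m])
  then have "{v \<in> carrier_vec m. v \<bullet>c v = (1 :: complex)} \<noteq> {}" by blast
  then show ?thesis unfolding op_norm_vnorm[OF assms(1)] using assms(3)
    by (intro cSUP_least) auto
qed

lemma op_norm_nonneg:
  assumes "X \<in> carrier_mat n m" "0 < m"
  shows "0 \<le> op_norm X"
proof -
  have "unit_vec m 0 \<bullet>c unit_vec m 0 = (1 :: complex)"
    using assms(2) by (auto simp: cscalar_unit_vec[of _ m])
  then have "vnorm (X *\<^sub>v unit_vec m 0) \<le> op_norm X"
    using assms by (intro op_norm_unit_bound) auto
  then show ?thesis using vnorm_nonneg order_trans by blast
qed

lemma cscalar_self_vnorm:
  assumes "v \<in> carrier_vec n"
  shows "v \<bullet>c v = complex_of_real ((vnorm v)\<^sup>2)"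
proof -
  have "0 \<le> v \<bullet>c v" by auto
  then have "Im (v \<bullet>c v) = 0" "0 \<le> Re (v \<bullet>c v)" by (auto simp: less_eq_complex_def)
  then show ?thesis by (simp add: vnorm_def complex_eq_iff)
qed

lemma op_norm_bound:
  assumes X: "X \<in> carrier_mat n m" and v: "v \<in> carrier_vec m"
  shows "vnorm (X *\<^sub>v v) \<le> op_norm X * vnorm v"
proof (cases "v = 0\<^sub>v m")
  case True
  then have "X *\<^sub>v v = 0\<^sub>v n" using X by auto
  then show ?thesis using True vnorm_eq_0_iff[of "0\<^sub>v n" n] vnorm_eq_0_iff[of "0\<^sub>v m" m] by simp
next
  case False
  then have pos: "0 < vnorm v" using v vnorm_eq_0_iff[of v m] by (simp add: less_le)
  define u where "u = complex_of_real (1 / vnorm v) \<cdot>\<^sub>v v"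
  have u: "u \<in> carrier_vec m" using v by (simp add: u_def)
  have "vnorm u = 1" using pos by (simp add: u_def vnorm_smult norm_divide)
  then have "vnorm (X *\<^sub>v u) \<le> op_norm X"
    using X u by (intro op_norm_unit_bound) (auto simp: cscalar_self_vnorm[of u m])
  moreover have "X *\<^sub>v u = complex_of_real (1 / vnorm v) \<cdot>\<^sub>v (X *\<^sub>v v)"
    unfolding u_def using X v by (rule mult_mat_vec)
  ultimately show ?thesis using pos by (simp add: vnorm_smult norm_divide field_simps)
qed

lemma op_norm_eq_0_iff:
  assumes X: "X \<in> carrier_mat n m" and m: "0 < m"
  shows "op_norm X = 0 \<longleftrightarrow> X = 0\<^sub>m n m"
proof
  assume 0: "op_norm X = 0"
  show "X = 0\<^sub>m n m"
  proof (rule mat_vec_eqI[OF X])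
    fix v :: "complex vec" assume v: "v \<in> carrier_vec m"
    have "vnorm (X *\<^sub>v v) = 0"
      using op_norm_bound[OF X v] 0 vnorm_nonneg[of "X *\<^sub>v v"] by simp
    then show "X *\<^sub>v v = 0\<^sub>m n m *\<^sub>v v" using X v vnorm_eq_0_iff[of "X *\<^sub>v v" n] by auto
  qed simp
next
  assume 0: "X = 0\<^sub>m n m"
  have "op_norm X \<le> 0"
  proof (rule op_norm_leI[OF X m])
    fix v :: "complex vec" assume v: "v \<in> carrier_vec m"
    then have "X *\<^sub>v v = 0\<^sub>v n" using 0 by auto
    then show "vnorm (X *\<^sub>v v) \<le> 0" using vnorm_eq_0_iff[of "0\<^sub>v n" n] by simp
  qed
  then show "op_norm X = 0" using op_norm_nonneg[OF X m] by simp
qed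

lemma op_norm_smult_le:
  assumes X: "X \<in> carrier_mat n m" and m: "0 < m"
  shows "op_norm (c \<cdot>\<^sub>m X) \<le> cmod c * op_norm X"
proof (rule op_norm_leI[of _ n m])
  fix v :: "complex vec" assume v: "v \<in> carrier_vec m" "v \<bullet>c v = 1"
  have "(c \<cdot>\<^sub>m X) *\<^sub>v v = c \<cdot>\<^sub>v (X *\<^sub>v v)" using X v by (intro eq_vecI) auto
  then show "vnorm ((c \<cdot>\<^sub>m X) *\<^sub>v v) \<le> cmod c * op_norm X"
    using op_norm_unit_bound[OF X v] by (simp add: vnorm_smult mult_left_mono)
qed (use X m in auto)

text \<open>The inequality for \<open>c\<close> and the one for \<open>1 / c\<close> together give
  equality.\<close>

lemma op_norm_smult:
  assumes X: "X \<in> carrier_mat n m" and m: "0 < m"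
  shows "op_norm (c \<cdot>\<^sub>m X) = cmod c * op_norm X"
proof (cases "c = 0")
  case True
  then have "c \<cdot>\<^sub>m X = 0\<^sub>m n m" using X by auto
  then show ?thesis using True m op_norm_eq_0_iff[of "0\<^sub>m n m" n m] by simp
next
  case False
  have "X = (1 / c) \<cdot>\<^sub>m (c \<cdot>\<^sub>m X)" using False X by (intro eq_matI) auto
  then have "op_norm X \<le> cmod (1 / c) * op_norm (c \<cdot>\<^sub>m X)"
    using op_norm_smult_le[of "c \<cdot>\<^sub>m X" n m "1 / c"] X m by simp
  then have "cmod c * op_norm X \<le> op_norm (c \<cdot>\<^sub>m X)"
    using False by (simp add: norm_divide field_simps)
  then show ?thesis using op_norm_smult_le[OF X m, of c] by simp
qed

lemma op_norm_triangle:
  assumes X: "X \<in> carrier_mat n m" and Y: "Y \<in> carrier_mat n m" and m: "0 < m"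
  shows "op_norm (X + Y) \<le> op_norm X + op_norm Y"
proof (rule op_norm_leI[of _ n m])
  fix v :: "complex vec" assume v: "v \<in> carrier_vec m" "v \<bullet>c v = 1"
  have "(X + Y) *\<^sub>v v = X *\<^sub>v v + Y *\<^sub>v v" using X Y v by (intro add_mult_distrib_mat_vec)
  then have "vnorm ((X + Y) *\<^sub>v v) \<le> vnorm (X *\<^sub>v v) + vnorm (Y *\<^sub>v v)"
    using X Y v vnorm_triangle[of "X *\<^sub>v v" n "Y *\<^sub>v v"] by simp
  then show "vnorm ((X + Y) *\<^sub>v v) \<le> op_norm X + op_norm Y"
    using op_norm_unit_bound[OF X v] op_norm_unit_bound[OF Y v] by simp
qed (use X Y m in auto)

lemma op_norm_mult:
  assumes X: "X \<in> carrier_mat n m" and Y: "Y \<in> carrier_mat m l" and m: "0 < m" "0 < l"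
  shows "op_norm (X * Y) \<le> op_norm X * op_norm Y"
proof (rule op_norm_leI[of _ n l])
  fix v :: "complex vec" assume v: "v \<in> carrier_vec l" "v \<bullet>c v = 1"
  have "(X * Y) *\<^sub>v v = X *\<^sub>v (Y *\<^sub>v v)" using X Y v by (intro assoc_mult_mat_vec)
  also have "vnorm \<dots> \<le> op_norm X * vnorm (Y *\<^sub>v v)"
    using Y v by (intro op_norm_bound[OF X]) simp
  also have "\<dots> \<le> op_norm X * op_norm Y"
    using op_norm_unit_bound[OF Y v] op_norm_nonneg[OF X m(1)] by (intro mult_left_mono)
  finally show "vnorm ((X * Y) *\<^sub>v v) \<le> op_norm X * op_norm Y" .
qed (use X Y m in auto)

text \<open>On a unit vector the squared length of \<open>X v\<close> is the inner product of
  \<open>X* X v\<close> with \<open>v\<close>, which Cauchy--Schwarz bounds by the norm of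
  \<open>X* X\<close>. This is the essential half of the C*-identity.\<close>

lemma op_norm_sq_le:
  assumes X: "X \<in> carrier_mat n m" and m: "0 < m" "0 < n"
  shows "(op_norm X)\<^sup>2 \<le> op_norm (mat_adjoint X * X)"
proof -
  have X': "mat_adjoint X \<in> carrier_mat m n" using X by simp
  have XX: "mat_adjoint X * X \<in> carrier_mat m m" using X X' by auto
  have "op_norm X \<le> sqrt (op_norm (mat_adjoint X * X))"
  proof (rule op_norm_leI[OF X m(1)])
    fix v :: "complex vec" assume v: "v \<in> carrier_vec m" "v \<bullet>c v = 1"
    have Xv: "X *\<^sub>v v \<in> carrier_vec n" using X v by simp
    have "(vnorm (X *\<^sub>v v))\<^sup>2 = cmod ((X *\<^sub>v v) \<bullet>c (X *\<^sub>v v))"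
      by (simp add: cscalar_self_vnorm[OF Xv] norm_power)
    also have "(X *\<^sub>v v) \<bullet>c (X *\<^sub>v v) = (mat_adjoint X *\<^sub>v (X *\<^sub>v v)) \<bullet>c v"
      by (rule cscalar_adjoint'[OF X Xv v(1), symmetric])
    also have "mat_adjoint X *\<^sub>v (X *\<^sub>v v) = (mat_adjoint X * X) *\<^sub>v v"
      using X X' v by (intro assoc_mult_mat_vec[symmetric])
    also have "cmod (((mat_adjoint X * X) *\<^sub>v v) \<bullet>c v) \<le> vnorm ((mat_adjoint X * X) *\<^sub>v v) * vnorm v"
      using mult_mat_vec_carrier[OF XX v(1)] v(1) by (rule vnorm_cauchy_schwarz)
    also have "\<dots> \<le> op_norm (mat_adjoint X * X)"
      using op_norm_unit_bound[OF XX v] by (simp add: vnorm_unit[OF v(2)])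
    finally show "vnorm (X *\<^sub>v v) \<le> sqrt (op_norm (mat_adjoint X * X))"
      by (rule real_le_rsqrt)
  qed
  then have "(op_norm X)\<^sup>2 \<le> (sqrt (op_norm (mat_adjoint X * X)))\<^sup>2"
    using op_norm_nonneg[OF X m(1)] by (intro power_mono)
  then show ?thesis using op_norm_nonneg[OF XX m(1)] by simp
qed

text \<open>Submultiplicativity turns the preceding bound into one with a factor
  \<open>op_norm X\<close> on both sides; cancelling it leaves the claim, and the case of norm 0 is
  separate.\<close>

lemma op_norm_adjoint_le:
  assumes X: "X \<in> carrier_mat n m" and m: "0 < m" "0 < n"
  shows "op_norm X \<le> op_norm (mat_adjoint X)"
proof -
  have X': "mat_adjoint X \<in> carrier_mat m n" using X by simp
  have "op_norm X * op_norm X \<le> op_norm (mat_adjoint X) * op_norm X"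
    using op_norm_sq_le[OF X m] op_norm_mult[OF X' X m(2) m(1)] by (simp add: power2_eq_square)
  then show ?thesis
    using op_norm_nonneg[OF X m(1)] op_norm_nonneg[OF X' m(2)] by (cases "op_norm X = 0") auto
qed

lemma op_norm_cstar:
  assumes X: "X \<in> carrier_mat n m" and m: "0 < m" "0 < n"
  shows "op_norm (mat_adjoint X * X) = (op_norm X)\<^sup>2"
proof -
  have X': "mat_adjoint X \<in> carrier_mat m n" using X by simp
  have "op_norm (mat_adjoint X) \<le> op_norm X"
    using op_norm_adjoint_le[OF X' m(2) m(1)] by simp
  then have "op_norm (mat_adjoint X * X) \<le> op_norm X * op_norm X"
    using op_norm_mult[OF X' X m(2) m(1)] mult_right_mono[OF _ op_norm_nonneg[OF X m(1)]] order_trans by blast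
  then show ?thesis using op_norm_sq_le[OF X m] by (simp add: power2_eq_square)
qed


section \<open>Subalgebras of matrix algebras\<close>

lemma mat_algebra_simps [simp]:
  "carrier (mat_algebra n) = carrier_mat n n"
  "x \<oplus>\<^bsub>mat_algebra n\<^esub> y = x + y" "x \<otimes>\<^bsub>mat_algebra n\<^esub> y = x * y"
  "c \<odot>\<^bsub>mat_algebra n\<^esub> x = c \<cdot>\<^sub>m x" "star (mat_algebra n) = mat_adjoint"
  "\<zero>\<^bsub>mat_algebra n\<^esub> = 0\<^sub>m n n" "\<one>\<^bsub>mat_algebra n\<^esub> = 1\<^sub>m n" "cnorm (mat_algebra n) = op_norm"
  by (simp_all add: mat_algebra_def)

lemma smult_zero_mat: "X \<in> carrier_mat n m \<Longrightarrow> 0 \<cdot>\<^sub>m X = (0\<^sub>m n m :: complex mat)"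
  by (intro eq_matI) auto

text \<open>Serves both the full and the diagonal matrices. The linear surjection \<open>T\<close>
  from \<open>k\<close>-tuples certifies finite dimension without exhibiting a basis of
  \<open>S\<close>.\<close>

lemma fd_cstar_subalgebra:
  fixes S :: "complex mat set" and T :: "complex vec \<Rightarrow> complex mat"
  assumes S: "star_subalgebra n S" and one: "1\<^sub>m n \<in> S" and n: "0 < n"
    and T: "T ` carrier_vec k = S"
    and T_add: "\<And>v w. v \<in> carrier_vec k \<Longrightarrow> w \<in> carrier_vec k \<Longrightarrow> T (v + w) = T v + T w"
    and T_smult: "\<And>c v. v \<in> carrier_vec k \<Longrightarrow> T (c \<cdot>\<^sub>v v) = c \<cdot>\<^sub>m T v"
  shows "fd_cstar_algebra ((mat_algebra n)\<lparr>carrier := S\<rparr>)"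
proof -
  let ?A = "(mat_algebra n)\<lparr>carrier := S\<rparr>"
  have Sc: "X \<in> carrier_mat n n" if "X \<in> S" for X using S that by (auto simp: star_subalgebra_def)
  have S0: "0\<^sub>m n n \<in> S" and S_add: "\<And>X Y. X \<in> S \<Longrightarrow> Y \<in> S \<Longrightarrow> X + Y \<in> S"
    and S_mult: "\<And>X Y. X \<in> S \<Longrightarrow> Y \<in> S \<Longrightarrow> X * Y \<in> S"
    and S_smult: "\<And>c X. X \<in> S \<Longrightarrow> c \<cdot>\<^sub>m X \<in> S" and S_star: "\<And>X. X \<in> S \<Longrightarrow> mat_adjoint X \<in> S"
    using S by (auto simp: star_subalgebra_def)
  have neg: "\<exists>Y\<in>S. X + Y = 0\<^sub>m n n" "\<exists>Y\<in>S. Y + X = 0\<^sub>m n n" if "X \<in> S" for X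
    using S_smult[OF that, of "-1"] Sc[OF that] by (auto intro!: bexI[of _ "(-1) \<cdot>\<^sub>m X"] eq_matI)
  have comm: "X + Y = Y + X" if "X \<in> S" "Y \<in> S" for X Y
    using Sc[OF that(1)] Sc[OF that(2)] by (rule comm_add_mat)
  have assoc: "X + Y + Z = X + (Y + Z)" if "X \<in> S" "Y \<in> S" "Z \<in> S" for X Y Z
    using Sc[OF that(1)] Sc[OF that(2)] Sc[OF that(3)] by (rule assoc_add_mat)
  have smult: "c \<cdot>\<^sub>m (X + Y) = c \<cdot>\<^sub>m X + c \<cdot>\<^sub>m Y" "(c + d) \<cdot>\<^sub>m X = c \<cdot>\<^sub>m X + d \<cdot>\<^sub>m X"
    "(c * d) \<cdot>\<^sub>m X = c \<cdot>\<^sub>m (d \<cdot>\<^sub>m X)" "1 \<cdot>\<^sub>m X = X" if "X \<in> S" "Y \<in> S" for c d X Y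
    using Sc[OF that(1)] Sc[OF that(2)] by (auto intro!: eq_matI simp: algebra_simps)
  have vs: "vectorspace class_ring ?A"
  proof (rule vs_criteria)
    show "field (class_ring :: complex ring)" by (rule class_field.field_axioms)
  qed (use S0 S_add S_smult neg assoc Sc in
      \<open>auto simp: class_ring_simps smult intro: comm\<close>)
  have lm: "linear_map class_ring (module_vec TYPE(complex) k) ?A T"
    unfolding linear_map_def mod_hom_def mod_hom_axioms_def
    using vs vec_vs vec_module T T_add T_smult
    by (auto simp: vectorspace_def LinearCombinations.module_hom_def module_vec_simps)
  interpret V: vec_space "TYPE(complex)" k .
  interpret T: linear_map class_ring "module_vec TYPE(complex) k" ?A T by (rule lm)
  have fin: "vectorspace.fin_dim class_ring ?A"
    using T by (intro T.surj_fin_dim[OF V.fin_dim]) (simp add: module_vec_simps)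
  have ring: "ring ?A"
  proof (rule ringI)
    show "abelian_group ?A"
      using S0 S_add neg comm assoc Sc by (intro abelian_groupI) auto
    show "monoid ?A"
      using S_mult one Sc by (intro monoidI) (auto intro: assoc_mult_mat[of _ n n] left_mult_one_mat[of _ n n] right_mult_one_mat[of _ n n])
  qed (auto dest!: Sc intro: add_mult_distrib_mat[of _ n n] mult_add_distrib_mat[of _ n n])
  have "1\<^sub>m n \<noteq> (0\<^sub>m n n :: complex mat)"
    using n by (auto dest!: arg_cong[of _ _ "\<lambda>X. X $$ (0, 0)"])
  then have ne: "S \<noteq> {0\<^sub>m n n}" using one by auto
  show ?thesis
    unfolding fd_cstar_algebra_def
    using vs fin ring ne S_star n
    by (auto dest!: Sc simp: mat_adjoint_add[of _ n n] mat_adjoint_mult[of _ n n] mat_adjoint_smult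
        mult_smult_distrib[of _ n n] mult_smult_assoc_mat[of _ n n]
        op_norm_nonneg[of _ n n] op_norm_eq_0_iff[of _ n n] op_norm_smult[of _ n n]
        op_norm_triangle[of _ n n] op_norm_mult[of _ n n _ n] op_norm_cstar[of _ n n])
qed

lemma fd_cstar_mat_algebra:
  assumes "0 < n"
  shows "fd_cstar_algebra (mat_algebra n)"
proof -
  let ?T = "\<lambda>v :: complex vec. mat n n (\<lambda>(i, j). v $ (i * n + j))"
  have "star_subalgebra n (carrier_mat n n)"
    by (auto simp: star_subalgebra_def)
  moreover have "?T ` carrier_vec (n * n) = carrier_mat n n"
  proof (intro subset_antisym subsetI)
    fix X :: "complex mat" assume X: "X \<in> carrier_mat n n"
    have "X = ?T (vec (n * n) (\<lambda>p. X $$ (p div n, p mod n)))"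
      using X by (intro eq_matI) (auto simp: block_index_less)
    then show "X \<in> ?T ` carrier_vec (n * n)" by (intro image_eqI[of _ ?T]) auto
  qed auto
  ultimately have "fd_cstar_algebra ((mat_algebra n)\<lparr>carrier := carrier_mat n n\<rparr>)"
    using assms by (intro fd_cstar_subalgebra[where T = ?T and k = "n * n"])
      (auto intro!: eq_matI simp: block_index_less)
  then show ?thesis by (simp add: mat_algebra_def)
qed

text \<open>A matrix copy of \<open>tuple_algebra n\<close>: the members of
  \<open>transmittable_algebras\<close> have element type \<open>complex mat\<close>, so the tuples
  themselves cannot be one of them.\<close>

definition diag_algebra :: "nat \<Rightarrow> complex mat cstar" where
  "diag_algebra n = (mat_algebra n)\<lparr>carrier := range (mat_diag n)\<rparr>"

lemma diag_algebra_simps [simp]: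
  "carrier (diag_algebra n) = range (mat_diag n)"
  "x \<oplus>\<^bsub>diag_algebra n\<^esub> y = x + y" "x \<otimes>\<^bsub>diag_algebra n\<^esub> y = x * y"
  "c \<odot>\<^bsub>diag_algebra n\<^esub> x = c \<cdot>\<^sub>m x" "star (diag_algebra n) = mat_adjoint"
  "\<zero>\<^bsub>diag_algebra n\<^esub> = 0\<^sub>m n n"
  by (simp_all add: diag_algebra_def)

lemma mat_diag_index: "i < n \<Longrightarrow> j < n \<Longrightarrow> mat_diag n f $$ (i, j) = (if i = j then f i else 0)"
  by (auto simp: mat_diag_def)

lemma mat_diag_dims [simp]: "dim_row (mat_diag n f) = n" "dim_col (mat_diag n f) = n"
  by (auto simp: mat_diag_def)

lemma mat_diag_arith:
  fixes f g :: "nat \<Rightarrow> complex"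
  shows "mat_diag n f + mat_diag n g = mat_diag n (\<lambda>i. f i + g i)"
    "c \<cdot>\<^sub>m mat_diag n f = mat_diag n (\<lambda>i. c * f i)"
    "mat_adjoint (mat_diag n f) = mat_diag n (\<lambda>i. cnj (f i))"
    "0\<^sub>m n n = mat_diag n (\<lambda>i. 0 :: complex)"
  by (auto intro!: eq_matI simp: mat_diag_index)

lemma fd_cstar_diag_algebra:
  assumes "0 < n"
  shows "fd_cstar_algebra (diag_algebra n)"
  unfolding diag_algebra_def
proof (rule fd_cstar_subalgebra[where T = "\<lambda>v. mat_diag n (\<lambda>i. v $ i)" and k = n])
  show "star_subalgebra n (range (mat_diag n))"
    by (auto simp: star_subalgebra_def mat_diag_arith)
  show "1\<^sub>m n \<in> range (mat_diag n)" by (metis mat_diag_one rangeI)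
  show "(\<lambda>v. mat_diag n (($) v)) ` carrier_vec n = range (mat_diag n)"
  proof (intro subset_antisym subsetI)
    fix X assume "X \<in> range (mat_diag n)"
    then obtain f where X: "X = mat_diag n f" by auto
    have "X = mat_diag n (\<lambda>i. vec n f $ i)" unfolding X by (intro eq_matI) (auto simp: mat_diag_index)
    then show "X \<in> (\<lambda>v. mat_diag n (($) v)) ` carrier_vec n"
      by (intro image_eqI[of _ _ "vec n f"]) auto
  qed auto
qed (use assms in \<open>auto intro!: eq_matI simp: mat_diag_index\<close>)


section \<open>Embeddings and isomorphisms\<close>

lemma star_homs_comp:
  assumes "\<pi> \<in> star_homs A B" "\<rho> \<in> star_homs B C"
  shows "\<rho> \<circ> \<pi> \<in> star_homs A C"
proof -
  have "\<pi> x \<in> carrier B" if "x \<in> carrier A" for x using assms(1) that by (auto simp: star_homs_def)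
  then show ?thesis using assms by (simp add: star_homs_def Pi_iff)
qed

lemma cstar_iso_trans: "A \<cong>\<^sub>C B \<Longrightarrow> B \<cong>\<^sub>C C \<Longrightarrow> A \<cong>\<^sub>C C"
  unfolding cstar_iso_def using star_homs_comp bij_betw_trans by blast

lemma cstar_embeds_trans:
  assumes "A \<lesssim>\<^sub>C B" "B \<lesssim>\<^sub>C C"
  shows "A \<lesssim>\<^sub>C C"
proof -
  obtain \<pi> \<rho> where \<pi>: "\<pi> \<in> star_homs A B" "inj_on \<pi> (carrier A)" and \<rho>: "\<rho> \<in> star_homs B C" "inj_on \<rho> (carrier B)"
    using assms by (auto simp: cstar_embeds_def)
  have "\<pi> ` carrier A \<subseteq> carrier B" using \<pi> by (auto simp: star_homs_def)
  then have "inj_on (\<rho> \<circ> \<pi>) (carrier A)" using \<pi> \<rho> by (auto intro: comp_inj_on inj_on_subset)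
  then show ?thesis using star_homs_comp[OF \<pi>(1) \<rho>(1)] by (auto simp: cstar_embeds_def)
qed

lemma fd_cstar_closed:
  assumes "fd_cstar_algebra A"
  shows "x \<in> carrier A \<Longrightarrow> y \<in> carrier A \<Longrightarrow> x \<oplus>\<^bsub>A\<^esub> y \<in> carrier A"
    "x \<in> carrier A \<Longrightarrow> y \<in> carrier A \<Longrightarrow> x \<otimes>\<^bsub>A\<^esub> y \<in> carrier A"
    "x \<in> carrier A \<Longrightarrow> c \<odot>\<^bsub>A\<^esub> x \<in> carrier A"
    "x \<in> carrier A \<Longrightarrow> star A x \<in> carrier A"
proof -
  have "ring A" "vectorspace class_ring A" using assms(1) by (auto simp: fd_cstar_algebra_def)
  then interpret A: ring A + V: vectorspace class_ring A by auto
  show "x \<in> carrier A \<Longrightarrow> y \<in> carrier A \<Longrightarrow> x \<oplus>\<^bsub>A\<^esub> y \<in> carrier A"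
    "x \<in> carrier A \<Longrightarrow> y \<in> carrier A \<Longrightarrow> x \<otimes>\<^bsub>A\<^esub> y \<in> carrier A" by auto
  show "x \<in> carrier A \<Longrightarrow> c \<odot>\<^bsub>A\<^esub> x \<in> carrier A" by (intro V.smult_closed) auto
  show "x \<in> carrier A \<Longrightarrow> star A x \<in> carrier A" using assms by (auto simp: fd_cstar_algebra_def)
qed

text \<open>An inverse image is identified by applying \<open>\<pi>\<close>, provided the candidate
  lies in \<open>carrier A\<close>; \<open>fd\<close> supplies this closure under the
  operations.\<close>

lemma cstar_iso_sym:
  assumes fd: "fd_cstar_algebra A" and iso: "A \<cong>\<^sub>C B"
  shows "B \<cong>\<^sub>C A"
proof -
  obtain \<pi> where \<pi>: "\<pi> \<in> star_homs A B" "bij_betw \<pi> (carrier A) (carrier B)"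
    using iso by (auto simp: cstar_iso_def)
  let ?\<rho> = "inv_into (carrier A) \<pi>"
  have \<rho>: "bij_betw ?\<rho> (carrier B) (carrier A)" using \<pi>(2) by (rule bij_betw_inv_into)
  have mem: "?\<rho> x \<in> carrier A" "\<pi> (?\<rho> x) = x" if "x \<in> carrier B" for x
    using that \<pi>(2) \<rho> by (auto simp: bij_betw_def f_inv_into_f)
  have left: "?\<rho> (\<pi> x) = x" if "x \<in> carrier A" for x
    using that \<pi>(2) by (auto simp: bij_betw_def)
  have eqI: "?\<rho> y = x" if "x \<in> carrier A" "\<pi> x = y" for x y using left that by auto
  have "?\<rho> \<in> star_homs B A"
    unfolding star_homs_def using \<pi>(1) mem fd_cstar_closed[OF fd]
    by (auto simp: star_homs_def intro!: eqI)
  then show ?thesis using \<rho> by (auto simp: cstar_iso_def)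
qed

text \<open>Injectivity sends a basis to an independent set of full size, hence to a basis. It is
  obtained as a basis of the image space \<open>?I\<close>; independence and span are then
  transferred to \<open>V\<close>.\<close>

lemma linear_endo_surj:
  assumes "linear_map K V V T" and fd: "vectorspace.fin_dim K V" and inj: "inj_on T (carrier V)"
  shows "T ` carrier V = carrier V"
proof -
  interpret linear_map K V V T by (rule assms(1))
  let ?I = "V\<lparr>carrier := imT\<rparr>"
  have sub: "VectorSpace.subspace K imT V" by (rule imT_is_subspace)
  then have submod: "submodule K imT V" by simp
  interpret I: vectorspace K ?I by (rule V.subspace_is_vs[OF sub])
  have "linear_map K V ?I T"
    unfolding linear_map_def mod_hom_def mod_hom_axioms_def
    using V.vectorspace_axioms I.vectorspace_axioms
    by (auto simp: vectorspace_def LinearCombinations.module_hom_def im_def)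
  then interpret T: linear_map K V ?I T .
  have surj: "T ` carrier V = carrier ?I" by (simp add: im_def)
  obtain B where B: "finite B" "V.basis B" using V.finite_basis_exists[OF fd] by auto
  have "I.basis (T ` B)" by (rule T.linear_inj_image_is_basis[OF inj surj B(2) fd])
  then have TB: "I.lin_indpt (T ` B)" "I.span (T ` B) = imT" "T ` B \<subseteq> imT"
    by (auto simp: I.basis_def)
  have imW: "imT \<subseteq> carrier V" using submod by (auto simp: submodule_def)
  have "card (T ` B) = card B"
    using B(2) by (intro card_image inj_on_subset[OF inj]) (auto simp: V.basis_def)
  also have "\<dots> = V.dim" using B by (simp add: V.dim_basis)
  finally have "V.dim \<le> card (T ` B)" by simp
  moreover have "V.module.lin_indpt (T ` B)" using TB(1) V.module.span_li_not_depend(2)[OF TB(3) submod] by simp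
  ultimately have "V.basis (T ` B)"
    using fd B TB imW by (intro V.dim_li_is_basis) auto
  then have "V.module.span (T ` B) = carrier V" by (simp add: V.basis_def)
  then have "imT = carrier V" using TB(2) V.module.span_li_not_depend(1)[OF TB(3) submod] by simp
  then show ?thesis by (simp add: im_def)
qed

text \<open>The two embeddings compose to an injective endomorphism of a finite-dimensional space.
  It is onto, which forces the outer embedding to be onto as well.\<close>

lemma cstar_embeds_antisym:
  assumes A: "fd_cstar_algebra A" and B: "fd_cstar_algebra B" and "A \<lesssim>\<^sub>C B" "B \<lesssim>\<^sub>C A"
  shows "A \<cong>\<^sub>C B"
proof -
  obtain \<pi> \<rho> where \<pi>: "\<pi> \<in> star_homs A B" "inj_on \<pi> (carrier A)" and \<rho>: "\<rho> \<in> star_homs B A" "inj_on \<rho> (carrier B)"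
    using assms by (auto simp: cstar_embeds_def)
  have \<pi>_im: "\<pi> ` carrier A \<subseteq> carrier B" and \<rho>_im: "\<rho> ` carrier B \<subseteq> carrier A"
    using \<pi> \<rho> by (auto simp: star_homs_def)
  have vs: "vectorspace class_ring A" and fin: "vectorspace.fin_dim class_ring A"
    using A by (auto simp: fd_cstar_algebra_def)
  have "linear_map class_ring A A (\<rho> \<circ> \<pi>)"
    unfolding linear_map_def mod_hom_def mod_hom_axioms_def
    using vs star_homs_comp[OF \<pi>(1) \<rho>(1)] by (auto simp: vectorspace_def LinearCombinations.module_hom_def star_homs_def)
  moreover have "inj_on (\<rho> \<circ> \<pi>) (carrier A)" using \<pi> \<rho> \<pi>_im by (auto intro: comp_inj_on inj_on_subset)
  ultimately have "(\<rho> \<circ> \<pi>) ` carrier A = carrier A" using fin by (intro linear_endo_surj) auto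
  then have "carrier A \<subseteq> \<rho> ` carrier B" using image_mono[OF \<pi>_im, of \<rho>] by (simp add: image_comp)
  then have "\<rho> ` carrier B = carrier A" using \<rho>_im by (intro subset_antisym)
  then have "B \<cong>\<^sub>C A" using \<rho> by (auto simp: cstar_iso_def bij_betw_def)
  then show ?thesis by (rule cstar_iso_sym[OF B])
qed

lemma iso_class_eqI:
  assumes "fd_cstar_algebra A" "A \<cong>\<^sub>C B"
  shows "iso_class A = iso_class B"
proof -
  have "B \<cong>\<^sub>C A" by (rule cstar_iso_sym[OF assms])
  then have "C \<cong>\<^sub>C A \<longleftrightarrow> C \<cong>\<^sub>C B" for C :: "complex mat cstar"
    using cstar_iso_trans[of C A B] cstar_iso_trans[of C B A] assms(2) by blast
  then show ?thesis by (simp add: iso_class_def)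
qed

lemma tuple_algebra_simps [simp]:
  "carrier (tuple_algebra n) = carrier_vec n"
  "x \<oplus>\<^bsub>tuple_algebra n\<^esub> y = x + y" "x \<otimes>\<^bsub>tuple_algebra n\<^esub> y = vec n (\<lambda>i. x $ i * y $ i)"
  "c \<odot>\<^bsub>tuple_algebra n\<^esub> x = c \<cdot>\<^sub>v x" "star (tuple_algebra n) = conjugate"
  by (simp_all add: tuple_algebra_def)

lemma diag_iso_tuple: "diag_algebra n \<cong>\<^sub>C tuple_algebra n"
proof -
  let ?\<pi> = "\<lambda>X :: complex mat. vec n (\<lambda>i. X $$ (i, i))"
  have \<pi>: "?\<pi> (mat_diag n f) = vec n f" for f by (auto simp: mat_diag_index)
  have "?\<pi> \<in> star_homs (diag_algebra n) (tuple_algebra n)"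
    unfolding star_homs_def by (auto simp: \<pi> mat_diag_arith)
  moreover have "bij_betw ?\<pi> (range (mat_diag n)) (carrier_vec n)"
    unfolding bij_betw_def
  proof (intro conjI inj_onI subset_antisym subsetI)
    fix X Y assume "X \<in> range (mat_diag n)" "Y \<in> range (mat_diag n)" and eq: "?\<pi> X = ?\<pi> Y"
    then obtain f g where fg: "X = mat_diag n f" "Y = mat_diag n g" by auto
    have "vec n f $ i = vec n g $ i" for i using eq by (simp add: fg \<pi>)
    then have "f i = g i" if "i < n" for i using that by (metis index_vec)
    then show "X = Y" unfolding fg by (intro eq_matI) (auto simp: mat_diag_index)
  next
    fix v :: "complex vec" assume v: "v \<in> carrier_vec n"
    have "v = ?\<pi> (mat_diag n (\<lambda>i. v $ i))" using v by (auto simp: \<pi>)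
    then show "v \<in> ?\<pi> ` range (mat_diag n)" by blast
  qed auto
  ultimately show ?thesis by (auto simp: cstar_iso_def)
qed

section \<open>Obstructions to embedding\<close>

lemma star_homs_commutes:
  assumes "\<pi> \<in> star_homs A B" "inj_on \<pi> (carrier A)" "fd_cstar_algebra A"
    and "\<And>x y. x \<in> carrier B \<Longrightarrow> y \<in> carrier B \<Longrightarrow> x \<otimes>\<^bsub>B\<^esub> y = y \<otimes>\<^bsub>B\<^esub> x"
    and x: "x \<in> carrier A" and y: "y \<in> carrier A"
  shows "x \<otimes>\<^bsub>A\<^esub> y = y \<otimes>\<^bsub>A\<^esub> x"
proof (rule inj_onD[OF assms(2)])
  have "\<pi> x \<in> carrier B" "\<pi> y \<in> carrier B" using assms(1) x y by (auto simp: star_homs_def)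
  then show "\<pi> (x \<otimes>\<^bsub>A\<^esub> y) = \<pi> (y \<otimes>\<^bsub>A\<^esub> x)"
    using assms(1,4) x y by (simp add: star_homs_def)
qed (use fd_cstar_closed[OF assms(3)] x y in auto)

text \<open>Commutativity would pass to the smaller algebra, but the matrix units at (0, 1) and (1,
  0) have different products in the two orders.\<close>

lemma mat_not_embeds_diag:
  assumes "2 \<le> n"
  shows "\<not> mat_algebra n \<lesssim>\<^sub>C diag_algebra m"
proof
  assume "mat_algebra n \<lesssim>\<^sub>C diag_algebra m"
  then obtain \<pi> where \<pi>: "\<pi> \<in> star_homs (mat_algebra n) (diag_algebra m)" "inj_on \<pi> (carrier (mat_algebra n))"
    by (auto simp: cstar_embeds_def)
  let ?E = "\<lambda>k l. ket_bra (unit_vec n k) (unit_vec n l)"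
  have "x \<otimes>\<^bsub>diag_algebra m\<^esub> y = y \<otimes>\<^bsub>diag_algebra m\<^esub> x"
    if "x \<in> carrier (diag_algebra m)" "y \<in> carrier (diag_algebra m)" for x y
    using that by (auto simp: mult.commute)
  from star_homs_commutes[OF \<pi> fd_cstar_mat_algebra this, of "?E 0 1" "?E 1 0"]
  have "?E 0 1 * ?E 1 0 = ?E 1 0 * ?E 0 1" using assms by simp
  moreover have "?E 0 1 * ?E 1 0 = ?E 0 0"
    using assms by (simp add: mult_ket_bra[of _ n n _ _ n] ket_bra_mult_vec[of _ n _ n] cscalar_unit_vec[of _ n])
  moreover have "?E 1 0 * ?E 0 1 = ?E 1 1"
    using assms by (simp add: mult_ket_bra[of _ n n _ _ n] ket_bra_mult_vec[of _ n _ n] cscalar_unit_vec[of _ n])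
  ultimately have "?E 0 0 $$ (0, 0) = ?E 1 1 $$ (0, 0)" by simp
  then show False using assms by simp
qed

lemma mult_mat_2_index:
  fixes p q :: "complex mat"
  assumes "p \<in> carrier_mat 2 2" "q \<in> carrier_mat 2 2" "i < 2" "j < 2"
  shows "(p * q) $$ (i, j) = p $$ (i, 0) * q $$ (0, j) + p $$ (i, 1) * q $$ (1, j)"
  using assms by (simp add: scalar_prod_def numeral_2_eq_2)

text \<open>A nonzero \<open>q\<close> killed by \<open>p\<close> makes \<open>p\<close> singular,
  so Cayley--Hamilton reads \<open>p * p = tr(p) p\<close>. Idempotence and
  \<open>p \<noteq> 0\<close> then force trace 1.\<close>

lemma idempotent_2_trace:
  fixes p q :: "complex mat"
  assumes p: "p \<in> carrier_mat 2 2" and q: "q \<in> carrier_mat 2 2"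
    and idem: "p * p = p" and pq: "p * q = 0\<^sub>m 2 2" and ne: "p \<noteq> 0\<^sub>m 2 2" "q \<noteq> 0\<^sub>m 2 2"
  shows "mat_trace p = 1"
proof -
  define a b c d where abcd: "a = p $$ (0, 0)" "b = p $$ (0, 1)" "c = p $$ (1, 0)" "d = p $$ (1, 1)"
  have ex: "\<exists>i<2. \<exists>j<2. x $$ (i, j) \<noteq> 0" if "x \<in> carrier_mat 2 2" "x \<noteq> 0\<^sub>m 2 2" for x :: "complex mat"
  proof (rule ccontr)
    assume "\<not> ?thesis"
    then have "x = 0\<^sub>m 2 2" using that(1) by (intro eq_matI) auto
    then show False using that(2) by simp
  qed
  obtain i j where ij: "i < 2" "j < 2" "q $$ (i, j) \<noteq> 0" using ex[OF q ne(2)] by auto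
  have "(p * q) $$ (k, j) = 0" if "k < 2" for k using pq ij that by simp
  then have "a * q $$ (0, j) + b * q $$ (1, j) = 0" "c * q $$ (0, j) + d * q $$ (1, j) = 0"
    using mult_mat_2_index[OF p q _ ij(2)] by (auto simp: abcd)
  \<comment> \<open>The adjugate of \<open>p\<close> applied to the image of \<open>(x, y)\<close>
    returns the determinant times \<open>(x, y)\<close>; below, \<open>(x, y)\<close> is a nonzero
    column of \<open>q\<close>.\<close>
  moreover have "(a * d - b * c) * x = d * (a * x + b * y) - b * (c * x + d * y)"
    "(a * d - b * c) * y = a * (c * x + d * y) - c * (a * x + b * y)" for x y
    by (simp_all add: algebra_simps)
  ultimately have "(a * d - b * c) * q $$ (0, j) = 0" "(a * d - b * c) * q $$ (1, j) = 0"
    by (metis mult_zero_right diff_zero)+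
  moreover have "i = 0 \<or> i = 1" using ij by auto
  ultimately have det: "a * d = b * c" using ij by auto
  have sq: "(p * p) $$ (k, l) = p $$ (k, l)" for k l using idem by simp
  have eqs: "a * a + b * c = a" "a * b + b * d = b" "c * a + d * c = c" "c * b + d * d = d"
    using sq[of 0 0] sq[of 0 1] sq[of 1 0] sq[of 1 1] by (simp_all add: mult_mat_2_index[OF p p] abcd)
  \<comment> \<open>Cayley--Hamilton entry by entry, with \<open>det\<close> already
    substituted.\<close>
  have "a * (a + d - 1) = (a * a + b * c) - a" "b * (a + d - 1) = (a * b + b * d) - b"
    "c * (a + d - 1) = (c * a + d * c) - c" "d * (a + d - 1) = (c * b + d * d) - d"
    using det by (simp_all add: algebra_simps)
  then have z: "a * (a + d - 1) = 0" "b * (a + d - 1) = 0" "c * (a + d - 1) = 0" "d * (a + d - 1) = 0"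
    by (simp_all only: eqs diff_self)
  obtain k l where kl: "k < 2" "l < 2" "p $$ (k, l) \<noteq> 0" using ex[OF p ne(1)] by auto
  then have "(k = 0 \<or> k = 1) \<and> (l = 0 \<or> l = 1)" by auto
  then have "a \<noteq> 0 \<or> b \<noteq> 0 \<or> c \<noteq> 0 \<or> d \<noteq> 0" using kl by (auto simp: abcd)
  then have "a + d - 1 = 0" using z by auto
  then show ?thesis using p by (simp add: mat_trace_def abcd numeral_2_eq_2)
qed

text \<open>Three orthogonal nonzero idempotents do not fit: \<open>p 0\<close> and
  \<open>p 1\<close> have trace 1, yet their sum is again an idempotent annihilating
  \<open>p 2\<close>, so its trace would be both 1 and 2.\<close>

lemma diag_3_not_embeds_mat_2: "\<not> diag_algebra 3 \<lesssim>\<^sub>C mat_algebra 2"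
proof
  assume "diag_algebra 3 \<lesssim>\<^sub>C mat_algebra 2"
  then obtain \<pi> where \<pi>: "\<pi> \<in> star_homs (diag_algebra 3) (mat_algebra 2)" "inj_on \<pi> (range (mat_diag 3))"
    by (auto simp: cstar_embeds_def)
  define p where "p = (\<lambda>k :: nat. \<pi> (mat_diag 3 (\<lambda>i. if i = k then 1 else 0)))"
  have p: "p k \<in> carrier_mat 2 2" for k using \<pi>(1) by (auto simp: star_homs_def p_def)
  have hom: "\<pi> (x * y) = \<pi> x * \<pi> y" "\<pi> (x + y) = \<pi> x + \<pi> y" "\<pi> (c \<cdot>\<^sub>m x) = c \<cdot>\<^sub>m \<pi> x"
    if "x \<in> range (mat_diag 3)" "y \<in> range (mat_diag 3)" for x y c
    using \<pi>(1) that by (auto simp: star_homs_def)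
  have zero: "\<pi> (mat_diag 3 (\<lambda>i. 0)) = 0\<^sub>m 2 2"
  proof -
    have "\<pi> (0 \<cdot>\<^sub>m mat_diag 3 (\<lambda>i. 0)) = 0 \<cdot>\<^sub>m \<pi> (mat_diag 3 (\<lambda>i. 0))" by (rule hom(3)) auto
    moreover have "\<pi> (mat_diag 3 (\<lambda>i. 0)) \<in> carrier_mat 2 2" using \<pi>(1) by (auto simp: star_homs_def)
    then have "0 \<cdot>\<^sub>m \<pi> (mat_diag 3 (\<lambda>i. 0)) = 0\<^sub>m 2 2" by (rule smult_zero_mat)
    ultimately show ?thesis by (simp add: mat_diag_arith(2))
  qed
  have mult: "p k * p l = (if k = l then p k else 0\<^sub>m 2 2)" for k l
  proof -
    have "p k * p l = \<pi> (mat_diag 3 (\<lambda>i. if i = k then 1 else 0) * mat_diag 3 (\<lambda>i. if i = l then 1 else 0))"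
      by (simp add: p_def hom(1) del: mat_diag_diag)
    also have "mat_diag 3 (\<lambda>i. if i = k then 1 else 0) * mat_diag 3 (\<lambda>i. if i = l then 1 else 0) =
        mat_diag 3 (\<lambda>i. if k = l then if i = k then 1 else 0 else (0 :: complex))"
      by (auto intro!: arg_cong[where f = "mat_diag 3"])
    finally show ?thesis using zero by (auto simp: p_def)
  qed
  have ne: "p k \<noteq> 0\<^sub>m 2 2" if "k < 3" for k
  proof
    assume "p k = 0\<^sub>m 2 2"
    then have "mat_diag 3 (\<lambda>i. if i = k then 1 else 0) = mat_diag 3 (\<lambda>i. 0 :: complex)"
      unfolding p_def zero[symmetric] by (rule inj_onD[OF \<pi>(2) _ rangeI rangeI])
    then have "mat_diag 3 (\<lambda>i. if i = k then 1 else 0) $$ (k, k) = mat_diag 3 (\<lambda>i. 0 :: complex) $$ (k, k)"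
      by simp
    then show False using that by (simp add: mat_diag_index)
  qed
  have tr: "mat_trace (p 0) = 1" "mat_trace (p 1) = 1"
    using idempotent_2_trace[of "p 0" "p 1"] idempotent_2_trace[of "p 1" "p 0"] p mult ne by auto
  define s where "s = p 0 + p 1"
  have s: "s \<in> carrier_mat 2 2" using p by (simp add: s_def)
  have sp: "s * p 0 = p 0" "s * p 1 = p 1" "s * p 2 = 0\<^sub>m 2 2"
    using p by (simp_all add: s_def add_mult_distrib_mat[of _ 2 2 _ _ 2] mult)
  have "s * (p 0 + p 1) = s * p 0 + s * p 1" using s p by (intro mult_add_distrib_mat)
  then have "s * s = s" by (simp only: sp s_def[symmetric])
  moreover have "s \<noteq> 0\<^sub>m 2 2"
  proof
    assume "s = 0\<^sub>m 2 2"
    then show False using sp(1) ne[of 0] p[of 0] by simp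
  qed
  ultimately have "mat_trace s = 1" using idempotent_2_trace[OF s p[of 2]] sp ne[of 2] by simp
  moreover have "mat_trace s = 2" using tr p by (simp add: s_def mat_trace_add[of _ 2])
  ultimately show False by simp
qed


section \<open>Orthonormal families as isometries\<close>

definition cols_mat :: "nat \<Rightarrow> nat \<Rightarrow> (nat \<Rightarrow> complex vec) \<Rightarrow> complex mat" where
  "cols_mat n r g = mat n r (\<lambda>(i, j). g j $ i)"

lemma cols_mat_carrier [simp]: "cols_mat n r g \<in> carrier_mat n r"
  by (simp add: cols_mat_def)

lemma cols_mat_dim [simp]: "dim_row (cols_mat n r g) = n" "dim_col (cols_mat n r g) = r"
  by (simp_all add: cols_mat_def)

lemma mult_cols_mat:
  assumes "A \<in> carrier_mat m n" "\<And>j. j < r \<Longrightarrow> g j \<in> carrier_vec n"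
  shows "A * cols_mat n r g = cols_mat m r (\<lambda>j. A *\<^sub>v g j)"
proof (rule eq_matI)
  fix i j assume "i < dim_row (cols_mat m r (\<lambda>j. A *\<^sub>v g j))" "j < dim_col (cols_mat m r (\<lambda>j. A *\<^sub>v g j))"
  then have ij: "i < m" "j < r" by auto
  have "col (cols_mat n r g) j = g j"
    using assms(2)[OF ij(2)] ij by (intro eq_vecI) (auto simp: cols_mat_def)
  then show "(A * cols_mat n r g) $$ (i, j) = cols_mat m r (\<lambda>j. A *\<^sub>v g j) $$ (i, j)"
    using assms(1) ij by (simp add: cols_mat_def)
qed (use assms in auto)

lemma adjoint_cols_mat_mult_vec:
  assumes "\<And>j. j < r \<Longrightarrow> g j \<in> carrier_vec n" "v \<in> carrier_vec n"
  shows "mat_adjoint (cols_mat n r g) *\<^sub>v v = vec r (\<lambda>j. v \<bullet>c g j)"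
proof (rule eq_vecI)
  fix j assume "j < dim_vec (vec r (\<lambda>j. v \<bullet>c g j))"
  then have j: "j < r" by simp
  show "(mat_adjoint (cols_mat n r g) *\<^sub>v v) $ j = vec r (\<lambda>j. v \<bullet>c g j) $ j"
    using j assms(2) by (simp add: cscalar_sum[OF assms(1)[OF j]])
      (simp add: scalar_prod_def cols_mat_def lessThan_atLeast0 mult.commute)
qed simp

lemma cols_mat_isometry:
  assumes g: "\<And>j. j < r \<Longrightarrow> g j \<in> carrier_vec n"
    and ortho: "\<And>i j. i < r \<Longrightarrow> j < r \<Longrightarrow> g j \<bullet>c g i = (if i = j then 1 else 0)"
  shows "mat_adjoint (cols_mat n r g) * cols_mat n r g = 1\<^sub>m r"
proof -
  have "mat_adjoint (cols_mat n r g) * cols_mat n r g = cols_mat r r (\<lambda>j. mat_adjoint (cols_mat n r g) *\<^sub>v g j)"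
    by (rule mult_cols_mat[OF _ g]) auto
  also have "\<dots> = cols_mat r r (\<lambda>j. vec r (\<lambda>i. g j \<bullet>c g i))"
    unfolding cols_mat_def[of r r] using adjoint_cols_mat_mult_vec[OF g g]
    by (intro cong_mat) (auto simp del: index_mult_mat_vec)
  also have "\<dots> = 1\<^sub>m r"
    using ortho by (intro eq_matI) (auto simp: cols_mat_def)
  finally show ?thesis .
qed

lemma orthonormal_basisD:
  assumes "orthonormal_basis n e"
  shows "i < n \<Longrightarrow> e i \<in> carrier_vec n"
    "i < n \<Longrightarrow> j < n \<Longrightarrow> e i \<bullet>c e j = (if i = j then 1 else 0)"
  using assms by (auto simp: orthonormal_basis_def)

text \<open>A square isometry is unitary. This is completeness of the family, from which vectors and
  matrices can be compared on the basis alone.\<close>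

lemma orthonormal_basis_unitary:
  assumes "orthonormal_basis n e"
  shows "cols_mat n n e * mat_adjoint (cols_mat n n e) = 1\<^sub>m n"
proof -
  have "mat_adjoint (cols_mat n n e) * cols_mat n n e = 1\<^sub>m n"
    using orthonormal_basisD[OF assms] by (intro cols_mat_isometry) auto
  then show ?thesis by (rule mat_mult_left_right_inverse[rotated -1]) auto
qed

lemma orthonormal_basis_vec_eqI:
  assumes e: "orthonormal_basis n e" and v: "v \<in> carrier_vec n" and w: "w \<in> carrier_vec n"
    and eq: "\<And>i. i < n \<Longrightarrow> v \<bullet>c e i = w \<bullet>c e i"
  shows "v = w"
proof -
  let ?U = "cols_mat n n e"
  have U: "x = ?U *\<^sub>v (mat_adjoint ?U *\<^sub>v x)" if x: "x \<in> carrier_vec n" for x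
  proof -
    have "(?U * mat_adjoint ?U) *\<^sub>v x = ?U *\<^sub>v (mat_adjoint ?U *\<^sub>v x)"
      using x by (intro assoc_mult_mat_vec[of _ n n _ n]) auto
    then show ?thesis using x by (simp add: orthonormal_basis_unitary[OF e])
  qed
  have "mat_adjoint ?U *\<^sub>v v = mat_adjoint ?U *\<^sub>v w"
    using v w eq orthonormal_basisD(1)[OF e] by (auto simp: adjoint_cols_mat_mult_vec)
  then show ?thesis using U[OF v] U[OF w] by simp
qed

lemma orthonormal_basis_mat_eqI:
  assumes e: "orthonormal_basis n e" and A: "A \<in> carrier_mat m n" and B: "B \<in> carrier_mat m n"
    and eq: "\<And>i. i < n \<Longrightarrow> A *\<^sub>v e i = B *\<^sub>v e i"
  shows "A = B"
proof -
  let ?U = "cols_mat n n e"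
  have U: "X = X * ?U * mat_adjoint ?U" if X: "X \<in> carrier_mat m n" for X
  proof -
    have "X * ?U * mat_adjoint ?U = X * (?U * mat_adjoint ?U)"
      using X by (intro assoc_mult_mat[of _ m n _ n _ n]) auto
    then show ?thesis using X by (simp add: orthonormal_basis_unitary[OF e])
  qed
  have "A * ?U = cols_mat m n (\<lambda>j. A *\<^sub>v e j)" "B * ?U = cols_mat m n (\<lambda>j. B *\<^sub>v e j)"
    using A B orthonormal_basisD(1)[OF e] by (auto intro: mult_cols_mat)
  then have "A * ?U = B * ?U" using eq by (auto simp: cols_mat_def intro!: cong_mat)
  then show ?thesis using U[OF A] U[OF B] by simp
qed

lemma kraus_gram_form:
  assumes "set Ks \<subseteq> carrier_mat m n" and x: "x \<in> carrier_vec n" and y: "y \<in> carrier_vec n"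
  shows "(kraus_gram n Ks *\<^sub>v x) \<bullet>c y = (\<Sum>K\<leftarrow>Ks. (K *\<^sub>v x) \<bullet>c (K *\<^sub>v y))"
  using assms(1)
proof (induction Ks)
  case Nil
  have "0\<^sub>m n n *\<^sub>v x = 0\<^sub>v n" using x by (intro eq_vecI) auto
  then show ?case using y by (simp add: cscalar_sum[of _ n])
next
  case (Cons K Ks)
  then have K: "K \<in> carrier_mat m n" and K': "mat_adjoint K \<in> carrier_mat n m" by auto
  have KK: "mat_adjoint K * K \<in> carrier_mat n n" using K K' by auto
  have G: "kraus_gram n Ks \<in> carrier_mat n n" using Cons kraus_gram_carrier[of Ks m n] by simp
  have Kx: "K *\<^sub>v x \<in> carrier_vec m" using K x by simp
  have "(mat_adjoint K * K) *\<^sub>v x = mat_adjoint K *\<^sub>v (K *\<^sub>v x)"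
    using K K' x by (intro assoc_mult_mat_vec)
  then have "((mat_adjoint K * K) *\<^sub>v x) \<bullet>c y = (K *\<^sub>v x) \<bullet>c (K *\<^sub>v y)"
    using cscalar_adjoint'[OF K Kx y] by simp
  moreover have "kraus_gram n (K # Ks) *\<^sub>v x = (mat_adjoint K * K) *\<^sub>v x + kraus_gram n Ks *\<^sub>v x"
    using KK G x by (simp add: add_mult_distrib_mat_vec[of _ n n])
  ultimately show ?case
    using Cons mult_mat_vec_carrier[OF KK x] mult_mat_vec_carrier[OF G x] y
    by (simp add: cscalar_add_left[of _ n])
qed

lemma kraus_gram_eq_one:
  assumes e: "orthonormal_basis n e" and Ks: "set Ks \<subseteq> carrier_mat m n"
    and eq: "\<And>i j. i < n \<Longrightarrow> j < n \<Longrightarrow>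
      (\<Sum>K\<leftarrow>Ks. (K *\<^sub>v e i) \<bullet>c (K *\<^sub>v e j)) = (if i = j then 1 else 0)"
  shows "kraus_gram n Ks = 1\<^sub>m n"
proof (rule orthonormal_basis_mat_eqI[OF e kraus_gram_carrier[OF Ks] one_carrier_mat])
  fix i assume i: "i < n"
  note e' = orthonormal_basisD[OF e]
  show "kraus_gram n Ks *\<^sub>v e i = 1\<^sub>m n *\<^sub>v e i"
  proof (rule orthonormal_basis_vec_eqI[OF e])
    fix j assume j: "j < n"
    show "(kraus_gram n Ks *\<^sub>v e i) \<bullet>c e j = (1\<^sub>m n *\<^sub>v e i) \<bullet>c e j"
      using i j e' kraus_gram_form[OF Ks e'(1)[OF i] e'(1)[OF j]] eq by simp
  qed (use e'(1)[OF i] mult_mat_vec_carrier[OF kraus_gram_carrier[OF Ks] e'(1)[OF i]] in auto)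
qed


section \<open>Sufficient conditions for transmission and embedding\<close>

lemma isometry_conj:
  fixes U X Y :: "complex mat"
  assumes U: "U \<in> carrier_mat n r" and iso: "mat_adjoint U * U = 1\<^sub>m r"
    and X: "X \<in> carrier_mat r r" and Y: "Y \<in> carrier_mat r r"
  shows "(U * X * mat_adjoint U) * (U * Y * mat_adjoint U) = U * (X * Y) * mat_adjoint U"
    "mat_adjoint U * (U * X * mat_adjoint U) * U = X"
    "mat_adjoint (U * X * mat_adjoint U) = U * mat_adjoint X * mat_adjoint U"
proof -
  have U': "mat_adjoint U \<in> carrier_mat r n" using U by simp
  have UX: "U * X \<in> carrier_mat n r" "X * mat_adjoint U \<in> carrier_mat r n"
    "U * Y \<in> carrier_mat n r" "Y * mat_adjoint U \<in> carrier_mat r n" using U U' X Y by auto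
  have UXU: "U * X * mat_adjoint U = U * (X * mat_adjoint U)" "U * Y * mat_adjoint U = U * (Y * mat_adjoint U)"
    using assoc_mult_mat[OF U X U'] assoc_mult_mat[OF U Y U'] by simp_all
  have cancel: "mat_adjoint U * (U * Z) = Z" if Z: "Z \<in> carrier_mat r n" for Z
  proof -
    have "mat_adjoint U * (U * Z) = mat_adjoint U * U * Z" using U U' Z by (intro assoc_mult_mat[symmetric])
    then show ?thesis using Z by (simp add: iso)
  qed
  have "U * X * mat_adjoint U * (U * Y * mat_adjoint U) = U * X * (mat_adjoint U * (U * (Y * mat_adjoint U)))"
    unfolding UXU(2) using UX(1) U' mult_carrier_mat[OF U UX(4)] by (rule assoc_mult_mat)
  also have "mat_adjoint U * (U * (Y * mat_adjoint U)) = Y * mat_adjoint U" by (rule cancel[OF UX(4)])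
  also have "U * X * (Y * mat_adjoint U) = U * X * Y * mat_adjoint U"
    using UX(1) Y U' by (intro assoc_mult_mat[symmetric])
  also have "U * X * Y = U * (X * Y)" using U X Y by (intro assoc_mult_mat)
  finally show "U * X * mat_adjoint U * (U * Y * mat_adjoint U) = U * (X * Y) * mat_adjoint U" .
  have "mat_adjoint U * (U * X * mat_adjoint U) = X * mat_adjoint U" unfolding UXU(1) by (rule cancel[OF UX(2)])
  moreover have "X * mat_adjoint U * U = X * (mat_adjoint U * U)" using X U U' by (intro assoc_mult_mat)
  ultimately show "mat_adjoint U * (U * X * mat_adjoint U) * U = X" using X by (simp add: iso)
  have "mat_adjoint (U * X * mat_adjoint U) = U * mat_adjoint (U * X)"
    using mat_adjoint_mult[OF UX(1) U'] by simp
  also have "\<dots> = U * (mat_adjoint X * mat_adjoint U)" using mat_adjoint_mult[OF U X] by simp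
  also have "\<dots> = U * mat_adjoint X * mat_adjoint U"
    using U mat_adjoint_carrier[OF X] U' by (intro assoc_mult_mat[symmetric])
  finally show "mat_adjoint (U * X * mat_adjoint U) = U * mat_adjoint X * mat_adjoint U" .
qed

text \<open>The range of \<open>U\<close> is the code, with \<open>U\<close> itself as the inclusion
  in \<open>correctable\<close>. \<open>recover\<close> is the fixed-point condition on the adjoint,
  moved through the trace so that \<open>D\<close> and \<open>\<Phi>\<close> can be computed
  directly.\<close>

lemma transmittable_isometry:
  assumes U: "U \<in> carrier_mat n r" and iso: "mat_adjoint U * U = 1\<^sub>m r"
    and R: "star_subalgebra r R" and one: "1\<^sub>m r \<in> R"
    and D: "quantum_channel m r D"
    and recover: "\<And>X Y. X \<in> R \<Longrightarrow> Y \<in> carrier_mat r r \<Longrightarrow>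
      mat_trace (X * D (\<Phi> (U * Y * mat_adjoint U))) = mat_trace (X * Y)"
  shows "transmittable n m \<Phi> ((mat_algebra r)\<lparr>carrier := R\<rparr>)"
proof -
  let ?\<pi> = "\<lambda>X. U * X * mat_adjoint U"
  have Rc: "X \<in> carrier_mat r r" if "X \<in> R" for X using R that by (auto simp: star_subalgebra_def)
  have Rcl: "0\<^sub>m r r \<in> R" "\<And>X Y. X \<in> R \<Longrightarrow> Y \<in> R \<Longrightarrow> X + Y \<in> R" "\<And>X Y. X \<in> R \<Longrightarrow> Y \<in> R \<Longrightarrow> X * Y \<in> R"
    "\<And>c X. X \<in> R \<Longrightarrow> c \<cdot>\<^sub>m X \<in> R" "\<And>X. X \<in> R \<Longrightarrow> mat_adjoint X \<in> R"
    using R by (auto simp: star_subalgebra_def)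
  note conj = isometry_conj(1)[OF U iso] isometry_conj(2,3)[OF U iso _ one_carrier_mat]
  have U': "mat_adjoint U \<in> carrier_mat r n" using U by simp
  have hom: "?\<pi> \<in> star_homs ((mat_algebra r)\<lparr>carrier := R\<rparr>) (mat_algebra n)"
    using U Rc by (auto simp: star_homs_def conj conj_add[of _ n r] conj_smult[of _ n r])
  have inj: "inj_on ?\<pi> R"
    by (rule inj_on_inverseI[of _ "\<lambda>Z. mat_adjoint U * Z * U"]) (simp add: conj Rc)
  have sub: "star_subalgebra n (?\<pi> ` R)"
  proof -
    have "0\<^sub>m n n = ?\<pi> (0\<^sub>m r r)" using U by simp
    then have "0\<^sub>m n n \<in> ?\<pi> ` R" using Rcl(1) by blast
    moreover have "?\<pi> X + ?\<pi> Y \<in> ?\<pi> ` R" "?\<pi> X * ?\<pi> Y \<in> ?\<pi> ` R" if "X \<in> R" "Y \<in> R" for X Y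
      using Rcl(2,3)[OF that] Rc[OF that(1)] Rc[OF that(2)] U
      by (simp_all add: conj flip: conj_add[of _ n r])
    moreover have "c \<cdot>\<^sub>m ?\<pi> X \<in> ?\<pi> ` R" "mat_adjoint (?\<pi> X) \<in> ?\<pi> ` R" if "X \<in> R" for c X
      using Rcl(4,5)[OF that] Rc[OF that] U by (simp_all add: conj flip: conj_smult[of _ n r])
    ultimately show ?thesis using Rc U unfolding star_subalgebra_def by auto
  qed
  have P: "U * mat_adjoint U = ?\<pi> (1\<^sub>m r)" using U by simp
  have unit: "unit_projection (?\<pi> ` R) (U * mat_adjoint U)"
    unfolding unit_projection_def P using one Rc
    by (auto simp: conj left_mult_one_mat[OF Rc] right_mult_one_mat[OF Rc] simp del: right_mult_one_mat)
  have "quantum_channel m r D \<and> (\<forall>X\<in>{mat_adjoint U * A * U |A. A \<in> ?\<pi> ` R}.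
      superop_adjoint r (D \<circ> (\<lambda>Y. \<Phi> (U * Y * mat_adjoint U))) X = X)"
  proof (intro conjI D ballI)
    fix X assume "X \<in> {mat_adjoint U * A * U |A. A \<in> ?\<pi> ` R}"
    then have "X \<in> R" using Rc by (auto simp: conj)
    then show "superop_adjoint r (D \<circ> (\<lambda>Y. \<Phi> (U * Y * mat_adjoint U))) X = X"
      using Rc recover by (intro superop_adjoint_eqI) auto
  qed
  then have "correctable n m \<Phi> (?\<pi> ` R)"
    unfolding correctable_def using sub unit U iso by blast
  then show ?thesis
    unfolding transmittable_def using hom inj by (intro bexI[of _ ?\<pi>]) auto
qed

lemma embeds_image:
  assumes "\<pi> \<in> star_homs A (mat_algebra n)" "inj_on \<pi> (carrier A)"
  shows "A \<lesssim>\<^sub>C (mat_algebra n)\<lparr>carrier := \<pi> ` carrier A\<rparr>"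
  unfolding cstar_embeds_def using assms by (intro bexI[of _ \<pi>]) (auto simp: star_homs_def)

text \<open>\<open>absorb\<close> allows \<open>U\<close> times its adjoint to be inserted between
  two factors, making the compression multiplicative, and lets \<open>B\<close> be rebuilt from its
  compression, making it injective.\<close>

lemma compression_embeds:
  assumes S: "star_subalgebra n S" and U: "U \<in> carrier_mat n r"
    and absorb: "\<And>B. B \<in> S \<Longrightarrow> U * mat_adjoint U * B = B"
  shows "(mat_algebra n)\<lparr>carrier := S\<rparr> \<lesssim>\<^sub>C mat_algebra r"
proof -
  have Sc: "B \<in> carrier_mat n n" if "B \<in> S" for B using S that by (auto simp: star_subalgebra_def)
  let ?\<tau> = "\<lambda>B. mat_adjoint U * B * U"
  have U': "mat_adjoint U \<in> carrier_mat r n" using U by simp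
  have UU: "U * mat_adjoint U \<in> carrier_mat n n" using U U' by auto
  have mult: "?\<tau> (B * C) = ?\<tau> B * ?\<tau> C" if BC: "B \<in> S" "C \<in> S" for B C
  proof -
    note c = Sc[OF BC(1)] Sc[OF BC(2)]
    have UB: "mat_adjoint U * B \<in> carrier_mat r n" "mat_adjoint U * C \<in> carrier_mat r n" "C * U \<in> carrier_mat n r"
      using U U' c by auto
    have "?\<tau> B * ?\<tau> C = mat_adjoint U * B * (U * (mat_adjoint U * C * U))"
      using UB(1) U mult_carrier_mat[OF UB(2) U] by (rule assoc_mult_mat)
    also have "U * (mat_adjoint U * C * U) = U * mat_adjoint U * (C * U)"
      unfolding assoc_mult_mat[OF U' c(2) U] using U U' UB by (intro assoc_mult_mat[symmetric])
    also have "\<dots> = U * mat_adjoint U * C * U" using UU c U by (intro assoc_mult_mat[symmetric])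
    also have "U * mat_adjoint U * C = C" by (rule absorb[OF BC(2)])
    also have "mat_adjoint U * B * (C * U) = mat_adjoint U * B * C * U"
      using UB(1) c(2) U by (intro assoc_mult_mat[symmetric])
    also have "mat_adjoint U * B * C = mat_adjoint U * (B * C)" using U' c by (intro assoc_mult_mat)
    finally show ?thesis by simp
  qed
  have star: "?\<tau> (mat_adjoint B) = mat_adjoint (?\<tau> B)" if B: "B \<in> S" for B
  proof -
    note c = Sc[OF B]
    have "mat_adjoint (?\<tau> B) = mat_adjoint U * mat_adjoint (mat_adjoint U * B)"
      using mult_carrier_mat[OF U' c] U by (rule mat_adjoint_mult)
    also have "mat_adjoint (mat_adjoint U * B) = mat_adjoint B * U"
      using mat_adjoint_mult[OF U' c] by simp
    also have "mat_adjoint U * (mat_adjoint B * U) = ?\<tau> (mat_adjoint B)"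
      using U' mat_adjoint_carrier[OF c] U by (intro assoc_mult_mat[symmetric])
    finally show ?thesis ..
  qed
  have conj: "?\<tau> = (\<lambda>B. mat_adjoint U * B * mat_adjoint (mat_adjoint U))" by simp
  have hom: "?\<tau> \<in> star_homs ((mat_algebra n)\<lparr>carrier := S\<rparr>) (mat_algebra r)"
    using U U' Sc mult star conj_add[OF U'] conj_smult[OF U'] by (auto simp: star_homs_def)
  have "U * ?\<tau> B * mat_adjoint U = B" if B: "B \<in> S" for B
  proof -
    note c = Sc[OF B]
    \<comment> \<open>Absorption on the right follows from absorption on the left by taking adjoints
      within \<open>S\<close>.\<close>
    have "mat_adjoint B \<in> S" using B S by (auto simp: star_subalgebra_def)
    then have "U * mat_adjoint U * mat_adjoint B = mat_adjoint B" by (rule absorb)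
    then have "mat_adjoint (U * mat_adjoint U * mat_adjoint B) = B" by simp
    moreover have "mat_adjoint (U * mat_adjoint U * mat_adjoint B) = B * mat_adjoint (U * mat_adjoint U)"
      using mat_adjoint_mult[OF UU mat_adjoint_carrier[OF c]] by simp
    moreover have "mat_adjoint (U * mat_adjoint U) = U * mat_adjoint U"
      using mat_adjoint_mult[OF U U'] by simp
    ultimately have right: "B * (U * mat_adjoint U) = B" by simp
    have UB: "mat_adjoint U * B \<in> carrier_mat r n" using U' c by auto
    have "U * ?\<tau> B = U * (mat_adjoint U * B) * U" using U UB by (intro assoc_mult_mat[symmetric])
    also have "U * (mat_adjoint U * B) = U * mat_adjoint U * B" using U U' c by (intro assoc_mult_mat[symmetric])
    also have "\<dots> = B" by (rule absorb[OF B])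
    finally have "U * ?\<tau> B * mat_adjoint U = B * U * mat_adjoint U" by simp
    also have "\<dots> = B * (U * mat_adjoint U)" using c U U' by (intro assoc_mult_mat)
    finally show ?thesis using right by simp
  qed
  then have "inj_on ?\<tau> S" by (rule inj_on_inverseI)
  then show ?thesis using hom by (auto simp: cstar_embeds_def)
qed


section \<open>The channel of the theorem\<close>

locale two_maximal_channel =
  fixes e f :: "nat \<Rightarrow> complex vec"
    and \<phi>p \<phi>m :: "complex vec"
    and E1 E2 E3 :: "complex mat"
    and \<Phi> :: "complex mat \<Rightarrow> complex mat"
  assumes e: "orthonormal_basis 4 e"
    and f: "orthonormal_basis 3 f"
    and \<phi>p: "\<phi>p = complex_of_real (1 / sqrt 2) \<cdot>\<^sub>v (f 1 + f 2)"
    and \<phi>m: "\<phi>m = complex_of_real (1 / sqrt 2) \<cdot>\<^sub>v (f 1 - f 2)"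
    and E1: "E1 = ket_bra (f 0) (e 0) + ket_bra (f 1) (e 1)"
    and E2: "E2 = ket_bra \<phi>p (e 2)"
    and E3: "E3 = ket_bra \<phi>m (e 3)"
    and \<Phi>: "\<And>X. X \<in> carrier_mat 4 4 \<Longrightarrow>
           \<Phi> X = E1 * X * mat_adjoint E1 + E2 * X * mat_adjoint E2 + E3 * X * mat_adjoint E3"
begin

text \<open>Keeps the index in \<open>e 1\<close> and \<open>f 1\<close> from being rewritten to
  \<open>Suc 0\<close>.\<close>

declare One_nat_def [simp del]

lemma e_carrier [simp]: "i < 4 \<Longrightarrow> e i \<in> carrier_vec 4"
  using orthonormal_basisD(1)[OF e] .

lemma f_carrier [simp]: "i < 3 \<Longrightarrow> f i \<in> carrier_vec 3"
  using orthonormal_basisD(1)[OF f] .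

lemma e_ortho: "i < 4 \<Longrightarrow> j < 4 \<Longrightarrow> e i \<bullet>c e j = (if i = j then 1 else 0)"
  using orthonormal_basisD(2)[OF e] .

lemma f_ortho: "i < 3 \<Longrightarrow> j < 3 \<Longrightarrow> f i \<bullet>c f j = (if i = j then 1 else 0)"
  using orthonormal_basisD(2)[OF f] .

lemma \<phi>_carrier [simp]: "\<phi>p \<in> carrier_vec 3" "\<phi>m \<in> carrier_vec 3"
  using f_carrier[of 1] f_carrier[of 2] by (auto simp: \<phi>p \<phi>m)

lemma f_dim [simp]: "i < 3 \<Longrightarrow> dim_vec (f i) = 3"
  using carrier_vecD[OF f_carrier] .

lemma \<phi>_dim [simp]: "dim_vec \<phi>p = 3" "dim_vec \<phi>m = 3"
  using \<phi>_carrier by auto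

lemma \<phi>_sums:
  assumes "v \<in> carrier_vec 3"
  shows "\<phi>p \<bullet>c v = complex_of_real (1 / sqrt 2) * (f 1 \<bullet>c v + f 2 \<bullet>c v)"
    "\<phi>m \<bullet>c v = complex_of_real (1 / sqrt 2) * (f 1 \<bullet>c v - f 2 \<bullet>c v)"
proof -
  have "f 1 \<in> carrier_vec 3" "f 2 \<in> carrier_vec 3" by auto
  moreover from this have "f 1 - f 2 = f 1 + (-1) \<cdot>\<^sub>v f 2" by (intro eq_vecI) auto
  ultimately show "\<phi>p \<bullet>c v = complex_of_real (1 / sqrt 2) * (f 1 \<bullet>c v + f 2 \<bullet>c v)"
    "\<phi>m \<bullet>c v = complex_of_real (1 / sqrt 2) * (f 1 \<bullet>c v - f 2 \<bullet>c v)"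
    using assms by (simp_all add: \<phi>p \<phi>m cscalar_smult_left[of _ 3] cscalar_add_left[of _ 3] del: of_real_divide)
qed

text \<open>The nonzero overlaps of \<open>f 1\<close> with \<open>\<phi>p\<close> and
  \<open>\<phi>m\<close> are the source of the cross terms in \<open>E_forms\<close>, and so of the
  relations tying \<open>e 1\<close> to \<open>e 2\<close> and \<open>e 3\<close>.\<close>

lemma f_\<phi>:
  "\<phi>p \<bullet>c f 0 = 0" "\<phi>m \<bullet>c f 0 = 0" "f 0 \<bullet>c \<phi>p = 0" "f 0 \<bullet>c \<phi>m = 0"
  "f 1 \<bullet>c \<phi>p = complex_of_real (1 / sqrt 2)" "f 2 \<bullet>c \<phi>p = complex_of_real (1 / sqrt 2)"
  "f 1 \<bullet>c \<phi>m = complex_of_real (1 / sqrt 2)" "f 2 \<bullet>c \<phi>m = - complex_of_real (1 / sqrt 2)"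
proof -
  have swap: "f i \<bullet>c v = cnj (v \<bullet>c f i)" if "i < 3" "v \<in> carrier_vec 3" for i v
    using that by (intro cscalar_swap[of _ 3]) auto
  show "\<phi>p \<bullet>c f 0 = 0" "\<phi>m \<bullet>c f 0 = 0" by (simp_all add: \<phi>_sums f_ortho)
  then show "f 0 \<bullet>c \<phi>p = 0" "f 0 \<bullet>c \<phi>m = 0" using swap[of 0] by simp_all
  show "f 1 \<bullet>c \<phi>p = complex_of_real (1 / sqrt 2)" "f 2 \<bullet>c \<phi>p = complex_of_real (1 / sqrt 2)"
    "f 1 \<bullet>c \<phi>m = complex_of_real (1 / sqrt 2)" "f 2 \<bullet>c \<phi>m = - complex_of_real (1 / sqrt 2)"
    by (simp_all add: swap[of _ \<phi>p] swap[of _ \<phi>m] \<phi>_sums f_ortho del: of_real_divide)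
qed

lemma \<phi>_ortho: "\<phi>p \<bullet>c \<phi>p = 1" "\<phi>m \<bullet>c \<phi>m = 1" "\<phi>p \<bullet>c \<phi>m = 0" "\<phi>m \<bullet>c \<phi>p = 0"
proof -
  have "complex_of_real (1 / sqrt 2) * (complex_of_real (1 / sqrt 2) + complex_of_real (1 / sqrt 2)) =
      complex_of_real (1 / sqrt 2 * (1 / sqrt 2 + 1 / sqrt 2))" by (simp only: of_real_mult of_real_add)
  also have "1 / sqrt 2 * (1 / sqrt 2 + 1 / sqrt 2) = 1" by (simp add: field_simps)
  finally show "\<phi>p \<bullet>c \<phi>p = 1" "\<phi>m \<bullet>c \<phi>m = 1" by (simp_all add: \<phi>_sums f_\<phi> del: of_real_divide)
  show "\<phi>p \<bullet>c \<phi>m = 0" "\<phi>m \<bullet>c \<phi>p = 0" by (simp_all add: \<phi>_sums f_\<phi>)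
qed

lemma E_carrier [simp]: "E1 \<in> carrier_mat 3 4" "E2 \<in> carrier_mat 3 4" "E3 \<in> carrier_mat 3 4"
  by (auto simp: E1 E2 E3)

lemma E_mult_vec:
  assumes "x \<in> carrier_vec 4"
  shows "E1 *\<^sub>v x = (x \<bullet>c e 0) \<cdot>\<^sub>v f 0 + (x \<bullet>c e 1) \<cdot>\<^sub>v f 1" "E2 *\<^sub>v x = (x \<bullet>c e 2) \<cdot>\<^sub>v \<phi>p" "E3 *\<^sub>v x = (x \<bullet>c e 3) \<cdot>\<^sub>v \<phi>m"
  using assms
  by (simp_all add: E1 E2 E3 ket_bra_mult_vec[of _ 3 _ 4] add_mult_distrib_mat_vec[of _ 3 4])

text \<open>The products of one Kraus operator with the adjoint of another, as sesquilinear forms.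
  Only the product of \<open>E1\<close> with its own adjoint has rank two; the four others listed
  have rank one.\<close>

lemma E_forms:
  assumes x: "x \<in> carrier_vec 4" and y: "y \<in> carrier_vec 4"
  shows "(E1 *\<^sub>v x) \<bullet>c (E1 *\<^sub>v y) = (x \<bullet>c e 0) * cnj (y \<bullet>c e 0) + (x \<bullet>c e 1) * cnj (y \<bullet>c e 1)"
    "(E2 *\<^sub>v x) \<bullet>c (E2 *\<^sub>v y) = (x \<bullet>c e 2) * cnj (y \<bullet>c e 2)"
    "(E3 *\<^sub>v x) \<bullet>c (E3 *\<^sub>v y) = (x \<bullet>c e 3) * cnj (y \<bullet>c e 3)"
    "(E1 *\<^sub>v x) \<bullet>c (E2 *\<^sub>v y) = complex_of_real (1 / sqrt 2) * ((x \<bullet>c e 1) * cnj (y \<bullet>c e 2))"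
    "(E1 *\<^sub>v x) \<bullet>c (E3 *\<^sub>v y) = complex_of_real (1 / sqrt 2) * ((x \<bullet>c e 1) * cnj (y \<bullet>c e 3))"
  unfolding E_mult_vec[OF x] E_mult_vec[OF y]
  by (simp_all add: cscalar_add_left[of _ 3] cscalar_add_right[of _ 3] cscalar_smult_left[of _ 3]
      cscalar_smult_right[of _ 3] f_ortho \<phi>_ortho f_\<phi> del: of_real_divide)

lemma less_4_cases: "i < 4 \<Longrightarrow> i = 0 \<or> i = 1 \<or> i = 2 \<or> i = (3 :: nat)"
  by auto

lemma less_3_cases: "i < 3 \<Longrightarrow> i = 0 \<or> i = 1 \<or> i = (2 :: nat)"
  by auto

lemma \<Phi>_kraus: "X \<in> carrier_mat 4 4 \<Longrightarrow> \<Phi> X = kraus_map 3 [E1, E2, E3] X"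
  using conj_carrier[OF E_carrier(1), of X] conj_carrier[OF E_carrier(2), of X] conj_carrier[OF E_carrier(3), of X]
  by (simp add: \<Phi> assoc_add_mat[of _ 3 3])

lemma channel: "quantum_channel 4 3 \<Phi>"
proof (rule quantum_channel_kraus_map[OF _ _ \<Phi>_kraus])
  show "kraus_gram 4 [E1, E2, E3] = 1\<^sub>m 4"
  proof (rule kraus_gram_eq_one[OF e, where m = 3])
    fix i j :: nat assume ij: "i < 4" "j < 4"
    then show "(\<Sum>K\<leftarrow>[E1, E2, E3]. (K *\<^sub>v e i) \<bullet>c (K *\<^sub>v e j)) = (if i = j then 1 else 0)"
      using less_4_cases[OF ij(1)] by (simp add: E_forms e_ortho)
  qed auto
qed auto


subsection \<open>Two transmittable algebras\<close>

lemma M2_transmittable: "mat_algebra 2 \<in> transmittable_algebras 4 3 \<Phi>"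
proof -
  let ?U = "cols_mat 4 2 e" and ?W = "cols_mat 3 2 f" and ?K = "ket_bra (unit_vec 2 0) (f 2)"
  let ?D = "kraus_map 2 [mat_adjoint ?W, ?K]"
  have U: "mat_adjoint ?U * ?U = 1\<^sub>m 2" by (rule cols_mat_isometry) (auto simp: e_ortho)
  have W: "mat_adjoint ?W * ?W = 1\<^sub>m 2" by (rule cols_mat_isometry) (auto simp: f_ortho)
  have W_f: "mat_adjoint ?W *\<^sub>v f i = vec 2 (\<lambda>j. f i \<bullet>c f j)" if "i < 3" for i
    using that by (intro adjoint_cols_mat_mult_vec) auto
  have K_f: "?K *\<^sub>v f i = (f i \<bullet>c f 2) \<cdot>\<^sub>v unit_vec 2 0" if "i < 3" for i
    using that by (intro ket_bra_mult_vec[of _ 2 _ 3]) auto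
  have Kc: "?K \<in> carrier_mat 2 3" by simp
  have D: "quantum_channel 3 2 ?D"
  proof (rule quantum_channel_kraus_map)
    show "kraus_gram 3 [mat_adjoint ?W, ?K] = 1\<^sub>m 3"
    proof (rule kraus_gram_eq_one[OF f, where m = 2])
      fix i j :: nat assume ij: "i < 3" "j < 3"
      have "(\<Sum>K\<leftarrow>[mat_adjoint ?W, ?K]. (K *\<^sub>v f i) \<bullet>c (K *\<^sub>v f j)) =
          vec 2 (\<lambda>k. f i \<bullet>c f k) \<bullet>c vec 2 (\<lambda>k. f j \<bullet>c f k) + (f i \<bullet>c f 2) * cnj (f j \<bullet>c f 2)"
        using ij by (simp add: W_f K_f cscalar_smult_left[of _ 2] cscalar_smult_right[of _ 2] cscalar_unit_vec[of _ 2]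
            del: index_mult_mat_vec)
      also have "vec 2 (\<lambda>k. f i \<bullet>c f k) \<bullet>c vec 2 (\<lambda>k. f j \<bullet>c f k) =
          (f i \<bullet>c f 0) * cnj (f j \<bullet>c f 0) + (f i \<bullet>c f 1) * cnj (f j \<bullet>c f 1)"
        by (simp add: cscalar_sum[of _ 2] numeral_2_eq_2 One_nat_def)
      finally show "(\<Sum>K\<leftarrow>[mat_adjoint ?W, ?K]. (K *\<^sub>v f i) \<bullet>c (K *\<^sub>v f j)) = (if i = j then 1 else 0)"
        using less_3_cases[OF ij(1)] ij by (auto simp: f_ortho)
    qed auto
  qed auto
  have EU: "E1 * ?U = ?W" "E2 * ?U = 0\<^sub>m 3 2" "E3 * ?U = 0\<^sub>m 3 2"
  proof -
    have "E1 *\<^sub>v e j = f j" "E2 *\<^sub>v e j = 0\<^sub>v 3" "E3 *\<^sub>v e j = 0\<^sub>v 3" if "j < 2" for j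
    proof -
      have "j = 0 \<or> j = 1" using that by auto
      then show "E1 *\<^sub>v e j = f j" "E2 *\<^sub>v e j = 0\<^sub>v 3" "E3 *\<^sub>v e j = 0\<^sub>v 3"
        by (auto simp: E_mult_vec e_ortho intro!: eq_vecI)
    qed
    then show "E1 * ?U = ?W" "E2 * ?U = 0\<^sub>m 3 2" "E3 * ?U = 0\<^sub>m 3 2"
      by (subst mult_cols_mat[of _ 3]; auto simp: cols_mat_def intro!: eq_matI)+
  qed
  have KW: "?K * ?W = 0\<^sub>m 2 2"
  proof -
    have "?K * ?W = cols_mat 2 2 (\<lambda>j. ?K *\<^sub>v f j)" using Kc by (intro mult_cols_mat) auto
    also have "\<dots> = 0\<^sub>m 2 2" by (intro eq_matI) (auto simp: cols_mat_def K_f f_ortho simp del: index_mult_mat_vec)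
    finally show ?thesis .
  qed
  have "transmittable 4 3 \<Phi> ((mat_algebra 2)\<lparr>carrier := carrier_mat 2 2\<rparr>)"
  proof (rule transmittable_isometry[OF _ U _ _ D])
    show "star_subalgebra 2 (carrier_mat 2 2)" by (auto simp: star_subalgebra_def)
    fix X Y :: "complex mat" assume X: "X \<in> carrier_mat 2 2" and Y: "Y \<in> carrier_mat 2 2"
    have "?U * Y * mat_adjoint ?U \<in> carrier_mat 4 4" using Y by (intro conj_carrier) auto
    then have "\<Phi> (?U * Y * mat_adjoint ?U) = kraus_map 3 [E1, E2, E3] (?U * Y * mat_adjoint ?U)"
      by (rule \<Phi>_kraus)
    also have "\<dots> = kraus_map 3 (map (\<lambda>K. K * ?U) [E1, E2, E3]) Y"
      using Y by (intro kraus_map_comp) auto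
    also have "\<dots> = ?W * Y * mat_adjoint ?W"
      using Y conj_carrier[of ?W 3 2 Y] by (simp add: EU)
    also have "?D (?W * Y * mat_adjoint ?W) = kraus_map 2 (map (\<lambda>K. K * ?W) [mat_adjoint ?W, ?K]) Y"
      using Y Kc by (intro kraus_map_comp) auto
    also have "\<dots> = Y" using Y by (simp add: W KW)
    finally show "mat_trace (X * ?D (\<Phi> (?U * Y * mat_adjoint ?U))) = mat_trace (X * Y)" by simp
  qed auto
  moreover have "(mat_algebra 2)\<lparr>carrier := carrier_mat 2 2\<rparr> = mat_algebra 2" by (simp add: mat_algebra_def)
  ultimately show ?thesis
    using fd_cstar_mat_algebra[of 2] by (simp add: transmittable_algebras_def)
qed

lemma C3_transmittable: "diag_algebra 3 \<in> transmittable_algebras 4 3 \<Phi>"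
proof -
  \<comment> \<open>The shift \<open>k + 1\<close> skips \<open>e 1\<close>: the code vectors
    \<open>e 0\<close>, \<open>e 2\<close>, \<open>e 3\<close> have the orthonormal outputs
    \<open>f 0\<close>, \<open>\<phi>p\<close>, \<open>\<phi>m\<close>.\<close>
  define h where "h = (\<lambda>k. if k = 0 then e 0 else e (k + 1))"
  define g where "g = (\<lambda>k :: nat. if k = 0 then f 0 else if k = 1 then \<phi>p else \<phi>m)"
  let ?u = "unit_vec 3 :: nat \<Rightarrow> complex vec"
  let ?U = "cols_mat 4 3 h"
  have h: "h k \<in> carrier_vec 4" if "k < 3" for k using that by (auto simp: h_def)
  have gc: "g k \<in> carrier_vec 3" for k by (simp add: g_def)
  have g: "orthonormal_basis 3 g"
    unfolding orthonormal_basis_def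
    by (auto simp: gc dest!: less_3_cases) (auto simp: g_def f_ortho \<phi>_ortho f_\<phi>)
  have U: "mat_adjoint ?U * ?U = 1\<^sub>m 3"
    by (rule cols_mat_isometry) (auto simp: h_def e_ortho)
  \<comment> \<open>The recovery measures in the basis \<open>g\<close> and prepares the unit vector
    with the index found.\<close>
  let ?Ks = "[ket_bra (?u 0) (g 0), ket_bra (?u 1) (g 1), ket_bra (?u 2) (g 2)]"
  let ?D = "kraus_map 3 ?Ks"
  have Ks: "set ?Ks \<subseteq> carrier_mat 3 3" using gc by auto
  have D: "quantum_channel 3 3 ?D"
  proof (rule quantum_channel_kraus_map[OF Ks])
    show "kraus_gram 3 ?Ks = 1\<^sub>m 3"
    proof (rule kraus_gram_eq_one[OF g Ks])
      fix i j :: nat assume ij: "i < 3" "j < 3"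
      have "(ket_bra (?u k) (g k) *\<^sub>v g i) \<bullet>c (ket_bra (?u k) (g k) *\<^sub>v g j) = (g i \<bullet>c g k) * cnj (g j \<bullet>c g k)"
        if "k < 3" for k
        using that gc by (simp add: ket_bra_mult_vec[of _ 3 _ 3] cscalar_smult_left[of _ 3] cscalar_smult_right[of _ 3]
            cscalar_unit_vec[of _ 3])
      then show "(\<Sum>K\<leftarrow>?Ks. (K *\<^sub>v g i) \<bullet>c (K *\<^sub>v g j)) = (if i = j then 1 else 0)"
        using less_3_cases[OF ij(1)] ij orthonormal_basisD(2)[OF g] by auto
    qed
  qed auto
  have lin: "linear_superop 3 3 ?D" by (rule linear_superop_kraus_map[OF Ks])
  have kb: "ket_bra v w * Y * mat_adjoint (ket_bra v w) = ((Y *\<^sub>v w) \<bullet>c w) \<cdot>\<^sub>m ket_bra v v"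
    if "Y \<in> carrier_mat 3 3" "v \<in> carrier_vec 3" "w \<in> carrier_vec 3" for Y v w
  proof -
    have "ket_bra v w * Y * ket_bra w v = ket_bra v w * (Y * ket_bra w v)"
      using that by (intro assoc_mult_mat[of _ 3 3 _ 3 _ 3]) auto
    also have "Y * ket_bra w v = ket_bra (Y *\<^sub>v w) v" using that by (intro mult_ket_bra[of _ 3 3 _ _ 3])
    also have "ket_bra v w * ket_bra (Y *\<^sub>v w) v = ket_bra (ket_bra v w *\<^sub>v (Y *\<^sub>v w)) v"
      using that by (intro mult_ket_bra[of _ 3 3 _ _ 3]) auto
    also have "ket_bra v w *\<^sub>v (Y *\<^sub>v w) = ((Y *\<^sub>v w) \<bullet>c w) \<cdot>\<^sub>v v"
      using that by (intro ket_bra_mult_vec[of _ 3 _ 3]) auto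
    finally show ?thesis by (simp add: mat_adjoint_ket_bra ket_bra_smult_left)
  qed
  have Dg: "?D (ket_bra (g k) (g k)) = ket_bra (?u k) (?u k)" if k: "k < 3" for k
  proof -
    have "ket_bra (?u l) (g l) * ket_bra (g k) (g k) * mat_adjoint (ket_bra (?u l) (g l)) =
        (if l = k then 1 else 0) \<cdot>\<^sub>m ket_bra (?u l) (?u l)" if "l < 3" for l
      using that k gc orthonormal_basisD(2)[OF g]
      by (simp add: kb ket_bra_mult_vec[of _ 3 _ 3] cscalar_smult_left[of _ 3])
    then show ?thesis using less_3_cases[OF k] by (auto intro!: eq_matI)
  qed
  have EU: "E1 * ?U = ket_bra (g 0) (?u 0)" "E2 * ?U = ket_bra (g 1) (?u 1)" "E3 * ?U = ket_bra (g 2) (?u 2)"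
  proof -
    have "E1 *\<^sub>v h j = (if j = 0 then g 0 else 0\<^sub>v 3)" "E2 *\<^sub>v h j = (if j = 1 then g 1 else 0\<^sub>v 3)"
      "E3 *\<^sub>v h j = (if j = 2 then g 2 else 0\<^sub>v 3)" if "j < 3" for j
      using less_3_cases[OF that] by (auto simp: E_mult_vec e_ortho h_def g_def intro!: eq_vecI)
    moreover have "A * ?U = ket_bra (g k) (?u k)"
      if A: "A \<in> carrier_mat 3 4" and k: "k < 3"
        and Ah: "\<And>j. j < 3 \<Longrightarrow> A *\<^sub>v h j = (if j = k then g k else 0\<^sub>v 3)" for A k
    proof -
      have "A * ?U = cols_mat 3 3 (\<lambda>j. A *\<^sub>v h j)" by (rule mult_cols_mat[OF A h])
      also have "\<dots> = cols_mat 3 3 (\<lambda>j. if j = k then g k else 0\<^sub>v 3)"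
        unfolding cols_mat_def using Ah by (intro cong_mat) auto
      also have "\<dots> = ket_bra (g k) (?u k)"
        using gc[of k] k by (intro eq_matI) (auto simp: cols_mat_def)
      finally show ?thesis .
    qed
    ultimately show "E1 * ?U = ket_bra (g 0) (?u 0)" "E2 * ?U = ket_bra (g 1) (?u 1)" "E3 * ?U = ket_bra (g 2) (?u 2)"
      by simp_all
  qed
  have "transmittable 4 3 \<Phi> ((mat_algebra 3)\<lparr>carrier := range (mat_diag 3)\<rparr>)"
  proof (rule transmittable_isometry[OF _ U _ _ D])
    show "star_subalgebra 3 (range (mat_diag 3))"
      by (auto simp: star_subalgebra_def mat_diag_arith)
    show "1\<^sub>m 3 \<in> range (mat_diag 3)" by (metis mat_diag_one rangeI)
    fix X Y :: "complex mat" assume X: "X \<in> range (mat_diag 3)" and Y: "Y \<in> carrier_mat 3 3"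
    obtain d where d: "X = mat_diag 3 d" using X by auto
    have "?U * Y * mat_adjoint ?U \<in> carrier_mat 4 4" using Y by (intro conj_carrier) auto
    then have "\<Phi> (?U * Y * mat_adjoint ?U) = kraus_map 3 [E1, E2, E3] (?U * Y * mat_adjoint ?U)"
      by (rule \<Phi>_kraus)
    also have "\<dots> = kraus_map 3 (map (\<lambda>K. K * ?U) [E1, E2, E3]) Y"
      using Y by (intro kraus_map_comp) auto
    also have "\<dots> = Y $$ (0, 0) \<cdot>\<^sub>m ket_bra (g 0) (g 0) + (Y $$ (1, 1) \<cdot>\<^sub>m ket_bra (g 1) (g 1) + Y $$ (2, 2) \<cdot>\<^sub>m ket_bra (g 2) (g 2))"
      (is "_ = ?Z")
    proof -
      have "(Y *\<^sub>v ?u k) \<bullet>c ?u k = Y $$ (k, k)" if "k < 3" for k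
        using that Y by (subst cscalar_unit_vec[of _ 3]) (auto simp: mult_mat_vec_def)
      then show ?thesis using Y gc by (simp add: EU kb)
    qed
    finally have "?D (\<Phi> (?U * Y * mat_adjoint ?U)) = ?D ?Z" by simp
    also have "\<dots> = Y $$ (0, 0) \<cdot>\<^sub>m ket_bra (?u 0) (?u 0) + (Y $$ (1, 1) \<cdot>\<^sub>m ket_bra (?u 1) (?u 1) + Y $$ (2, 2) \<cdot>\<^sub>m ket_bra (?u 2) (?u 2))"
      using gc by (simp add: linear_superopD(2,3)[OF lin] Dg del: kraus_map_simps)
    \<comment> \<open>Encoding, channel and recovery erase the off-diagonal entries of
      \<open>Y\<close>; a trace against a diagonal \<open>X\<close> does not see them.\<close>
    also have "\<dots> = mat_diag 3 (\<lambda>k. Y $$ (k, k))"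
    proof (rule eq_matI)
      fix i j assume "i < dim_row (mat_diag 3 (\<lambda>k. Y $$ (k, k)))" "j < dim_col (mat_diag 3 (\<lambda>k. Y $$ (k, k)))"
      then have ij: "i < 3" "j < 3" by auto
      then show "(Y $$ (0, 0) \<cdot>\<^sub>m ket_bra (?u 0) (?u 0) + (Y $$ (1, 1) \<cdot>\<^sub>m ket_bra (?u 1) (?u 1) + Y $$ (2, 2) \<cdot>\<^sub>m ket_bra (?u 2) (?u 2))) $$ (i, j) =
          mat_diag 3 (\<lambda>k. Y $$ (k, k)) $$ (i, j)"
        using less_3_cases[OF ij(1)] less_3_cases[OF ij(2)] by (auto simp: mat_diag_index)
    qed auto
    finally have "mat_trace (X * ?D (\<Phi> (?U * Y * mat_adjoint ?U))) = (\<Sum>k<3. d k * Y $$ (k, k))"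
      by (simp add: d mat_trace_def mat_diag_index)
    also have "\<dots> = mat_trace (X * Y)"
      using Y by (simp add: d mat_diag_mult_left[of _ 3 3] mat_trace_def)
    finally show "mat_trace (X * ?D (\<Phi> (?U * Y * mat_adjoint ?U))) = mat_trace (X * Y)" .
  qed auto
  then show ?thesis
    using fd_cstar_diag_algebra[of 3] by (simp add: transmittable_algebras_def diag_algebra_def)
qed


subsection \<open>Every transmittable algebra embeds into one of the two\<close>

lemma correctable_embeds:
  assumes corr: "correctable 4 3 \<Phi> S"
  shows "(mat_algebra 4)\<lparr>carrier := S\<rparr> \<lesssim>\<^sub>C mat_algebra 2 \<or> (mat_algebra 4)\<lparr>carrier := S\<rparr> \<lesssim>\<^sub>C diag_algebra 3"
proof -
  have S: "star_subalgebra 4 S" using corr by (simp add: correctable_def)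
  have Sc: "B \<in> carrier_mat 4 4" if "B \<in> S" for B using S that by (auto simp: star_subalgebra_def)
  have S_star: "mat_adjoint B \<in> S" if "B \<in> S" for B using S that by (auto simp: star_subalgebra_def)
  have Es: "set [E1, E2, E3] \<subseteq> carrier_mat 3 4" by auto
  obtain P where P: "unit_projection S P"
    and twine: "\<And>B K L x y. B \<in> S \<Longrightarrow> K \<in> set [E1, E2, E3] \<Longrightarrow> L \<in> set [E1, E2, E3] \<Longrightarrow>
      x \<in> carrier_vec 4 \<Longrightarrow> y \<in> carrier_vec 4 \<Longrightarrow>
      (L *\<^sub>v (P *\<^sub>v x)) \<bullet>c (K *\<^sub>v (B *\<^sub>v y)) = (L *\<^sub>v (mat_adjoint B *\<^sub>v x)) \<bullet>c (K *\<^sub>v (P *\<^sub>v y))"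
    using correctable_intertwines[OF corr Es \<Phi>_kraus] by metis
  have PS: "P \<in> S" "mat_adjoint P = P" "P * P = P" and PB: "\<And>B. B \<in> S \<Longrightarrow> P * B = B" "\<And>B. B \<in> S \<Longrightarrow> B * P = B"
    using P by (auto simp: unit_projection_def)
  have Pc: "P \<in> carrier_mat 4 4" using PS Sc by auto
  define p where "p = (\<lambda>k. P *\<^sub>v e k)"
  have pc: "p k \<in> carrier_vec 4" if "k < 4" for k using Pc that by (auto simp: p_def)
  have Bc: "B *\<^sub>v x \<in> carrier_vec 4" if "B \<in> S" "x \<in> carrier_vec 4" for B x
    using Sc[OF that(1)] that(2) by (rule mult_mat_vec_carrier)
  have Bp: "B *\<^sub>v p k = B *\<^sub>v e k" if B: "B \<in> S" and k: "k < 4" for B k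
  proof -
    have "B *\<^sub>v p k = (B * P) *\<^sub>v e k"
      unfolding p_def using Sc[OF B] Pc e_carrier[OF k] by (rule assoc_mult_mat_vec[symmetric])
    then show ?thesis using PB B by simp
  qed
  have adj: "(mat_adjoint B *\<^sub>v x) \<bullet>c y = x \<bullet>c (B *\<^sub>v y)" if "B \<in> S" "x \<in> carrier_vec 4" "y \<in> carrier_vec 4" for B x y
    using Sc[OF that(1)] that(2,3) by (rule cscalar_adjoint')
  have Padj: "(P *\<^sub>v x) \<bullet>c y = x \<bullet>c (P *\<^sub>v y)" if "x \<in> carrier_vec 4" "y \<in> carrier_vec 4" for x y
    using adj[OF PS(1) that] PS by simp
  define n where "n = (\<lambda>k. p k \<bullet>c e k)"
  have n0: "n k = 0 \<longleftrightarrow> p k = 0\<^sub>v 4" if k: "k < 4" for k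
  proof -
    have "P *\<^sub>v p k = p k" using Bp[OF PS(1) k] by (simp add: p_def)
    then have "p k \<bullet>c p k = n k"
      using Padj[of "p k" "e k"] pc[OF k] k by (simp add: n_def p_def)
    then show ?thesis using conjugate_square_eq_0_vec[OF pc[OF k]] by simp
  qed
  \<comment> \<open>The Rayleigh quotient at \<open>p k\<close>, which is the joint eigenvalue when
    there is one. If \<open>p k = 0\<close>, division by zero makes it 0, which agrees with the zero
    action of \<open>S\<close> on \<open>e k\<close>.\<close>
  define ev where "ev = (\<lambda>k B. ((B *\<^sub>v e k) \<bullet>c e k) / n k)"
  text \<open>\<open>commutes a b\<close> says that \<open>S\<close> commutes with \<open>|P e\<^sub>a\<rangle>\<langle>P e\<^sub>b|\<close>.\<close>
  define commutes where "commutes = (\<lambda>a b. \<forall>B\<in>S. \<forall>x\<in>carrier_vec 4. \<forall>y\<in>carrier_vec 4.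
    (x \<bullet>c p a) * cnj ((B *\<^sub>v y) \<bullet>c e b) = (x \<bullet>c (B *\<^sub>v e a)) * cnj (y \<bullet>c p b))"
  have eig: "B *\<^sub>v e a = ev b B \<cdot>\<^sub>v p a"
    if "commutes a b" and ab: "a < 4" "b < 4" and ne: "p b \<noteq> 0\<^sub>v 4" and B: "B \<in> S" for a b B
  proof -
    let ?m = "(B *\<^sub>v e b) \<bullet>c e b"
    have pe: "e b \<bullet>c p b = n b" using Padj[of "e b" "e b"] ab by (simp add: n_def p_def)
    have nb: "cnj (n b) = n b"
      using cscalar_swap[of "p b" 4 "e b"] ab pc pe by (simp add: n_def)
    \<comment> \<open>The relation \<open>commutes a b\<close> at \<open>y = e b\<close>, with
      \<open>x\<close> left free to determine the vector.\<close>
    have "n b \<cdot>\<^sub>v (B *\<^sub>v e a) = ?m \<cdot>\<^sub>v p a"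
    proof (rule cscalar_eqI)
      fix x :: "complex vec" assume x: "x \<in> carrier_vec 4"
      have "(x \<bullet>c p a) * cnj ?m = (x \<bullet>c (B *\<^sub>v e a)) * cnj (n b)"
        using that(1) B x ab pe by (simp add: commutes_def)
      then show "x \<bullet>c (n b \<cdot>\<^sub>v (B *\<^sub>v e a)) = x \<bullet>c (?m \<cdot>\<^sub>v p a)"
        using x ab pc Bc[OF B] by (simp add: cscalar_smult_right[of _ 4] mult.commute)
    qed (use ab pc Bc[OF B] in auto)
    then have "(1 / n b) \<cdot>\<^sub>v (n b \<cdot>\<^sub>v (B *\<^sub>v e a)) = (1 / n b) \<cdot>\<^sub>v (?m \<cdot>\<^sub>v p a)" by simp
    then show ?thesis using ne n0[OF ab(2)] by (simp add: smult_smult_assoc ev_def)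
  qed
  have pair: "P *\<^sub>v x \<in> carrier_vec 4" "B *\<^sub>v y \<in> carrier_vec 4" "mat_adjoint B *\<^sub>v x \<in> carrier_vec 4"
    "P *\<^sub>v y \<in> carrier_vec 4" "\<And>k. k < 4 \<Longrightarrow> (P *\<^sub>v x) \<bullet>c e k = x \<bullet>c p k"
    "\<And>k. k < 4 \<Longrightarrow> (mat_adjoint B *\<^sub>v x) \<bullet>c e k = x \<bullet>c (B *\<^sub>v e k)"
    "\<And>k. k < 4 \<Longrightarrow> (P *\<^sub>v y) \<bullet>c e k = y \<bullet>c p k"
    if "B \<in> S" "x \<in> carrier_vec 4" "y \<in> carrier_vec 4" for B x y
    using that Bc PS S_star adj Padj by (auto simp: p_def)
  have commutesI: "commutes a b"
    if form: "\<And>x y. x \<in> carrier_vec 4 \<Longrightarrow> y \<in> carrier_vec 4 \<Longrightarrow>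
        (L *\<^sub>v x) \<bullet>c (K *\<^sub>v y) = c * ((x \<bullet>c e a) * cnj (y \<bullet>c e b))"
      and c: "c \<noteq> 0" and K: "K \<in> set [E1, E2, E3]" and L: "L \<in> set [E1, E2, E3]" and ab: "a < 4" "b < 4"
    for L K c a b
    unfolding commutes_def
  proof (intro ballI)
    fix B and x y :: "complex vec" assume B: "B \<in> S" and x: "x \<in> carrier_vec 4" and y: "y \<in> carrier_vec 4"
    note pr = pair[OF B x y]
    show "(x \<bullet>c p a) * cnj ((B *\<^sub>v y) \<bullet>c e b) = (x \<bullet>c (B *\<^sub>v e a)) * cnj (y \<bullet>c p b)"
      using twine[OF B K L x y] form[OF pr(1,2)] form[OF pr(3,4)] pr(5,6)[OF ab(1)] pr(7)[OF ab(2)] c by simp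
  qed
  \<comment> \<open>The factor \<open>1 / sqrt 2\<close> in the two mixed forms is nonzero and
    cancels. The product of \<open>E1\<close> with itself gives only the sum relation
    \<open>rank2\<close>, whose two terms are not yet separated.\<close>
  have rank1: "commutes 2 2" "commutes 3 3" "commutes 1 2" "commutes 1 3"
    using commutesI[of E2 E2 1 2 2] commutesI[of E3 E3 1 3 3]
      commutesI[of E1 E2 "complex_of_real (1 / sqrt 2)" 1 2] commutesI[of E1 E3 "complex_of_real (1 / sqrt 2)" 1 3]
    by (simp_all add: E_forms del: of_real_divide)
  have rank2: "(x \<bullet>c p 0) * cnj ((B *\<^sub>v y) \<bullet>c e 0) + (x \<bullet>c p 1) * cnj ((B *\<^sub>v y) \<bullet>c e 1) =
      (x \<bullet>c (B *\<^sub>v e 0)) * cnj (y \<bullet>c p 0) + (x \<bullet>c (B *\<^sub>v e 1)) * cnj (y \<bullet>c p 1)"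
    if "B \<in> S" "x \<in> carrier_vec 4" "y \<in> carrier_vec 4" for B x y
    using twine[OF that(1) _ _ that(2,3), of E1 E1] pair[OF that] by (simp add: E_forms)
  have zero: "B *\<^sub>v e k = 0\<^sub>v 4" if "p k = 0\<^sub>v 4" "B \<in> S" "k < 4" for B k
  proof -
    have "B *\<^sub>v 0\<^sub>v 4 = 0\<^sub>v 4" using Sc[OF that(2)] by (intro eq_vecI) auto
    then show ?thesis using Bp[OF that(2,3)] that(1) by simp
  qed
  have ev_star: "ev k (mat_adjoint B) = cnj (ev k B)" if "B \<in> S" "k < 4" for B k
  proof -
    have "(mat_adjoint B *\<^sub>v e k) \<bullet>c e k = cnj ((B *\<^sub>v e k) \<bullet>c e k)"
      using adj[OF that(1), of "e k" "e k"] cscalar_swap[OF Bc[OF that(1) e_carrier[OF that(2)]] e_carrier[OF that(2)]] that by simp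
    moreover have "cnj (n k) = n k"
      using adj[OF PS(1), of "e k" "e k"] PS cscalar_swap[OF pc[OF that(2)] e_carrier[OF that(2)]] that
      by (simp add: n_def p_def)
    ultimately show ?thesis by (simp add: ev_def)
  qed
  show ?thesis
  proof (cases "p 1 = 0\<^sub>v 4 \<or> p 2 \<noteq> 0\<^sub>v 4 \<or> p 3 \<noteq> 0\<^sub>v 4")
    case True
    then consider "p 1 = 0\<^sub>v 4" | k where "k \<in> {2, 3}" "p k \<noteq> 0\<^sub>v 4" "commutes 1 k" using rank1 by blast
    \<comment> \<open>\<open>\<mu>\<close> is the eigenvalue at \<open>p 1\<close>: zero if
      \<open>p 1 = 0\<close>, otherwise that of a nonzero \<open>p 2\<close> or \<open>p 3\<close>.
      \<open>\<mu>_det\<close> records that it carries no information beyond \<open>ev 2\<close> and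
      \<open>ev 3\<close>, which injectivity of \<open>\<rho>\<close> will rely on.\<close>
    then obtain \<mu> where eig1: "\<And>B. B \<in> S \<Longrightarrow> B *\<^sub>v e 1 = \<mu> B \<cdot>\<^sub>v p 1"
      and \<mu>_star: "\<And>B. B \<in> S \<Longrightarrow> \<mu> (mat_adjoint B) = cnj (\<mu> B)"
      and \<mu>_det: "\<And>B C. ev 2 B = ev 2 C \<Longrightarrow> ev 3 B = ev 3 C \<Longrightarrow> \<mu> B = \<mu> C"
    proof cases
      case 1
      show ?thesis by (rule that[of "\<lambda>_. 0"]) (use zero[OF 1] 1 in auto)
    next
      case 2
      show ?thesis by (rule that[of "ev k"]) (use eig[OF 2(3)] 2 ev_star in auto)
    qed
    \<comment> \<open>A joint eigenvector of an adjoint-closed algebra yields a commuting rank-one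
      projection up to scale. Subtracting its term from \<open>rank2\<close> isolates the term at
      index 0.\<close>
    have "commutes 1 1"
      unfolding commutes_def
    proof (intro ballI)
      fix B and x y :: "complex vec" assume B: "B \<in> S" and x: "x \<in> carrier_vec 4" and y: "y \<in> carrier_vec 4"
      have "(B *\<^sub>v y) \<bullet>c e 1 = y \<bullet>c (mat_adjoint B *\<^sub>v e 1)"
        using cscalar_adjoint[OF Sc[OF B] y, of "e 1"] by simp
      also have "\<dots> = \<mu> B * (y \<bullet>c p 1)"
        using eig1[OF S_star[OF B]] \<mu>_star[OF B] y pc[of 1] by (simp add: cscalar_smult_right[of _ 4])
      finally show "(x \<bullet>c p 1) * cnj ((B *\<^sub>v y) \<bullet>c e 1) = (x \<bullet>c (B *\<^sub>v e 1)) * cnj (y \<bullet>c p 1)"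
        using eig1[OF B] x pc[of 1] by (simp add: cscalar_smult_right[of _ 4])
    qed
    then have "commutes 0 0" using rank2 by (simp add: commutes_def)
    have diag: "B *\<^sub>v e k = ev k B \<cdot>\<^sub>v p k" if "B \<in> S" "k \<in> {0, 2, 3}" for B k
    proof (cases "p k = 0\<^sub>v 4")
      case True
      then show ?thesis using zero[OF True that(1)] that(2) by auto
    next
      case False
      then show ?thesis using eig[of k k B] \<open>commutes 0 0\<close> rank1 that by auto
    qed
    \<comment> \<open>The same shift past index 1: the diagonal holds \<open>ev 0\<close>,
      \<open>ev 2\<close>, \<open>ev 3\<close>.\<close>
    define \<rho> where "\<rho> = (\<lambda>B. mat_diag 3 (\<lambda>k. ev (if k = 0 then 0 else k + 1) B))"
    have ev_add: "ev k (B + C) = ev k B + ev k C" if "B \<in> S" "C \<in> S" "k < 4" for B C k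
      using that Bc[OF that(1), of "e k"] Bc[OF that(2), of "e k"] Sc[OF that(1)] Sc[OF that(2)]
      by (simp add: ev_def add_mult_distrib_mat_vec[of _ 4 4] cscalar_add_left[of _ 4] add_divide_distrib)
    have ev_smult: "ev k (c \<cdot>\<^sub>m B) = c * ev k B" if "B \<in> S" "k < 4" for B c k
    proof -
      have "(c \<cdot>\<^sub>m B) *\<^sub>v e k = c \<cdot>\<^sub>v (B *\<^sub>v e k)" using Sc[OF that(1)] that(2) e_carrier[OF that(2)] by (intro eq_vecI) auto
      then show ?thesis using that Bc[OF that(1), of "e k"] by (simp add: ev_def cscalar_smult_left[of _ 4])
    qed
    have ev_mult: "ev k (B * C) = ev k B * ev k C" if "B \<in> S" "C \<in> S" and k: "k \<in> {0, 2, 3}" for B C k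
    proof (cases "n k = 0")
      case True
      then show ?thesis by (simp add: ev_def)
    next
      case False
      have k4: "k < 4" using k by auto
      have "(B * C) *\<^sub>v e k = B *\<^sub>v (C *\<^sub>v e k)"
        using Sc[OF that(1)] Sc[OF that(2)] e_carrier[OF k4] by (rule assoc_mult_mat_vec)
      also have "\<dots> = ev k C \<cdot>\<^sub>v (B *\<^sub>v p k)"
        unfolding diag[OF that(2) k] using Sc[OF that(1)] pc[OF k4] by (rule mult_mat_vec)
      also have "B *\<^sub>v p k = ev k B \<cdot>\<^sub>v p k" using Bp[OF that(1) k4] diag[OF that(1) k] by simp
      finally have "((B * C) *\<^sub>v e k) \<bullet>c e k = ev k C * (ev k B * n k)"
        using pc[OF k4] k4 by (simp add: n_def cscalar_smult_left[of _ 4])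
      then have "ev k (B * C) = ev k C * (ev k B * n k) / n k" by (subst ev_def) simp
      then show ?thesis using False by simp
    qed
    have "\<rho> \<in> star_homs ((mat_algebra 4)\<lparr>carrier := S\<rparr>) (diag_algebra 3)"
      unfolding star_homs_def
      by (auto simp: \<rho>_def mat_diag_arith ev_star intro!: eq_matI)
        (auto simp: mat_diag_index ev_add ev_smult ev_mult ev_star dest!: less_3_cases)
    moreover have "inj_on \<rho> S"
    proof (rule inj_onI)
      fix B C assume BC: "B \<in> S" "C \<in> S" and eq: "\<rho> B = \<rho> C"
      have "\<rho> B $$ (k, k) = \<rho> C $$ (k, k)" for k using eq by simp
      from this[of 0] this[of 1] this[of 2]
      have ev_eq: "ev 0 B = ev 0 C" "ev 2 B = ev 2 C" "ev 3 B = ev 3 C"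
        by (simp_all add: \<rho>_def mat_diag_index numeral_2_eq_2 numeral_3_eq_3)
      \<comment> \<open>The three eigenvalues fix the action on \<open>e 0\<close>,
        \<open>e 2\<close>, \<open>e 3\<close>, and through \<open>\<mu>_det\<close> also on
        \<open>e 1\<close>.\<close>
      show "B = C"
      proof (rule orthonormal_basis_mat_eqI[OF e Sc[OF BC(1)] Sc[OF BC(2)]])
        fix i :: nat assume "i < 4"
        then show "B *\<^sub>v e i = C *\<^sub>v e i"
          using less_4_cases[of i] ev_eq \<mu>_det[OF ev_eq(2,3)] eig1[OF BC(1)] eig1[OF BC(2)] diag[OF BC(1)] diag[OF BC(2)]
          by auto
      qed
    qed
    ultimately have "(mat_algebra 4)\<lparr>carrier := S\<rparr> \<lesssim>\<^sub>C diag_algebra 3" by (auto simp: cstar_embeds_def)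
    then show ?thesis by simp
  next
    case False
    then have p23: "p 2 = 0\<^sub>v 4" "p 3 = 0\<^sub>v 4" by auto
    let ?U = "cols_mat 4 2 e"
    have U: "?U \<in> carrier_mat 4 2" and U': "mat_adjoint ?U \<in> carrier_mat 2 4" by auto
    then have UU: "?U * mat_adjoint ?U \<in> carrier_mat 4 4" by auto
    \<comment> \<open>\<open>P\<close> annihilates \<open>e 2\<close> and \<open>e 3\<close>, so its
      range lies in the span of \<open>e 0\<close> and \<open>e 1\<close>.\<close>
    have UP: "?U * mat_adjoint ?U * P = P"
    proof (rule mat_vec_eqI[OF mult_carrier_mat[OF UU Pc] Pc])
      fix x :: "complex vec" assume x: "x \<in> carrier_vec 4"
      have Px: "P *\<^sub>v x \<in> carrier_vec 4" using Pc x by simp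
      have UPx: "mat_adjoint ?U *\<^sub>v (P *\<^sub>v x) = vec 2 (\<lambda>j. (P *\<^sub>v x) \<bullet>c e j)"
        using Px by (intro adjoint_cols_mat_mult_vec) auto
      have "(?U * mat_adjoint ?U * P) *\<^sub>v x = (?U * mat_adjoint ?U) *\<^sub>v (P *\<^sub>v x)"
        using UU Pc x by (rule assoc_mult_mat_vec)
      also have "\<dots> = ?U *\<^sub>v (mat_adjoint ?U *\<^sub>v (P *\<^sub>v x))"
        using U U' Px by (rule assoc_mult_mat_vec)
      also have "\<dots> = P *\<^sub>v x"
      proof (rule orthonormal_basis_vec_eqI[OF e _ Px])
        show "?U *\<^sub>v (mat_adjoint ?U *\<^sub>v (P *\<^sub>v x)) \<in> carrier_vec 4"
          using U UPx by (intro mult_mat_vec_carrier[of _ 4 2]) auto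
        fix i :: nat assume i: "i < 4"
        have "(?U *\<^sub>v (mat_adjoint ?U *\<^sub>v (P *\<^sub>v x))) \<bullet>c e i = (mat_adjoint ?U *\<^sub>v (P *\<^sub>v x)) \<bullet>c (mat_adjoint ?U *\<^sub>v e i)"
          using U UPx i by (intro cscalar_adjoint) auto
        also have "mat_adjoint ?U *\<^sub>v e i = vec 2 (\<lambda>j. e i \<bullet>c e j)"
          using i by (intro adjoint_cols_mat_mult_vec) auto
        also have "(mat_adjoint ?U *\<^sub>v (P *\<^sub>v x)) \<bullet>c vec 2 (\<lambda>j. e i \<bullet>c e j) =
            (\<Sum>j<2. ((P *\<^sub>v x) \<bullet>c e j) * cnj (e i \<bullet>c e j))"
          unfolding UPx by (simp add: cscalar_sum[of _ 2])
        \<comment> \<open>For \<open>i\<close> equal to 2 or 3 the sum is 0, and the right side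
          vanishes because \<open>P\<close> is self-adjoint and kills \<open>e i\<close>.\<close>
        also have "\<dots> = (P *\<^sub>v x) \<bullet>c e i"
        proof -
          have "x \<bullet>c 0\<^sub>v 4 = 0" using cscalar_sum[of "0\<^sub>v 4" 4 x] by simp
          moreover have "P *\<^sub>v e 2 = 0\<^sub>v 4" "P *\<^sub>v e 3 = 0\<^sub>v 4" using p23 by (simp_all add: p_def)
          ultimately have "(P *\<^sub>v x) \<bullet>c e 2 = 0" "(P *\<^sub>v x) \<bullet>c e 3 = 0"
            using Padj[OF x, of "e 2"] Padj[OF x, of "e 3"] by simp_all
          then show ?thesis using less_4_cases[OF i] i by (auto simp: e_ortho numeral_2_eq_2)
        qed
        finally show "(?U *\<^sub>v (mat_adjoint ?U *\<^sub>v (P *\<^sub>v x))) \<bullet>c e i = (P *\<^sub>v x) \<bullet>c e i" .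
      qed
      finally show "(?U * mat_adjoint ?U * P) *\<^sub>v x = P *\<^sub>v x" .
    qed
    have "?U * mat_adjoint ?U * B = B" if B: "B \<in> S" for B
    proof -
      have "?U * mat_adjoint ?U * P * B = ?U * mat_adjoint ?U * (P * B)"
        using UU Pc Sc[OF B] by (rule assoc_mult_mat)
      then show ?thesis using UP PB B by simp
    qed
    then have "(mat_algebra 4)\<lparr>carrier := S\<rparr> \<lesssim>\<^sub>C mat_algebra 2" by (rule compression_embeds[OF S U])
    then show ?thesis by simp
  qed
qed

lemma transmittable_embeds:
  assumes "A \<in> transmittable_algebras 4 3 \<Phi>"
  shows "A \<lesssim>\<^sub>C mat_algebra 2 \<or> A \<lesssim>\<^sub>C diag_algebra 3"
proof -
  obtain \<pi> where \<pi>: "\<pi> \<in> star_homs A (mat_algebra 4)" "inj_on \<pi> (carrier A)" "correctable 4 3 \<Phi> (\<pi> ` carrier A)"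
    using assms by (auto simp: transmittable_algebras_def transmittable_def)
  show ?thesis
    using correctable_embeds[OF \<pi>(3)] cstar_embeds_trans[OF embeds_image[OF \<pi>(1,2)]] by blast
qed

text \<open>Anything above one of the two algebras embeds into one of them, and by the obstructions
  it can only be the same one; antisymmetry then gives an isomorphism. Conversely a maximal algebra
  embeds into one of the two, which is itself transmittable.\<close>

lemma maximal_classes:
  "iso_class ` maximal_algebras (transmittable_algebras 4 3 \<Phi>) =
    {iso_class (mat_algebra 2), iso_class (tuple_algebra 3)}"
proof -
  let ?T = "transmittable_algebras 4 3 \<Phi>"
  have fd: "fd_cstar_algebra A" if "A \<in> ?T" for A using that by (simp add: transmittable_algebras_def)
  note M2 = M2_transmittable and C3 = C3_transmittable
  have "mat_algebra 2 \<cong>\<^sub>C B" if "B \<in> ?T" "mat_algebra 2 \<lesssim>\<^sub>C B" for B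
    using that transmittable_embeds[OF that(1)] cstar_embeds_antisym[OF fd[OF M2] fd[OF that(1)]]
      mat_not_embeds_diag[of 2 3] cstar_embeds_trans[of "mat_algebra 2" B "diag_algebra 3"] by auto
  then have max1: "mat_algebra 2 \<in> maximal_algebras ?T" using M2 by (auto simp: maximal_algebras_def)
  have "diag_algebra 3 \<cong>\<^sub>C B" if "B \<in> ?T" "diag_algebra 3 \<lesssim>\<^sub>C B" for B
    using that transmittable_embeds[OF that(1)] cstar_embeds_antisym[OF fd[OF C3] fd[OF that(1)]]
      diag_3_not_embeds_mat_2 cstar_embeds_trans[of "diag_algebra 3" B "mat_algebra 2"] by auto
  then have max2: "diag_algebra 3 \<in> maximal_algebras ?T" using C3 by (auto simp: maximal_algebras_def)
  have tuple: "iso_class (diag_algebra 3) = iso_class (tuple_algebra 3)"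
    by (rule iso_class_eqI[OF fd[OF C3] diag_iso_tuple])
  have "iso_class A = iso_class (mat_algebra 2) \<or> iso_class A = iso_class (diag_algebra 3)"
    if "A \<in> maximal_algebras ?T" for A
    using that transmittable_embeds[of A] M2 C3 iso_class_eqI[OF fd, of A]
    by (auto simp: maximal_algebras_def)
  then show ?thesis using max1 max2 tuple by force
qed

text \<open>A dominating algebra would lie above both maximal ones and below one of them, so one
  would embed into the other.\<close>

lemma no_dominating: "\<not> dominating_transmittable 4 3 \<Phi> A"
proof
  assume dom: "dominating_transmittable 4 3 \<Phi> A"
  then have "A \<in> transmittable_algebras 4 3 \<Phi>" "mat_algebra 2 \<lesssim>\<^sub>C A" "diag_algebra 3 \<lesssim>\<^sub>C A"
    using M2_transmittable C3_transmittable by (auto simp: dominating_transmittable_def)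
  then show False
    using transmittable_embeds[of A] mat_not_embeds_diag[of 2 3] diag_3_not_embeds_mat_2
      cstar_embeds_trans[of "mat_algebra 2" A "diag_algebra 3"]
      cstar_embeds_trans[of "diag_algebra 3" A "mat_algebra 2"] by auto
qed

end

theorem mainTheorem1:
  fixes e f :: "nat \<Rightarrow> complex vec"
    and \<phi>p \<phi>m :: "complex vec"
    and E1 E2 E3 :: "complex mat"
    and \<Phi> :: "complex mat \<Rightarrow> complex mat"
  assumes "orthonormal_basis 4 e"
    and "orthonormal_basis 3 f"
    and "\<phi>p = complex_of_real (1 / sqrt 2) \<cdot>\<^sub>v (f 1 + f 2)"
    and "\<phi>m = complex_of_real (1 / sqrt 2) \<cdot>\<^sub>v (f 1 - f 2)"
    and "E1 = ket_bra (f 0) (e 0) + ket_bra (f 1) (e 1)"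
    and "E2 = ket_bra \<phi>p (e 2)"
    and "E3 = ket_bra \<phi>m (e 3)"
    and "\<And>X. X \<in> carrier_mat 4 4 \<Longrightarrow>
           \<Phi> X = E1 * X * mat_adjoint E1 + E2 * X * mat_adjoint E2 + E3 * X * mat_adjoint E3"
  shows "quantum_channel 4 3 \<Phi> \<and>
         iso_class ` maximal_algebras (transmittable_algebras 4 3 \<Phi>) =
           {iso_class (mat_algebra 2), iso_class (tuple_algebra 3)} \<and>
         \<not> (\<exists>A. dominating_transmittable 4 3 \<Phi> A)"
proof -
  interpret two_maximal_channel e f \<phi>p \<phi>m E1 E2 E3 \<Phi>
    by (rule two_maximal_channel.intro) (fact assms)+
  show ?thesis using channel maximal_classes no_dominating by blast
qed

end
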